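(* Let $\Omega$ be a smoothly bounded pseudoconvex domain in $\mathbb{C}^n$, $n>1$, and let $P\in b\Omega$ be a point of finite regular type, i.e. $\Delta_{\mathrm{reg}}(b\Omega,P)<\infty$. If $f\in\mathcal{O}(\Omega)\cap\mathrm{Lip}_\alpha(\Omega)$ for some $0<\alpha<1/\Delta_{\mathrm{reg}}(b\Omega,P)$, then there exists $C>0$ such that $$|f(P_\delta)-f(w)|\le C\cdot S(|P_\delta-w|)^\alpha$$ for $\boldsymbol{v}\in\mathbb{T}_P(b\Omega)$, small $\delta>0$, and $w\in\mathbb{D}(\delta)$, where $P_\delta$, $\mathbb{D}(\delta)$ and $S$ are the point, disc and function associated with $P$, $\boldsymbol{v}$, a defining function $r$ of $\Omega$ near $P$ and a choice of coordinates near $P$ (defined in the context). The constant $C$ depends on the local geometry of $b\Omega$ near $P$ and can be chosen to be independent of $\boldsymbol{v}$ and of the choice of coordinates; its only dependence on $f$ is on the Lipschitz-$\alpha$ norm $\|f\|_\alpha$. If, furthermore, the regular type of $b\Omega$ is bounded in a neighbourhood of $P$, then $C$ can be chosen to be independent of $P$ as well.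
   Context: A smoothly bounded domain is a bounded domain with $C^\infty$ boundary $b\Omega$. $\mathcal{O}(\Omega)$ is the set of holomorphic functions on $\Omega$. For $0<\alpha<1$, $\mathrm{Lip}_\alpha(\Omega)$ is the set of $f:\Omega\to\mathbb{C}$ for which there is $C_f>0$ with $|f(x)-f(y)|\le C_f|x-y|^\alpha$ for all $x,y\in\Omega$, and $\|f\|_\alpha=\|f\|_\infty+\sup_{x\ne y}|f(x)-f(y)|/|x-y|^\alpha$. For $P\in b\Omega$, $\boldsymbol{\nu}_P$ is the outward unit normal of $b\Omega$ at $P$, and $\mathbb{T}_P(b\Omega)$ is the set of unit vectors in the complex tangent space to $b\Omega$ at $P$. A smooth real-valued function $r$ defined in a neighbourhood $U$ of $P$ is a defining function of $\Omega$ near $P$ if $\Omega\cap U=\{z\in U: r(z)<0\}$, $b\Omega\cap U=\{z\in U: r(z)=0\}$ and $\nabla r\neq 0$ on $b\Omega\cap U$. For $P\in b\Omega$, a defining function $r$ of $\Omega$ near $P$ (defined on $U$), $\boldsymbol{v}\in\mathbb{T}_P(b\Omega)$, small $t>0$, and a choice of coordinates near $P$ (in which the expressions below are formed), define $$P_t:=P-t\boldsymbol{\nu}_P,\qquad R(t):=\sup\{\rho>0: P_t+\zeta\boldsymbol{v}\in\Omega\cap U\text{ for }\zeta\in\mathbb{C},\ |\zeta|\le\rho\},$$ $$\mathbb{D}(t):=\{P_t+\zeta\boldsymbol{v}:\zeta\in\mathbb{C},\ |\zeta|<R(t)\},\qquad S(t):=\sup\{r(P+\zeta\boldsymbol{v}):\zeta\in\mathbb{C},\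 |\zeta|\le t\}.$$ The objects $R$, $\mathbb{D}$ and $S$ may depend on $P$, $\boldsymbol{v}$, the choice of coordinates and the defining function; this dependence is suppressed in the notation. Regular type: for a smooth function $g$ near $0\in\mathbb{C}$, $\mathrm{ord}(g)$ is the order of vanishing of $g-g(0)$ at $0$; for a vector-valued $F=(f_1,\dots,f_n)$, $\mathrm{ord}(F)=\min_j\mathrm{ord}(f_j)$. Then $\Delta_{\mathrm{reg}}(b\Omega,P)=\sup_F\mathrm{ord}(r\circ F)/\mathrm{ord}(F)$, the supremum being over holomorphic parametrizations $F$, defined near $0\in\mathbb{C}$, of non-singular holomorphic curves with $F(0)=P$. This does not depend on the choice of $r$. *)

theory Defs
  imports "HOL-Complex_Analysis.Complex_Analysis"
begin

text \<open>
  Points of \<open>\<complex>\<^sup>n\<close> are vectors of type \<open>complex^'n\<close>: the library norm is the Euclidean norm, the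
  library inner product is the real part of the Hermitian one, \<open>*\<^sub>R\<close> is scaling by reals and
  \<open>*s\<close> is scaling by complex numbers.
\<close>

section \<open>Smooth functions and smoothly bounded domains\<close>

fun dir_derivs :: "'a list \<Rightarrow> ('a::real_normed_vector \<Rightarrow> 'b::real_normed_vector) \<Rightarrow> 'a \<Rightarrow> 'b" where
  "dir_derivs [] f = f"
| "dir_derivs (v # vs) f = (\<lambda>x. frechet_derivative (dir_derivs vs f) (at x) v)"

text \<open>For open \<open>U\<close>: all iterated directional derivatives exist and are differentiable on \<open>U\<close>.\<close>

definition smooth_on :: "'a set \<Rightarrow> ('a::real_normed_vector \<Rightarrow> 'b::real_normed_vector) \<Rightarrow> bool" where
  "smooth_on U f \<longleftrightarrow> (\<forall>vs. \<forall>x\<in>U. dir_derivs vs f differentiable (at x))"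

definition gradient :: "('a::real_inner \<Rightarrow> real) \<Rightarrow> 'a \<Rightarrow> 'a" where
  "gradient r z = (THE g. GDERIV r z :> g)"

definition defining_function_near ::
    "(complex^'n) set \<Rightarrow> complex^'n \<Rightarrow> (complex^'n \<Rightarrow> real) \<Rightarrow> (complex^'n) set \<Rightarrow> bool" where
  "defining_function_near \<Omega> P r U \<longleftrightarrow>
     open U \<and> P \<in> U \<and> smooth_on U r \<and>
     \<Omega> \<inter> U = {z\<in>U. r z < 0} \<and> frontier \<Omega> \<inter> U = {z\<in>U. r z = 0} \<and>
     (\<forall>z\<in>frontier \<Omega> \<inter> U. gradient r z \<noteq> 0)"

definition smoothly_bounded_domain :: "(complex^'n) set \<Rightarrow> bool" where
  "smoothly_bounded_domain \<Omega> \<longleftrightarrow>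
     open \<Omega> \<and> connected \<Omega> \<and> \<Omega> \<noteq> {} \<and> bounded \<Omega> \<and>
     (\<forall>P\<in>frontier \<Omega>. \<exists>r U. defining_function_near \<Omega> P r U)"

section \<open>Pseudoconvexity\<close>

text \<open>
  Plurisubharmonicity is only needed for continuous real functions, for which the mean value
  over a circle is always a convergent integral.
\<close>

definition continuous_plurisubharmonic_on :: "(complex^'n \<Rightarrow> real) \<Rightarrow> (complex^'n) set \<Rightarrow> bool" where
  "continuous_plurisubharmonic_on u \<Omega> \<longleftrightarrow>
     continuous_on \<Omega> u \<and>
     (\<forall>a b. (\<forall>\<zeta>. cmod \<zeta> \<le> 1 \<longrightarrow> a + \<zeta> *s b \<in> \<Omega>) \<longrightarrow>
        u a \<le> 1 / (2 * pi) * integral {0..2 * pi} (\<lambda>\<theta>. u (a + cis \<theta> *s b)))"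

text \<open>Hartogs pseudoconvexity: minus the logarithm of the distance to the boundary is
  plurisubharmonic (\<open>\<Omega>\<close> is meant to be open with nonempty boundary).\<close>

definition pseudoconvex :: "(complex^'n) set \<Rightarrow> bool" where
  "pseudoconvex \<Omega> \<longleftrightarrow>
     continuous_plurisubharmonic_on (\<lambda>z. - ln (infdist z (frontier \<Omega>))) \<Omega>"

section \<open>Holomorphic functions, holomorphic coordinates and Lipschitz classes\<close>

definition holomorphic_fun_on :: "(complex^'n \<Rightarrow> complex) \<Rightarrow> (complex^'n) set \<Rightarrow> bool" where
  "holomorphic_fun_on f \<Omega> \<longleftrightarrow>
     (\<forall>z\<in>\<Omega>. \<exists>L. (f has_derivative L) (at z) \<and> (\<forall>c v. L (c *s v) = c * L v))"

text \<open>\<open>\<phi>\<close> is a biholomorphic map of the neighbourhood \<open>W\<close> of \<open>P\<close> onto the open set \<open>\<phi> ` W\<close>,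
  and \<open>\<psi>\<close> is its inverse.\<close>

definition holomorphic_coordinates_near ::
    "complex^'n \<Rightarrow> (complex^'n \<Rightarrow> complex^'n) \<Rightarrow> (complex^'n \<Rightarrow> complex^'n) \<Rightarrow> (complex^'n) set \<Rightarrow> bool" where
  "holomorphic_coordinates_near P \<phi> \<psi> W \<longleftrightarrow>
     open W \<and> P \<in> W \<and> open (\<phi> ` W) \<and> (\<forall>z\<in>W. \<psi> (\<phi> z) = z) \<and>
     (\<forall>i. holomorphic_fun_on (\<lambda>z. \<phi> z $ i) W) \<and>
     (\<forall>i. holomorphic_fun_on (\<lambda>z. \<psi> z $ i) (\<phi> ` W))"

definition Lip :: "real \<Rightarrow> (complex^'n) set \<Rightarrow> (complex^'n \<Rightarrow> complex) set" where
  "Lip \<alpha> \<Omega> = {f. \<exists>C>0. \<forall>x\<in>\<Omega>. \<forall>y\<in>\<Omega>. cmod (f x - f y) \<le> C * norm (x - y) powr \<alpha>}"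

definition lip_norm :: "real \<Rightarrow> (complex^'n) set \<Rightarrow> (complex^'n \<Rightarrow> complex) \<Rightarrow> real" where
  "lip_norm \<alpha> \<Omega> f =
     (SUP x\<in>\<Omega>. cmod (f x)) +
     (SUP (x, y)\<in>{(x, y). x \<in> \<Omega> \<and> y \<in> \<Omega> \<and> x \<noteq> y}. cmod (f x - f y) / norm (x - y) powr \<alpha>)"

section \<open>Regular type\<close>

text \<open>Order of vanishing of \<open>g - g 0\<close> at \<open>0\<close>: the supremum of all \<open>k\<close> such that every iterated
  derivative of order less than \<open>k\<close> vanishes at \<open>0\<close>.\<close>

definition vanishing_order :: "(complex \<Rightarrow> 'b::real_normed_vector) \<Rightarrow> enat" where
  "vanishing_order g =
     Sup {enat k |k. \<forall>vs. length vs < k \<longrightarrow> dir_derivs vs (\<lambda>\<zeta>. g \<zeta> - g 0) 0 = 0}"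

definition vanishing_order_vec :: "(complex \<Rightarrow> complex^'n) \<Rightarrow> enat" where
  "vanishing_order_vec F = (INF i. vanishing_order (\<lambda>\<zeta>. F \<zeta> $ i))"

definition regular_curve_at :: "complex^'n \<Rightarrow> (complex \<Rightarrow> complex^'n) \<Rightarrow> bool" where
  "regular_curve_at P F \<longleftrightarrow>
     F 0 = P \<and> (\<exists>e>0. \<forall>i. (\<lambda>\<zeta>. F \<zeta> $ i) holomorphic_on ball 0 e) \<and>
     (\<exists>i. deriv (\<lambda>\<zeta>. F \<zeta> $ i) 0 \<noteq> 0)"

text \<open>The regular type at \<open>P\<close> of the hypersurface \<open>{r = 0}\<close>; it does not depend on the choice of the
  defining function \<open>r\<close> near \<open>P\<close>.\<close>

definition regular_type :: "(complex^'n \<Rightarrow> real) \<Rightarrow> complex^'n \<Rightarrow> ereal" where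
  "regular_type r P =
     (SUP F\<in>{F. regular_curve_at P F}.
        ereal_of_enat (vanishing_order (r \<circ> F)) / ereal_of_enat (vanishing_order_vec F))"

section \<open>Normals, complex tangent vectors, discs and the function \<open>S\<close>\<close>

definition outer_normal :: "(complex^'n \<Rightarrow> real) \<Rightarrow> complex^'n \<Rightarrow> complex^'n" where
  "outer_normal r P = sgn (gradient r P)"

text \<open>Unit vectors \<open>v\<close> such that \<open>v\<close> and \<open>\<i> v\<close> are both tangent to \<open>{r = 0}\<close> at \<open>P\<close>.\<close>

definition unit_complex_tangents :: "(complex^'n \<Rightarrow> real) \<Rightarrow> complex^'n \<Rightarrow> (complex^'n) set" where
  "unit_complex_tangents r P =
     {v. norm v = 1 \<and> inner v (gradient r P) = 0 \<and> inner (\<i> *s v) (gradient r P) = 0}"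

definition inner_point :: "(complex^'n \<Rightarrow> real) \<Rightarrow> complex^'n \<Rightarrow> real \<Rightarrow> complex^'n" where
  "inner_point r P t = P - t *\<^sub>R outer_normal r P"

text \<open>In the next two definitions \<open>G\<close> stands for the piece \<open>\<Omega> \<inter> U\<close> of the domain near \<open>P\<close>, as seen
  in the chosen coordinates.\<close>

definition disc_radius ::
    "(complex^'n) set \<Rightarrow> (complex^'n \<Rightarrow> real) \<Rightarrow> complex^'n \<Rightarrow> complex^'n \<Rightarrow> real \<Rightarrow> ereal" where
  "disc_radius G r P v t =
     Sup (ereal ` {\<rho>. \<rho> > 0 \<and> (\<forall>\<zeta>. cmod \<zeta> \<le> \<rho> \<longrightarrow> inner_point r P t + \<zeta> *s v \<in> G)})"

definition tangential_disc ::
    "(complex^'n) set \<Rightarrow> (complex^'n \<Rightarrow> real) \<Rightarrow> complex^'n \<Rightarrow> complex^'n \<Rightarrow> real \<Rightarrow> (complex^'n) set" where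
  "tangential_disc G r P v t =
     {inner_point r P t + \<zeta> *s v |\<zeta>. ereal (cmod \<zeta>) < disc_radius G r P v t}"

definition S_fun :: "(complex^'n \<Rightarrow> real) \<Rightarrow> complex^'n \<Rightarrow> complex^'n \<Rightarrow> real \<Rightarrow> real" where
  "S_fun r P v t = (SUP \<zeta>\<in>cball 0 t. r (P + \<zeta> *s v))"

text \<open>
  The estimate at \<open>P\<close> with constant \<open>C\<close>, for all holomorphic coordinates near \<open>P\<close>. In the
  coordinates \<open>\<phi>\<close> (with inverse \<open>\<psi>\<close>) the point is \<open>\<phi> P\<close>, the domain near it is
  \<open>\<phi> ` (\<Omega> \<inter> U \<inter> W)\<close>, and the defining function and the function \<open>f\<close> become \<open>r \<circ> \<psi>\<close> and \<open>f \<circ> \<psi>\<close>.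
  How small \<open>\<delta>\<close> has to be may depend on the coordinates, but not on \<open>v\<close>.
\<close>

definition tangential_estimate ::
    "(complex^'n) set \<Rightarrow> (complex^'n) set \<Rightarrow> (complex^'n \<Rightarrow> real) \<Rightarrow> real \<Rightarrow>
     (complex^'n \<Rightarrow> complex) \<Rightarrow> complex^'n \<Rightarrow> real \<Rightarrow> bool" where
  "tangential_estimate \<Omega> U r \<alpha> f P C \<longleftrightarrow>
     (\<forall>\<phi> \<psi> W. holomorphic_coordinates_near P \<phi> \<psi> W \<longrightarrow>
       (\<exists>\<delta>\<^sub>0>0. \<forall>v \<in> unit_complex_tangents (r \<circ> \<psi>) (\<phi> P). \<forall>\<delta>. 0 < \<delta> \<and> \<delta> < \<delta>\<^sub>0 \<longrightarrow>
         (\<forall>w \<in> tangential_disc (\<phi> ` (\<Omega> \<inter> U \<inter> W)) (r \<circ> \<psi>) (\<phi> P) v \<delta>.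
            cmod ((f \<circ> \<psi>) (inner_point (r \<circ> \<psi>) (\<phi> P) \<delta>) - (f \<circ> \<psi>) w)
              \<le> C * S_fun (r \<circ> \<psi>) (\<phi> P) v (norm (inner_point (r \<circ> \<psi>) (\<phi> P) \<delta> - w)) powr \<alpha>)))"

end

theory Submission
  imports Defs "HOL-Real_Asymp.Real_Asymp"
begin

text \<open>
  Fix a boundary point \<open>Q\<close>, coordinates \<open>\<phi>\<close> with inverse \<open>\<psi>\<close>, and put \<open>G\<^sub>v \<zeta> = r (\<psi> (\<phi> Q + \<zeta> *s v))\<close> for
  unit vectors \<open>v\<close>, so that \<open>S v t\<close> is the supremum of \<open>G\<^sub>v\<close> over the disc of radius \<open>t\<close>. Let \<open>K\<close> be
  the largest natural number with \<open>K * \<alpha> < 1\<close>. The type condition says that no holomorphic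
  regular curve through \<open>Q\<close> has order of contact greater than \<open>K\<close> with the boundary; the curves
  \<open>\<zeta> \<mapsto> \<psi> (\<phi> Q + \<zeta> *s v)\<close> are such curves.

  Why the estimate holds: both points \<open>\<psi> P\<^sub>\<delta>\<close> and \<open>\<psi> w\<close> are moved inwards, along the normal at \<open>Q\<close>
  in the original coordinates, by \<open>u\<^sub>k\<close>, a fixed multiple of \<open>S v (2 ^ k * t)\<close> with \<open>t = \<bar>P\<^sub>\<delta> - w\<bar>\<close>. At this
  depth the whole (curved) disc of radius \<open>2 ^ k * t\<close> around \<open>P\<^sub>\<delta>\<close> fits into the domain. The increment
  of \<open>f\<close> between the depths \<open>u\<^sub>k\<close> and \<open>u\<^sub>k\<^sub>+\<^sub>1\<close>, as a function on that disc, is at most a multiple of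
  \<open>u\<^sub>k\<^sub>+\<^sub>1 powr \<alpha>\<close> by the Lipschitz condition, and the Schwarz lemma gains a factor \<open>2\<^sup>-\<^sup>k\<close> at distance
  \<open>t\<close> from the centre (\<open>dyadic_chain\<close>). If \<open>S\<close> grows at most like a power \<open>K\<close>, that is
  \<open>S v (2 ^ k * t) \<le> C * (2 ^ k) ^ K * S v t\<close>, then the sum over \<open>k\<close> is a convergent geometric series because
  \<open>K * \<alpha> < 1\<close>, and it is a multiple of \<open>S v t powr \<alpha>\<close> (\<open>geometric_powr_sum\<close>). The last term of the
  chain is of order \<open>t\<close>, which is small compared with \<open>S v t powr \<alpha>\<close> because \<open>S v t \<ge> c * t\<^sup>K\<close>.

  The two bounds on \<open>S\<close> come from the following facts. The functions \<open>G\<^sub>v\<close> have derivatives bounded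
  uniformly in \<open>v\<close> (\<open>bdd_derivs_curve_family\<close>). So on each ray \<open>G\<^sub>v\<close> is a polynomial of degree \<open>K\<close>
  up to \<open>O(t\<^sup>K\<^sup>+\<^sup>1)\<close>, and the type condition together with the compactness of the unit sphere gives
  \<open>N v t \<ge> c * t\<^sup>K\<close> for \<open>N v t\<close>, the supremum of \<open>\<bar>G\<^sub>v\<bar>\<close> over the disc (\<open>uniform_lower_bound\<close>). Hence the
  error term is negligible and \<open>N\<close> grows like a polynomial of degree \<open>K\<close>, with a constant that depends
  on \<open>K\<close> alone (\<open>sup_abs_growth\<close>). Finally \<open>S v t \<ge> e * N v t\<close>, again with a constant that depends only
  on \<open>K\<close>. This is the contribution of pseudoconvexity (\<open>pseudoconvex_sup_bound\<close>). If \<open>G\<^sub>v\<close> were very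
  negative somewhere but nowhere noticeably positive, then \<open>- ln dist\<close> would violate a maximum
  principle on a disc pushed inwards to a depth of the order of \<open>N v t\<close>: on the boundary circle of
  such a disc the distance to \<open>frontier \<Omega>\<close> would be nowhere noticeably smaller, and on an arc
  definitely larger, than at the centre. Since the discs are curved and plurisubharmonicity is
  given on affine discs, this principle needs its own proof (\<open>psh_disc_maximum_principle\<close>).

  Since the constants depend only on \<open>K\<close>, on \<open>\<alpha>\<close> and on a lower bound for the gradient of \<open>r\<close>, they
  serve for all \<open>v\<close>, all coordinates and all \<open>Q\<close> near \<open>P\<close> at once; the coordinates only influence how
  small \<open>\<delta>\<close> has to be.
\<close>

section \<open>Families of smooth functions with uniformly bounded derivatives\<close>

lemma dir_derivs_snoc: "dir_derivs (vs @ [w]) f = dir_derivs vs (\<lambda>x. frechet_derivative f (at x) w)"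
  by (induction vs) auto

lemma smooth_on_frechet_derivative:
  assumes "smooth_on U f" shows "smooth_on U (\<lambda>x. frechet_derivative f (at x) w)"
  using assms unfolding smooth_on_def dir_derivs_snoc[symmetric] by blast

lemma smooth_on_differentiable:
  assumes "smooth_on U f" "x \<in> U" shows "f differentiable (at x)"
  using assms unfolding smooth_on_def by (metis dir_derivs.simps(1))

lemma frechet_derivative_cong_open:
  assumes "open S" "x \<in> S" "\<And>y. y \<in> S \<Longrightarrow> f y = g y"
  shows "frechet_derivative f (at x) = frechet_derivative g (at x)"
proof -
  have "(f has_derivative L) (at x) \<longleftrightarrow> (g has_derivative L) (at x)" for L
    using assms by (metis has_derivative_transform_within_open)
  then show ?thesis unfolding frechet_derivative_def by presburger
qed

text \<open>
  The estimates below have to be uniform over a family of curves, so that smoothness is treated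
  for whole sets of functions: \<open>bdd_derivs k S \<F>\<close> means that up to order \<open>k\<close> all derivatives in
  directions from the unit ball exist on \<open>S\<close> and are bounded there by a constant common to \<open>\<F>\<close>.
  The recursion differentiates the family first, which makes the product and chain rules
  inductions on \<open>k\<close>.
\<close>
definition deriv_family :: "(complex \<Rightarrow> real) set \<Rightarrow> (complex \<Rightarrow> real) set" where
  "deriv_family \<F> = (\<lambda>(g, w) x. frechet_derivative g (at x) w) ` (\<F> \<times> cball 0 1)"

lemma deriv_familyI: "g \<in> \<F> \<Longrightarrow> norm w \<le> 1 \<Longrightarrow> (\<lambda>x. frechet_derivative g (at x) w) \<in> deriv_family \<F>"
  unfolding deriv_family_def by (rule image_eqI[of _ _ "(g, w)"]) auto

lemma deriv_familyE:
  assumes "h \<in> deriv_family \<F>"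
  obtains g w where "h = (\<lambda>x. frechet_derivative g (at x) w)" "g \<in> \<F>" "norm w \<le> 1"
  using assms unfolding deriv_family_def by auto

definition sum_family :: "('a \<Rightarrow> real) set \<Rightarrow> ('a \<Rightarrow> real) set \<Rightarrow> ('a \<Rightarrow> real) set" where
  "sum_family \<F> \<G> = (\<lambda>(f, g) x. f x + g x) ` (\<F> \<times> \<G>)"

definition prod_family :: "('a \<Rightarrow> real) set \<Rightarrow> ('a \<Rightarrow> real) set \<Rightarrow> ('a \<Rightarrow> real) set" where
  "prod_family \<F> \<G> = (\<lambda>(f, g) x. f x * g x) ` (\<F> \<times> \<G>)"

lemma sum_familyI: "f \<in> \<F> \<Longrightarrow> g \<in> \<G> \<Longrightarrow> (\<lambda>x. f x + g x) \<in> sum_family \<F> \<G>"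
  unfolding sum_family_def by (rule image_eqI[of _ _ "(f, g)"]) auto

lemma prod_familyI: "f \<in> \<F> \<Longrightarrow> g \<in> \<G> \<Longrightarrow> (\<lambda>x. f x * g x) \<in> prod_family \<F> \<G>"
  unfolding prod_family_def by (rule image_eqI[of _ _ "(f, g)"]) auto

lemma sum_familyE:
  assumes "h \<in> sum_family \<F> \<G>"
  obtains f g where "h = (\<lambda>x. f x + g x)" "f \<in> \<F>" "g \<in> \<G>"
  using assms unfolding sum_family_def by auto

lemma prod_familyE:
  assumes "h \<in> prod_family \<F> \<G>"
  obtains f g where "h = (\<lambda>x. f x * g x)" "f \<in> \<F>" "g \<in> \<G>"
  using assms unfolding prod_family_def by auto

primrec bdd_derivs :: "nat \<Rightarrow> complex set \<Rightarrow> (complex \<Rightarrow> real) set \<Rightarrow> bool" where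
  "bdd_derivs 0 S \<F> = (\<exists>B. \<forall>g\<in>\<F>. \<forall>x\<in>S. \<bar>g x\<bar> \<le> B)"
| "bdd_derivs (Suc k) S \<F> = ((\<exists>B. \<forall>g\<in>\<F>. \<forall>x\<in>S. \<bar>g x\<bar> \<le> B) \<and>
     (\<forall>g\<in>\<F>. \<forall>x\<in>S. g differentiable (at x)) \<and>
     bdd_derivs k S (deriv_family \<F>))"

lemma bdd_derivs_bound: "bdd_derivs k S \<F> \<Longrightarrow> \<exists>B. \<forall>g\<in>\<F>. \<forall>x\<in>S. \<bar>g x\<bar> \<le> B"
  by (cases k) auto

lemma bdd_derivs_cong:
  assumes "open S" "bdd_derivs k S \<F>" "\<And>g. g \<in> \<G> \<Longrightarrow> \<exists>f\<in>\<F>. \<forall>x\<in>S. g x = f x"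
  shows "bdd_derivs k S \<G>"
  using assms(2,3)
proof (induction k arbitrary: \<F> \<G>)
  case 0
  then obtain B where B: "\<forall>g\<in>\<F>. \<forall>x\<in>S. \<bar>g x\<bar> \<le> B" by auto
  have "\<forall>g\<in>\<G>. \<forall>x\<in>S. \<bar>g x\<bar> \<le> B" using B 0(2) by metis
  then show ?case by auto
next
  case (Suc k)
  obtain B where B: "\<forall>g\<in>\<F>. \<forall>x\<in>S. \<bar>g x\<bar> \<le> B" using Suc.prems(1) by auto
  have 1: "\<forall>g\<in>\<G>. \<forall>x\<in>S. \<bar>g x\<bar> \<le> B" using B Suc.prems(2) by metis
  have 2: "g differentiable (at x)" if "g \<in> \<G>" "x \<in> S" for g x
  proof -
    obtain f where f: "f \<in> \<F>" "\<forall>x\<in>S. g x = f x" using Suc.prems(2)[OF \<open>g \<in> \<G>\<close>] by auto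
    have "f differentiable (at x)" using Suc.prems(1) f that by auto
    then show ?thesis using f \<open>open S\<close> that
      unfolding differentiable_def by (metis has_derivative_transform_within_open)
  qed
  have "bdd_derivs k S (deriv_family \<F>)"
    using Suc.prems(1) by simp
  then have 3: "bdd_derivs k S (deriv_family \<G>)"
  proof (rule Suc.IH)
    fix h assume "h \<in> (deriv_family \<G>)"
    then obtain g w where g: "h = (\<lambda>x. frechet_derivative g (at x) w)" "g \<in> \<G>" "norm w \<le> 1"
      by (auto elim: deriv_familyE)
    obtain f where f: "f \<in> \<F>" "\<forall>x\<in>S. g x = f x" using Suc.prems(2)[OF g(2)] by auto
    have "\<forall>x\<in>S. h x = frechet_derivative f (at x) w"
      using frechet_derivative_cong_open[OF \<open>open S\<close>, of _ g f] f g by auto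
    then show "\<exists>f\<in>(deriv_family \<F>). \<forall>x\<in>S. h x = f x"
      by (intro bexI[OF _ deriv_familyI[OF f(1) g(3)]]) simp
  qed
  show ?case using 1 2 3 by auto
qed

lemma bdd_derivs_subset: "open S \<Longrightarrow> bdd_derivs k S \<F> \<Longrightarrow> \<G> \<subseteq> \<F> \<Longrightarrow> bdd_derivs k S \<G>"
  by (rule bdd_derivs_cong) auto

lemma bdd_derivs_Suc: "bdd_derivs (Suc k) S \<F> \<Longrightarrow> bdd_derivs k S \<F>"
proof (induction k arbitrary: \<F>)
  case 0 then show ?case by auto
next
  case (Suc k)
  have "bdd_derivs k S (deriv_family \<F>)"
    by (rule Suc.IH) (use Suc.prems in \<open>simp only: bdd_derivs.simps(2)[of "Suc k"]\<close>)
  then show ?case using Suc.prems by (simp only: bdd_derivs.simps(2)) simp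
qed

lemma bdd_derivs_add:
  assumes "open S" "bdd_derivs k S \<F>" "bdd_derivs k S \<G>"
  shows "bdd_derivs k S (sum_family \<F> \<G>)"
  using assms(2,3)
proof (induction k arbitrary: \<F> \<G>)
  case 0
  obtain A where A: "\<forall>g\<in>\<F>. \<forall>x\<in>S. \<bar>g x\<bar> \<le> A" using 0 by auto
  obtain B where B: "\<forall>g\<in>\<G>. \<forall>x\<in>S. \<bar>g x\<bar> \<le> B" using 0 by auto
  have "\<forall>h\<in>(sum_family \<F> \<G>). \<forall>x\<in>S. \<bar>h x\<bar> \<le> A + B"
    using A B by (auto elim!: sum_familyE intro!: order_trans[OF abs_triangle_ineq] add_mono)
  then show ?case by auto
next
  case (Suc k)
  have bd: "\<exists>B. \<forall>h\<in>(sum_family \<F> \<G>). \<forall>x\<in>S. \<bar>h x\<bar> \<le> B"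
    by (rule bdd_derivs_bound[OF Suc.IH[OF bdd_derivs_Suc[OF Suc.prems(1)] bdd_derivs_Suc[OF Suc.prems(2)]]])
  have dF: "f differentiable (at x)" if "f \<in> \<F>" "x \<in> S" for f x using Suc.prems that by auto
  have dG: "f differentiable (at x)" if "f \<in> \<G>" "x \<in> S" for f x using Suc.prems that by auto
  have d: "\<forall>h\<in>(sum_family \<F> \<G>). \<forall>x\<in>S. h differentiable (at x)" using dF dG by (auto elim!: sum_familyE intro!: differentiable_add)
  have "bdd_derivs k S (sum_family (deriv_family \<F>) (deriv_family \<G>))"
    by (rule Suc.IH) (use Suc.prems in auto)
  then have "bdd_derivs k S (deriv_family (sum_family \<F> \<G>))"
  proof (rule bdd_derivs_cong[OF \<open>open S\<close>])
    fix h assume "h \<in> deriv_family (sum_family \<F> \<G>)"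
    then obtain f g w where h: "h = (\<lambda>x. frechet_derivative (\<lambda>x. f x + g x) (at x) w)"
      "f \<in> \<F>" "g \<in> \<G>" "norm w \<le> 1" by (auto elim!: deriv_familyE sum_familyE prod_familyE)
    have "h x = frechet_derivative f (at x) w + frechet_derivative g (at x) w" if "x \<in> S" for x
    proof -
      have "((\<lambda>x. f x + g x) has_derivative (\<lambda>w. frechet_derivative f (at x) w + frechet_derivative g (at x) w)) (at x)"
        using dF[OF h(2) that] dG[OF h(3) that]
        by (intro has_derivative_add) (auto simp: frechet_derivative_works)
      from frechet_derivative_at[OF this, symmetric] show ?thesis using h(1) by simp
    qed
    then show "\<exists>f\<in>(sum_family (deriv_family \<F>) (deriv_family \<G>)). \<forall>x\<in>S. h x = f x"
      by (intro bexI[OF _ sum_familyI[OF deriv_familyI[OF h(2,4)] deriv_familyI[OF h(3,4)]]]) simp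
  qed
  then show ?case using bd d by simp
qed

lemma bdd_derivs_mult:
  assumes "open S" "bdd_derivs k S \<F>" "bdd_derivs k S \<G>"
  shows "bdd_derivs k S (prod_family \<F> \<G>)"
  using assms(2,3)
proof (induction k arbitrary: \<F> \<G>)
  case 0
  obtain A where A: "\<forall>g\<in>\<F>. \<forall>x\<in>S. \<bar>g x\<bar> \<le> A" using 0 by auto
  obtain B where B: "\<forall>g\<in>\<G>. \<forall>x\<in>S. \<bar>g x\<bar> \<le> B" using 0 by auto
  have "\<forall>h\<in>(prod_family \<F> \<G>). \<forall>x\<in>S. \<bar>h x\<bar> \<le> A * B"
    using A B by (auto elim!: prod_familyE simp: abs_mult intro!: mult_mono) (rule order_trans[OF abs_ge_zero], blast)
  then show ?case by auto
next
  case (Suc k)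
  have bd: "\<exists>B. \<forall>h\<in>prod_family \<F> \<G>. \<forall>x\<in>S. \<bar>h x\<bar> \<le> B"
    by (rule bdd_derivs_bound[OF Suc.IH[OF bdd_derivs_Suc[OF Suc.prems(1)] bdd_derivs_Suc[OF Suc.prems(2)]]])
  have dF: "f differentiable (at x)" if "f \<in> \<F>" "x \<in> S" for f x using Suc.prems that by auto
  have dG: "f differentiable (at x)" if "f \<in> \<G>" "x \<in> S" for f x using Suc.prems that by auto
  have d: "\<forall>h\<in>prod_family \<F> \<G>. \<forall>x\<in>S. h differentiable (at x)" using dF dG by (auto elim!: prod_familyE intro!: differentiable_mult)
  have 1: "bdd_derivs k S (prod_family \<F> (deriv_family \<G>))"
    by (rule Suc.IH) (use Suc.prems bdd_derivs_Suc in auto)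
  have 2: "bdd_derivs k S (prod_family (deriv_family \<F>) \<G>)"
    by (rule Suc.IH) (use Suc.prems bdd_derivs_Suc in auto)
  have "bdd_derivs k S (sum_family (prod_family \<F> (deriv_family \<G>)) (prod_family (deriv_family \<F>) \<G>))"
    using bdd_derivs_add[OF \<open>open S\<close> 1 2] .
  then have "bdd_derivs k S (deriv_family (prod_family \<F> \<G>))"
  proof (rule bdd_derivs_cong[OF \<open>open S\<close>])
    fix h assume "h \<in> deriv_family (prod_family \<F> \<G>)"
    then obtain f g w where h: "h = (\<lambda>x. frechet_derivative (\<lambda>x. f x * g x) (at x) w)"
      "f \<in> \<F>" "g \<in> \<G>" "norm w \<le> 1" by (auto elim!: deriv_familyE sum_familyE prod_familyE)
    have "h x = f x * frechet_derivative g (at x) w + frechet_derivative f (at x) w * g x" if "x \<in> S" for x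
    proof -
      have "((\<lambda>x. f x * g x) has_derivative (\<lambda>w. f x * frechet_derivative g (at x) w + frechet_derivative f (at x) w * g x)) (at x)"
        using dF[OF h(2) that] dG[OF h(3) that]
        by (intro has_derivative_mult) (auto simp: frechet_derivative_works)
      from frechet_derivative_at[OF this, symmetric] show ?thesis using h(1) by simp
    qed
    then show "\<exists>f\<in>(sum_family (prod_family \<F> (deriv_family \<G>)) (prod_family (deriv_family \<F>) \<G>)). \<forall>x\<in>S. h x = f x"
      by (intro bexI[OF _ sum_familyI[OF prod_familyI[OF h(2) deriv_familyI[OF h(3,4)]]
            prod_familyI[OF deriv_familyI[OF h(2,4)] h(3)]]]) simp
  qed
  then show ?case using bd d by simp
qed

lemma bdd_derivs_zero: "open S \<Longrightarrow> bdd_derivs k S {\<lambda>x. 0}"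
proof (induction k)
  case (Suc k)
  have "deriv_family {\<lambda>x. 0} \<subseteq> {\<lambda>x. 0}"
    unfolding deriv_family_def by (auto simp: frechet_derivative_const)
  then have "bdd_derivs k S (deriv_family {\<lambda>x. 0})"
    by (rule bdd_derivs_subset[OF Suc.prems Suc.IH[OF Suc.prems]])
  then show ?case by (simp add: exI[of _ 0])
qed auto

lemma bdd_derivs_sum:
  assumes "open S" "finite I" "\<And>b. b \<in> I \<Longrightarrow> bdd_derivs k S (h b ` T)"
  shows "bdd_derivs k S ((\<lambda>t x. \<Sum>b\<in>I. h b t x) ` T)"
  using assms(2,3)
proof (induction I)
  case empty
  show ?case by (rule bdd_derivs_subset[OF \<open>open S\<close> bdd_derivs_zero[OF \<open>open S\<close>]]) auto
next
  case (insert a I)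
  have "bdd_derivs k S (sum_family (h a ` T) ((\<lambda>t x. \<Sum>b\<in>I. h b t x) ` T))"
    by (intro bdd_derivs_add[OF \<open>open S\<close>] insert.prems insert.IH) simp_all
  then show ?case
  proof (rule bdd_derivs_subset[OF \<open>open S\<close>], intro image_subsetI)
    fix t assume "t \<in> T"
    then have "(\<lambda>x. h a t x + (\<Sum>b\<in>I. h b t x)) \<in> sum_family (h a ` T) ((\<lambda>t x. \<Sum>b\<in>I. h b t x) ` T)"
      by (intro sum_familyI) auto
    then show "(\<lambda>x. \<Sum>b\<in>insert a I. h b t x) \<in> sum_family (h a ` T) ((\<lambda>t x. \<Sum>b\<in>I. h b t x) ` T)"
      using insert.hyps by simp
  qed
qed

text \<open>
  By the chain rule the derivative of \<open>\<rho> \<circ> F\<close> is a sum of products of a derivative of a component of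
  \<open>F\<close> and a partial derivative of \<open>\<rho>\<close> composed with \<open>F\<close>. The latter is of the same form with another
  smooth function in place of \<open>\<rho>\<close>, so the induction has to run over all \<open>\<rho>\<close>.
\<close>
lemma bdd_derivs_compose:
  fixes \<rho> :: "'a::euclidean_space \<Rightarrow> real" and \<S> :: "(complex \<Rightarrow> 'a) set"
  assumes "open S" "compact C" "C \<subseteq> U" "open U"
    and FC: "\<And>F x. F \<in> \<S> \<Longrightarrow> x \<in> S \<Longrightarrow> F x \<in> C"
    and FB: "\<And>b k. b \<in> Basis \<Longrightarrow> bdd_derivs k S ((\<lambda>F x. F x \<bullet> b) ` \<S>)"
    and "smooth_on U \<rho>"
  shows "bdd_derivs k S ((\<lambda>F x. \<rho> (F x)) ` \<S>)"
  using assms(7)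
proof (induction k arbitrary: \<rho>)
  case (0 \<rho>)
  have "continuous_on C \<rho>"
    using smooth_on_differentiable[OF 0] \<open>C \<subseteq> U\<close>
    by (intro continuous_at_imp_continuous_on ballI differentiable_imp_continuous_within) blast
  then have "bounded (\<rho> ` C)" using \<open>compact C\<close> compact_continuous_image compact_imp_bounded by blast
  then obtain B where "\<forall>y\<in>C. \<bar>\<rho> y\<bar> \<le> B" by (auto simp: bounded_iff)
  then show ?case using FC by auto
next
  case (Suc k \<rho>)
  let ?h = "\<lambda>b (F, w) x. frechet_derivative (\<lambda>x. F x \<bullet> b) (at x) w * frechet_derivative \<rho> (at (F x)) b"
  let ?T = "\<S> \<times> cball 0 1"
  have "bdd_derivs k S ((\<lambda>F x. \<rho> (F x)) ` \<S>)" using Suc by blast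
  then have bd: "\<exists>B. \<forall>g\<in>((\<lambda>F x. \<rho> (F x)) ` \<S>). \<forall>x\<in>S. \<bar>g x\<bar> \<le> B" by (rule bdd_derivs_bound)
  have chain: "((\<lambda>x. \<rho> (F x)) has_derivative
      (\<lambda>w. \<Sum>b\<in>Basis. frechet_derivative (\<lambda>x. F x \<bullet> b) (at x) w * frechet_derivative \<rho> (at (F x)) b)) (at x)"
    if F: "F \<in> \<S>" and x: "x \<in> S" for F x
  proof -
    let ?F' = "\<lambda>w. \<Sum>b\<in>Basis. frechet_derivative (\<lambda>x. F x \<bullet> b) (at x) w *\<^sub>R b"
    have "(\<lambda>x. F x \<bullet> b) differentiable (at x)" if "b \<in> Basis" for b
    proof -
      have "\<forall>g\<in>((\<lambda>F x. F x \<bullet> b) ` \<S>). \<forall>x\<in>S. g differentiable (at x)"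
        using FB[OF that, of "Suc 0"] unfolding bdd_derivs.simps(2) by (elim conjE)
      from bspec[OF bspec[OF this imageI[OF F]] x] show ?thesis .
    qed
    then have "((\<lambda>x. \<Sum>b\<in>Basis. (F x \<bullet> b) *\<^sub>R b) has_derivative ?F') (at x)"
      by (intro has_derivative_sum has_derivative_scaleR_left) (auto simp: frechet_derivative_works)
    then have F': "(F has_derivative ?F') (at x)" by (simp add: euclidean_representation)
    have "\<rho> differentiable (at (F x))" using smooth_on_differentiable[OF Suc.prems] FC[OF F x] \<open>C \<subseteq> U\<close> by blast
    then have \<rho>': "(\<rho> has_derivative frechet_derivative \<rho> (at (F x))) (at (F x))"
      by (simp add: frechet_derivative_works)
    then have lin: "linear (frechet_derivative \<rho> (at (F x)))" using has_derivative_linear by blast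
    have "((\<lambda>x. \<rho> (F x)) has_derivative (\<lambda>w. frechet_derivative \<rho> (at (F x)) (?F' w))) (at x)"
      using has_derivative_compose[OF F' \<rho>'] .
    then show ?thesis
      by (simp add: linear_sum[OF lin] linear_scale[OF lin])
  qed
  have "bdd_derivs k S ((\<lambda>t x. \<Sum>b\<in>Basis. ?h b t x) ` ?T)"
  proof (rule bdd_derivs_sum[OF \<open>open S\<close> finite_Basis])
    fix b :: 'a assume b: "b \<in> Basis"
    have "bdd_derivs k S (deriv_family ((\<lambda>F x. F x \<bullet> b) ` \<S>))"
      using FB[OF b, of "Suc k"] by simp
    moreover have "bdd_derivs k S ((\<lambda>F x. frechet_derivative \<rho> (at (F x)) b) ` \<S>)"
      by (rule Suc.IH[OF smooth_on_frechet_derivative[OF Suc.prems]])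
    ultimately have "bdd_derivs k S (prod_family (deriv_family ((\<lambda>F x. F x \<bullet> b) ` \<S>))
      ((\<lambda>F x. frechet_derivative \<rho> (at (F x)) b) ` \<S>))" by (rule bdd_derivs_mult[OF \<open>open S\<close>])
    then show "bdd_derivs k S (?h b ` ?T)"
    proof (rule bdd_derivs_subset[OF \<open>open S\<close>], intro image_subsetI, clarify)
      fix F and w :: complex assume F: "F \<in> \<S>" "w \<in> cball 0 1"
      show "(\<lambda>x. frechet_derivative (\<lambda>x. F x \<bullet> b) (at x) w * frechet_derivative \<rho> (at (F x)) b)
        \<in> prod_family (deriv_family ((\<lambda>F x. F x \<bullet> b) ` \<S>)) ((\<lambda>F x. frechet_derivative \<rho> (at (F x)) b) ` \<S>)"
        by (rule prod_familyI[OF deriv_familyI[OF imageI[OF F(1)]] imageI[OF F(1)]]) (use F in simp)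
    qed
  qed
  then have "bdd_derivs k S (deriv_family ((\<lambda>F x. \<rho> (F x)) ` \<S>))"
  proof (rule bdd_derivs_cong[OF \<open>open S\<close>])
    fix h assume "h \<in> deriv_family ((\<lambda>F x. \<rho> (F x)) ` \<S>)"
    then obtain F w where h: "h = (\<lambda>x. frechet_derivative (\<lambda>x. \<rho> (F x)) (at x) w)" "F \<in> \<S>" "norm w \<le> 1"
      by (elim deriv_familyE imageE) simp
    have "h x = (\<Sum>b\<in>Basis. ?h b (F, w) x)" if "x \<in> S" for x
      using frechet_derivative_at[OF chain[OF h(2) that], symmetric] h(1) by simp
    then show "\<exists>f\<in>(\<lambda>t x. \<Sum>b\<in>Basis. ?h b t x) ` ?T. \<forall>x\<in>S. h x = f x"
      using h(2,3) by (intro bexI[OF _ imageI[of "(F, w)"]]) auto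
  qed
  moreover have "\<forall>g\<in>((\<lambda>F x. \<rho> (F x)) ` \<S>). \<forall>x\<in>S. g differentiable (at x)"
  proof (intro ballI, elim imageE)
    fix g F x assume "g = (\<lambda>x. \<rho> (F x))" "F \<in> \<S>" "x \<in> S"
    then show "g differentiable (at x)" using chain[of F x] by (auto intro: differentiableI)
  qed
  ultimately show ?case using bd by simp
qed

text \<open>
  Directional derivatives of real parts of holomorphic functions are again such real parts, and
  the Cauchy inequality bounds them on a slightly smaller disc.
\<close>
lemma bdd_derivs_Re_holomorphic:
  assumes "\<rho> < R" "\<And>h. h \<in> \<H> \<Longrightarrow> h holomorphic_on ball 0 R"
    "\<And>h z. h \<in> \<H> \<Longrightarrow> z \<in> ball 0 R \<Longrightarrow> cmod (h z) \<le> B"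
  shows "bdd_derivs k (ball 0 \<rho>) ((\<lambda>h z. Re (h z)) ` \<H>)"
  using assms
proof (induction k arbitrary: R B \<H>)
  case 0
  have "\<bar>Re (h x)\<bar> \<le> B" if "h \<in> \<H>" "x \<in> ball 0 \<rho>" for h x
    using 0(3)[OF that(1), of x] that(2) 0(1) abs_Re_le_cmod[of "h x"] by force
  then show ?case by (simp only: bdd_derivs.simps(1)) (intro exI[of _ B] ballI, elim imageE, simp)
next
  case (Suc k)
  have bd: "\<bar>Re (h x)\<bar> \<le> B" if "h \<in> \<H>" "x \<in> ball 0 \<rho>" for h x
    using Suc.prems(3)[OF that(1), of x] that(2) Suc.prems(1) abs_Re_le_cmod[of "h x"] by force
  have der: "((\<lambda>z. Re (h z)) has_derivative (\<lambda>w. Re (deriv h x * w))) (at x)"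
    if "h \<in> \<H>" "x \<in> ball 0 R" for h x
  proof -
    have "(h has_field_derivative deriv h x) (at x)"
      using Suc.prems(2)[OF that(1)] that(2) by (simp add: holomorphic_derivI)
    then show ?thesis by (intro has_derivative_Re) (simp add: has_field_derivative_def)
  qed
  define R' where "R' = (\<rho> + R) / 2"
  have R': "\<rho> < R'" "R' < R" using Suc.prems(1) by (auto simp: R'_def)
  let ?\<H>' = "(\<lambda>(h, w) z. deriv h z * w) ` (\<H> \<times> cball 0 1)"
  have "bdd_derivs k (ball 0 \<rho>) ((\<lambda>h z. Re (h z)) ` ?\<H>')"
  proof (rule Suc.IH[OF R'(1), where B = "\<bar>B\<bar> / ((R - R')/2)"])
    fix h' assume "h' \<in> ?\<H>'"
    then obtain h w where h: "h' = (\<lambda>z. deriv h z * w)" "h \<in> \<H>" "norm w \<le> 1" by auto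
    have hol: "h holomorphic_on ball 0 R" using Suc.prems(2) h by blast
    have "deriv h holomorphic_on ball 0 R" by (rule holomorphic_deriv[OF hol]) simp
    then have "deriv h holomorphic_on ball 0 R'" by (rule holomorphic_on_subset) (use R' in auto)
    then show "h' holomorphic_on ball 0 R'" unfolding h(1) by (rule holomorphic_on_mult) (rule holomorphic_on_const)
    fix z :: complex assume z: "z \<in> ball 0 R'"
    have sub: "cball z ((R - R')/2) \<subseteq> ball 0 R"
    proof
      fix y assume "y \<in> cball z ((R - R')/2)"
      then have "norm (y - z) \<le> (R-R')/2" by (simp add: dist_norm norm_minus_commute)
      then have "norm y \<le> (R-R')/2 + norm z" using norm_triangle_sub[of y z] by linarith
      then show "y \<in> ball 0 R" using z R' by (simp add: field_simps)
    qed
    have "norm ((deriv ^^ 1) h z) \<le> fact 1 * \<bar>B\<bar> / ((R - R')/2) ^ 1"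
    proof (rule Cauchy_inequality)
      show "h holomorphic_on ball z ((R - R')/2)"
        using hol sub by (meson ball_subset_cball holomorphic_on_subset order_trans)
      show "continuous_on (cball z ((R - R')/2)) h"
        using hol sub holomorphic_on_imp_continuous_on continuous_on_subset by blast
      show "0 < (R - R') / 2" using R' by simp
      fix x assume "norm (z - x) = (R - R') / 2"
      then have "x \<in> cball z ((R - R')/2)" by (simp add: dist_norm)
      then have "x \<in> ball 0 R" using sub by blast
      then show "norm (h x) \<le> \<bar>B\<bar>" using Suc.prems(3)[OF h(2)] by force
    qed
    then have "norm (deriv h z) \<le> \<bar>B\<bar> / ((R - R')/2)" by simp
    then show "cmod (h' z) \<le> \<bar>B\<bar> / ((R - R')/2)"
      using h(3) mult_mono[of "norm (deriv h z)" "\<bar>B\<bar> / ((R - R')/2)" "norm w" 1] R'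
      by (simp add: h(1) norm_mult)
  qed
  then have "bdd_derivs k (ball 0 \<rho>) (deriv_family ((\<lambda>h z. Re (h z)) ` \<H>))"
  proof (rule bdd_derivs_cong[OF open_ball])
    fix g assume "g \<in> deriv_family ((\<lambda>h z. Re (h z)) ` \<H>)"
    then obtain h w where g: "g = (\<lambda>x. frechet_derivative (\<lambda>z. Re (h z)) (at x) w)" "h \<in> \<H>" "norm w \<le> 1"
      by (elim deriv_familyE imageE) simp
    have "g x = Re (deriv h x * w)" if "x \<in> ball 0 \<rho>" for x
      using frechet_derivative_at[OF der[OF g(2)], of x, symmetric] that Suc.prems(1) g(1) by simp
    then show "\<exists>f\<in>((\<lambda>h z. Re (h z)) ` ?\<H>'). \<forall>x\<in>ball 0 \<rho>. g x = f x"
      using g(2,3) by (intro bexI[OF _ imageI[OF imageI[of "(h, w)"]]]) auto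
  qed
  moreover have "\<forall>g\<in>((\<lambda>h z. Re (h z)) ` \<H>). \<forall>x\<in>ball 0 \<rho>. g differentiable (at x)"
  proof (intro ballI, elim imageE)
    fix g h and x :: complex assume "g = (\<lambda>z. Re (h z))" "h \<in> \<H>" "x \<in> ball 0 \<rho>"
    then show "g differentiable (at x)"
      using der[of h x] Suc.prems(1) unfolding differentiable_def by auto
  qed
  moreover have "\<exists>B. \<forall>g\<in>((\<lambda>h z. Re (h z)) ` \<H>). \<forall>x\<in>ball 0 \<rho>. \<bar>g x\<bar> \<le> B"
    using bd by (intro exI[of _ B] ballI, elim imageE, simp)
  ultimately show ?case by simp
qed

definition derivs_le :: "nat \<Rightarrow> real \<Rightarrow> complex set \<Rightarrow> (complex \<Rightarrow> real) \<Rightarrow> bool" where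
  "derivs_le k B S g \<longleftrightarrow> (\<forall>vs. length vs \<le> k \<longrightarrow> set vs \<subseteq> cball 0 1 \<longrightarrow>
     (\<forall>x\<in>S. dir_derivs vs g differentiable (at x) \<and> \<bar>dir_derivs vs g x\<bar> \<le> B))"

lemma bdd_derivs_imp_derivs_le:
  assumes "bdd_derivs (Suc k) S \<F>"
  shows "\<exists>B\<ge>0. \<forall>g\<in>\<F>. derivs_le k B S g"
  using assms
proof (induction k arbitrary: \<F>)
  case 0
  obtain B where B: "\<forall>g\<in>\<F>. \<forall>x\<in>S. \<bar>g x\<bar> \<le> B" using bdd_derivs_bound[OF 0] by blast
  have "\<forall>g\<in>\<F>. derivs_le 0 \<bar>B\<bar> S g"
  proof
    fix g assume g: "g \<in> \<F>"
    have "\<bar>g x\<bar> \<le> \<bar>B\<bar>" if "x \<in> S" for x using B g that by fastforce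
    then show "derivs_le 0 \<bar>B\<bar> S g" using 0 g by (auto simp: derivs_le_def)
  qed
  then show ?case by (intro exI[of _ "\<bar>B\<bar>"]) simp
next
  case (Suc k)
  obtain B1 where B1: "\<forall>g\<in>\<F>. \<forall>x\<in>S. \<bar>g x\<bar> \<le> B1" using bdd_derivs_bound[OF Suc.prems] by blast
  have d: "\<forall>g\<in>\<F>. \<forall>x\<in>S. g differentiable (at x)" and "bdd_derivs (Suc k) S (deriv_family \<F>)"
    using Suc.prems unfolding bdd_derivs.simps(2)[of "Suc k"] by blast+
  then obtain B2 where B2: "B2 \<ge> 0" "\<forall>g\<in>deriv_family \<F>. derivs_le k B2 S g" using Suc.IH by blast
  have "derivs_le (Suc k) (\<bar>B1\<bar> + B2) S g" if g: "g \<in> \<F>" for g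
    unfolding derivs_le_def
  proof (intro allI impI)
    fix vs :: "complex list" assume vs: "length vs \<le> Suc k" "set vs \<subseteq> cball 0 1"
    show "\<forall>x\<in>S. dir_derivs vs g differentiable (at x) \<and> \<bar>dir_derivs vs g x\<bar> \<le> \<bar>B1\<bar> + B2"
    proof (cases vs rule: rev_cases)
      case Nil
      have "\<bar>g x\<bar> \<le> \<bar>B1\<bar> + B2" if "x \<in> S" for x using B1 B2(1) g that by fastforce
      then show ?thesis using d g Nil by auto
    next
      case (snoc ws w)
      have "(\<lambda>x. frechet_derivative g (at x) w) \<in> deriv_family \<F>"
        by (rule deriv_familyI[OF g]) (use vs snoc in auto)
      then have "derivs_le k B2 S (\<lambda>x. frechet_derivative g (at x) w)" using B2 by blast
      from this[unfolded derivs_le_def, rule_format, of ws] show ?thesis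
        using vs B2(1) unfolding snoc dir_derivs_snoc by (auto intro: add_increasing)
    qed
  qed
  then show ?case using B2 by (intro exI[of _ "\<bar>B1\<bar> + B2"]) simp
qed

section \<open>Taylor polynomials on segments and vanishing derivatives\<close>

primrec coeff_const :: "nat \<Rightarrow> real" where
  "coeff_const 0 = 1"
| "coeff_const (Suc K) = 1 + (real K + 2) * ((1 + 2 ^ Suc K) * coeff_const K)"

lemma coeff_const_ge_1: "coeff_const K \<ge> 1"
proof (induction K)
  case (Suc K)
  then have "0 \<le> (real K + 2) * ((1 + 2 ^ Suc K) * coeff_const K)" by (intro mult_nonneg_nonneg) auto
  then show ?case by simp
qed auto

text \<open>
  All norms on polynomials of bounded degree are equivalent. For an elementary proof note that
  \<open>p x - 2 ^ Suc K * p (x/2)\<close> has no term of degree \<open>Suc K\<close>, while its other coefficients are at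
  least as large as those of \<open>p\<close>.
\<close>
lemma poly_coeff_bound:
  fixes a :: "nat \<Rightarrow> real"
  assumes "\<And>x. 0 \<le> x \<Longrightarrow> x \<le> 1 \<Longrightarrow> \<bar>\<Sum>i\<le>K. a i * x ^ i\<bar> \<le> M" "k \<le> K"
  shows "\<bar>a k\<bar> \<le> coeff_const K * M"
  using assms
proof (induction K arbitrary: a M k)
  case 0
  then show ?case using "0.prems"(1)[of 0] by simp
next
  case (Suc K)
  define L where "L = (1 + 2 ^ Suc K) * coeff_const K * M"
  have M0: "M \<ge> 0" using Suc.prems(1)[of 0] by simp
  have L0: "L \<ge> 0" unfolding L_def using M0 coeff_const_ge_1[of K] by (intro mult_nonneg_nonneg) auto
  define b where "b = (\<lambda>i. a i * (1 - 2 ^ (Suc K - i)))"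
  have b: "\<bar>\<Sum>i\<le>K. b i * x ^ i\<bar> \<le> (1 + 2 ^ Suc K) * M" if x: "0 \<le> x" "x \<le> 1" for x
  proof -
    have "(\<Sum>i\<le>Suc K. a i * x ^ i) - 2 ^ Suc K * (\<Sum>i\<le>Suc K. a i * (x/2) ^ i)
        = (\<Sum>i\<le>Suc K. a i * x ^ i - 2 ^ Suc K * (a i * (x/2) ^ i))"
      unfolding sum_distrib_left sum_subtractf by simp
    also have "\<dots> = (\<Sum>i\<le>Suc K. b i * x ^ i)"
    proof (rule sum.cong)
      fix i assume "i \<in> {..Suc K}"
      then have "(2::real) ^ Suc K = 2 ^ (Suc K - i) * 2 ^ i" by (simp flip: power_add)
      then have eq: "2 ^ Suc K * (a i * (x/2) ^ i) = 2 ^ (Suc K - i) * a i * x ^ i"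
        unfolding power_divide by simp
      show "a i * x ^ i - 2 ^ Suc K * (a i * (x/2) ^ i) = b i * x ^ i"
        unfolding eq b_def by (simp add: algebra_simps)
    qed simp
    also have "\<dots> = (\<Sum>i\<le>K. b i * x ^ i)" by (simp add: b_def)
    finally have eq: "(\<Sum>i\<le>K. b i * x ^ i) = (\<Sum>i\<le>Suc K. a i * x ^ i) - 2 ^ Suc K * (\<Sum>i\<le>Suc K. a i * (x/2) ^ i)" by simp
    have "\<bar>2 ^ Suc K * (\<Sum>i\<le>Suc K. a i * (x/2) ^ i)\<bar> \<le> 2 ^ Suc K * M"
      using Suc.prems(1)[of "x/2"] x unfolding abs_mult by (intro mult_mono) auto
    then show ?thesis unfolding eq using Suc.prems(1)[of x] x
      by (simp add: algebra_simps)
  qed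
  have ai: "\<bar>a i\<bar> \<le> L" if i: "i \<le> K" for i
  proof -
    have "\<bar>b i\<bar> \<le> coeff_const K * ((1 + 2 ^ Suc K) * M)" by (rule Suc.IH[OF b i])
    moreover have "\<bar>a i\<bar> * 1 \<le> \<bar>a i\<bar> * \<bar>1 - 2 ^ (Suc K - i)\<bar>"
    proof (rule mult_left_mono)
      have "(2::real) ^ 1 \<le> 2 ^ (Suc K - i)" using i by (intro power_increasing) auto
      then show "1 \<le> \<bar>1 - (2::real) ^ (Suc K - i)\<bar>" by simp
    qed simp
    ultimately show ?thesis unfolding L_def b_def by (simp add: abs_mult mult.commute mult.left_commute)
  qed
  have c: "coeff_const (Suc K) * M = M + (real K + 2) * L" by (simp add: L_def algebra_simps)
  show ?case
  proof (cases "k = Suc K")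
    case True
    have "\<bar>\<Sum>i\<le>K. a i\<bar> \<le> (\<Sum>i\<le>K. L)" by (intro order_trans[OF sum_abs] sum_mono ai) simp
    then have "\<bar>\<Sum>i\<le>K. a i\<bar> \<le> (real K + 1) * L" by (simp add: add.commute)
    moreover have "\<bar>(\<Sum>i\<le>K. a i) + a (Suc K)\<bar> \<le> M" using Suc.prems(1)[of 1] by simp
    ultimately have "\<bar>a (Suc K)\<bar> \<le> M + (real K + 1) * L" by linarith
    moreover have "(real K + 2) * L = (real K + 1) * L + L" by (simp add: algebra_simps)
    ultimately show ?thesis unfolding True c using L0 by linarith
  next
    case False
    then have "\<bar>a k\<bar> \<le> L" using Suc.prems(2) ai by simp
    also have "L \<le> M + (real K + 2) * L"
    proof -
      have "1 * L \<le> (real K + 2) * L" using L0 by (intro mult_right_mono) auto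
      then show ?thesis using M0 by linarith
    qed
    finally show ?thesis unfolding c .
  qed
qed

lemma taylor_segment:
  fixes g :: "complex \<Rightarrow> real"
  assumes g: "derivs_le (Suc K) B (ball 0 R) g" and w: "norm w \<le> 1" and s: "0 \<le> s" "norm \<zeta> + s < R"
    and x: "0 \<le> x" "x \<le> 1"
  shows "\<bar>g (\<zeta> + of_real (x * s) * w) - (\<Sum>k\<le>K. (dir_derivs (replicate k w) g \<zeta> * s ^ k / fact k) * x ^ k)\<bar>
    \<le> B * s ^ Suc K"
proof (cases "x * s = 0")
  case True
  have B0: "B \<ge> 0"
  proof -
    have "\<zeta> \<in> ball 0 R" using s by simp
    then have "\<bar>dir_derivs [] g \<zeta>\<bar> \<le> B" using g[unfolded derivs_le_def, rule_format, of "[]"] by simp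
    then show ?thesis by simp
  qed
  have "(\<Sum>k\<le>K. (dir_derivs (replicate k w) g \<zeta> * s ^ k / fact k) * x ^ k)
      = (\<Sum>k\<in>{0}. (dir_derivs (replicate k w) g \<zeta> * s ^ k / fact k) * x ^ k)"
    by (rule sum.mono_neutral_right) (use True in auto)
  moreover have "of_real (x * s) * w = (0::complex)" using True by (simp only: of_real_0 mult_zero_left)
  then have eq: "\<zeta> + of_real (x * s) * w = \<zeta>" by (simp only: add_0_right)
  ultimately show ?thesis unfolding eq using B0 s by simp
next
  case False
  then have h: "0 < x * s" using x s by (auto simp: zero_less_mult_iff less_le)
  define D where "D = (\<lambda>m y. dir_derivs (replicate m w) g (\<zeta> + of_real y * w))"
  have inb: "\<zeta> + of_real t * w \<in> ball 0 R" if "0 \<le> t" "t \<le> x * s" for t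
  proof -
    have "norm (of_real t * w :: complex) \<le> t * 1" using that w mult_left_mono[of "norm w" 1 t] by (simp add: norm_mult)
    moreover have "x * s \<le> 1 * s" using x s by (intro mult_right_mono) auto
    ultimately have "norm (\<zeta> + of_real t * w) \<le> norm \<zeta> + s"
      using norm_triangle_ineq[of \<zeta> "of_real t * w"] that by linarith
    then show ?thesis using s by simp
  qed
  have gd: "dir_derivs (replicate m w) g differentiable (at y)" "\<bar>dir_derivs (replicate m w) g y\<bar> \<le> B"
    if "m \<le> Suc K" "y \<in> ball 0 R" for m y
    using g that w unfolding derivs_le_def by (auto simp: set_replicate_conv_if)
  have "\<exists>t. 0 < t \<and> t < x * s \<and> D 0 (x * s) = (\<Sum>m<Suc K. (D m 0 / fact m) * (x * s) ^ m) + (D (Suc K) t / fact (Suc K)) * (x * s) ^ Suc K"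
  proof (rule Maclaurin[OF h])
    show "\<forall>m t. m < Suc K \<and> 0 \<le> t \<and> t \<le> x * s \<longrightarrow> (D m has_real_derivative D (Suc m) t) (at t)"
    proof (intro allI impI)
      fix m t assume a: "m < Suc K \<and> 0 \<le> t \<and> t \<le> x * s"
      let ?f = "dir_derivs (replicate m w) g" and ?y = "\<zeta> + of_real t * w"
      have "?f differentiable (at ?y)" using gd(1) inb a by simp
      then have f: "(?f has_derivative frechet_derivative ?f (at ?y)) (at ?y)" by (simp add: frechet_derivative_works)
      have l: "((\<lambda>y. \<zeta> + of_real y * w) has_derivative (\<lambda>y. of_real y * w)) (at t)"
        by (auto intro!: derivative_eq_intros)
      have "(D m has_derivative (\<lambda>y. frechet_derivative ?f (at ?y) (of_real y * w))) (at t)"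
        unfolding D_def using has_derivative_compose[OF l f] .
      moreover have "frechet_derivative ?f (at ?y) (of_real y * w) = D (Suc m) t * y" for y
        using linear_scale[OF has_derivative_linear[OF f], of y w] by (simp add: D_def scaleR_conv_of_real)
      ultimately show "(D m has_real_derivative D (Suc m) t) (at t)"
        by (simp add: has_field_derivative_def)
    qed
  qed auto
  then obtain t where t: "0 < t" "t < x * s"
    and eq: "D 0 (x * s) = (\<Sum>m<Suc K. (D m 0 / fact m) * (x * s) ^ m) + (D (Suc K) t / fact (Suc K)) * (x * s) ^ Suc K"
    by blast
  have "\<bar>D (Suc K) t\<bar> \<le> B" unfolding D_def by (rule gd(2)[OF order_refl inb]) (use t in auto)
  then have "\<bar>D (Suc K) t\<bar> / fact (Suc K) \<le> B / 1" by (intro frac_le) (auto simp del: fact_Suc)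
  moreover have "(x * s) ^ Suc K \<le> s ^ Suc K" using x s by (intro power_mono) (auto intro: mult_left_le_one_le)
  ultimately have "\<bar>(D (Suc K) t / fact (Suc K)) * (x * s) ^ Suc K\<bar> \<le> B * s ^ Suc K"
    using h \<open>\<bar>D (Suc K) t\<bar> \<le> B\<close> unfolding abs_mult abs_divide by (intro mult_mono) auto
  moreover have "(\<Sum>m<Suc K. (D m 0 / fact m) * (x * s) ^ m) = (\<Sum>k\<le>K. (dir_derivs (replicate k w) g \<zeta> * s ^ k / fact k) * x ^ k)"
    by (simp add: D_def lessThan_Suc_atMost power_mult_distrib mult_ac)
  ultimately show ?thesis using eq by (simp add: D_def)
qed

text \<open>
  Interpolation in the style of Landau: a function that is small on a segment, and whose derivative
  of order \<open>Suc K\<close> is bounded, has small derivatives of the intermediate orders.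
\<close>
lemma derivative_interpolation:
  fixes g :: "complex \<Rightarrow> real"
  assumes g: "derivs_le (Suc K) B (ball 0 R) g" and w: "norm w \<le> 1" and s: "0 \<le> s" "norm \<zeta> + s < R"
    and M: "\<And>x. 0 \<le> x \<Longrightarrow> x \<le> 1 \<Longrightarrow> \<bar>g (\<zeta> + of_real (x * s) * w)\<bar> \<le> M" and k: "k \<le> K"
  shows "\<bar>dir_derivs (replicate k w) g \<zeta>\<bar> * s ^ k / fact k \<le> coeff_const K * (M + B * s ^ Suc K)"
proof -
  have "\<bar>dir_derivs (replicate k w) g \<zeta> * s ^ k / fact k\<bar> \<le> coeff_const K * (M + B * s ^ Suc K)"
  proof (rule poly_coeff_bound[OF _ k])
    fix x :: real assume x: "0 \<le> x" "x \<le> 1"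
    show "\<bar>\<Sum>k\<le>K. dir_derivs (replicate k w) g \<zeta> * s ^ k / fact k * x ^ k\<bar> \<le> M + B * s ^ Suc K"
      using taylor_segment[OF g w s x] M[OF x] by linarith
  qed
  then show ?thesis using s by (simp add: abs_mult)
qed

lemma bdd_derivs_const:
  assumes "open S" shows "bdd_derivs k S {\<lambda>x. c}"
proof (cases k)
  case (Suc m)
  have "deriv_family {\<lambda>x. c} \<subseteq> {\<lambda>x. 0}"
    unfolding deriv_family_def by (auto simp: frechet_derivative_const)
  then have "bdd_derivs m S (deriv_family {\<lambda>x. c})"
    using bdd_derivs_subset[OF assms bdd_derivs_zero[OF assms]] by blast
  then show ?thesis unfolding Suc by (simp add: exI[of _ "\<bar>c\<bar>"])
qed auto

lemma bdd_derivs_frechet_derivative: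
  assumes g: "\<And>k. bdd_derivs k S {g}" and S: "open S"
  shows "bdd_derivs k S {\<lambda>x. frechet_derivative g (at x) w}"
proof -
  have "bdd_derivs k S (prod_family {\<lambda>x. norm w} (deriv_family {g}))"
    using g[of "Suc k"] by (intro bdd_derivs_mult bdd_derivs_const S) simp
  then show ?thesis
  proof (rule bdd_derivs_cong[OF S])
    fix h assume "h \<in> {\<lambda>x. frechet_derivative g (at x) w}"
    then have h: "h = (\<lambda>x. frechet_derivative g (at x) w)" by simp
    have "h x = norm w * frechet_derivative g (at x) (sgn w)" if "x \<in> S" for x
    proof -
      have "g differentiable (at x)" using g[of "Suc 0"] that by simp
      then have "linear (frechet_derivative g (at x))" by (rule linear_frechet_derivative)
      from linear_scale[OF this, of "norm w" "sgn w"] show ?thesis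
        by (cases "w = 0") (auto simp: h sgn_div_norm)
    qed
    moreover have "(\<lambda>x. norm w * frechet_derivative g (at x) (sgn w)) \<in> prod_family {\<lambda>x. norm w} (deriv_family {g})"
      by (intro prod_familyI deriv_familyI) (auto simp: norm_sgn)
    ultimately show "\<exists>f\<in>prod_family {\<lambda>x. norm w} (deriv_family {g}). \<forall>x\<in>S. h x = f x"
      by (intro bexI) auto
  qed
qed

text \<open>
  A smooth function of size \<open>O(\<bar>\<zeta>\<bar>\<^sup>m)\<close> has a derivative of size \<open>O(\<bar>\<zeta>\<bar>\<^sup>m\<^sup>-\<^sup>1)\<close>: apply the interpolation
  inequality on the segment of length \<open>\<bar>\<zeta>\<bar>\<close> that starts at \<open>\<zeta>\<close>. This avoids Taylor polynomials in
  several variables and the symmetry of higher derivatives.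
\<close>
lemma frechet_derivative_vanishes:
  assumes g: "\<And>k. bdd_derivs k (ball 0 R) {g}" and R: "0 < R"
    and A: "\<And>\<zeta>. norm \<zeta> < R \<Longrightarrow> \<bar>g \<zeta>\<bar> \<le> A * norm \<zeta> ^ Suc (Suc n)"
  obtains A' where "\<And>\<zeta>. norm \<zeta> < R / 2 \<Longrightarrow> \<bar>frechet_derivative g (at \<zeta>) w\<bar> \<le> A' * norm \<zeta> ^ Suc n"
proof -
  let ?K = "Suc n"
  obtain B where B: "0 \<le> B" "derivs_le (Suc ?K) B (ball 0 R) g"
    using bdd_derivs_imp_derivs_le[OF g[of "Suc (Suc ?K)"]] by blast
  define u where "u = sgn w"
  have u: "norm u \<le> 1" by (simp add: u_def norm_sgn)
  have A0: "A \<ge> 0"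
  proof -
    have "norm (complex_of_real (R/2)) = R/2" using R by simp
    then have "0 \<le> A * (R/2) ^ Suc (Suc n)" using A[of "of_real (R/2)"] R abs_ge_zero order_trans by fastforce
    moreover have "0 < (R/2) ^ Suc (Suc n)" using R by simp
    ultimately show ?thesis by (meson linorder_not_less mult_neg_pos)
  qed
  define L where "L = coeff_const ?K * (A * 2 ^ Suc ?K + B)"
  have L0: "L \<ge> 0" unfolding L_def using coeff_const_ge_1[of ?K] A0 B by (intro mult_nonneg_nonneg add_nonneg_nonneg) auto
  have key: "\<bar>frechet_derivative g (at \<zeta>) u\<bar> \<le> L * s ^ Suc n"
    if s: "0 < s" "norm \<zeta> \<le> s" "s < R / 2" for \<zeta> s
  proof -
    have "\<bar>dir_derivs (replicate 1 u) g \<zeta>\<bar> * s ^ 1 / fact 1 \<le> coeff_const ?K * (A * (2 * s) ^ Suc ?K + B * s ^ Suc ?K)"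
    proof (rule derivative_interpolation[OF B(2) u])
      fix x :: real assume x: "0 \<le> x" "x \<le> 1"
      have "norm (of_real (x * s) * u) \<le> s"
        using x s u mult_mono[of x 1 s s] mult_mono[of "x * s" s "norm u" 1] by (simp add: norm_mult)
      then have n: "norm (\<zeta> + of_real (x * s) * u) \<le> 2 * s"
        using norm_triangle_ineq[of \<zeta> "of_real (x * s) * u"] s by linarith
      then have "\<bar>g (\<zeta> + of_real (x * s) * u)\<bar> \<le> A * norm (\<zeta> + of_real (x * s) * u) ^ Suc ?K"
        using A s by simp
      also have "\<dots> \<le> A * (2 * s) ^ Suc ?K" using n A0 by (intro mult_left_mono power_mono) auto
      finally show "\<bar>g (\<zeta> + of_real (x * s) * u)\<bar> \<le> A * (2 * s) ^ Suc ?K" .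
    qed (use s in auto)
    then have "\<bar>frechet_derivative g (at \<zeta>) u\<bar> * s \<le> (L * s ^ Suc n) * s"
      unfolding L_def by (simp add: algebra_simps power_mult_distrib)
    then show ?thesis by (rule mult_right_le_imp_le) (rule s)
  qed
  have "\<bar>frechet_derivative g (at \<zeta>) u\<bar> \<le> L * norm \<zeta> ^ Suc n" if z: "norm \<zeta> < R / 2" for \<zeta>
  proof (cases "\<zeta> = 0")
    case True
    have "\<bar>frechet_derivative g (at \<zeta>) u\<bar> \<le> 0"
    proof (rule tendsto_lowerbound)
      show "((\<lambda>s. L * s ^ Suc n) \<longlongrightarrow> 0) (at_right 0)" by (auto intro!: tendsto_eq_intros)
      have "\<forall>\<^sub>F s in at_right (0::real). 0 < s \<and> s < R/2"
        using R by (auto simp: eventually_at_right_field intro!: exI[of _ "R/2"])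
      then show "\<forall>\<^sub>F s in at_right 0. \<bar>frechet_derivative g (at \<zeta>) u\<bar> \<le> L * s ^ Suc n"
        by eventually_elim (use key True in auto)
    qed simp
    then show ?thesis using L0 by auto
  qed (use key z in auto)
  moreover have "frechet_derivative g (at \<zeta>) w = norm w * frechet_derivative g (at \<zeta>) u" if "norm \<zeta> < R / 2" for \<zeta>
  proof -
    have "g differentiable (at \<zeta>)" using g[of "Suc 0"] that R by simp
    then have "linear (frechet_derivative g (at \<zeta>))" by (rule linear_frechet_derivative)
    from linear_scale[OF this, of "norm w" u] linear_0[OF this] show ?thesis
      by (cases "w = 0") (auto simp: u_def sgn_div_norm)
  qed
  ultimately have "\<bar>frechet_derivative g (at \<zeta>) w\<bar> \<le> (norm w * L) * norm \<zeta> ^ Suc n" if "norm \<zeta> < R / 2" for \<zeta>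
    using that by (simp add: abs_mult mult_left_mono mult.assoc)
  then show ?thesis using that by blast
qed

lemma bdd_derivs_mono_set: "bdd_derivs k S \<F> \<Longrightarrow> T \<subseteq> S \<Longrightarrow> bdd_derivs k T \<F>"
proof (induction k arbitrary: \<F>)
  case 0
  then obtain B where "\<forall>g\<in>\<F>. \<forall>x\<in>S. \<bar>g x\<bar> \<le> B" by auto
  then have "\<forall>g\<in>\<F>. \<forall>x\<in>T. \<bar>g x\<bar> \<le> B" using 0(2) by blast
  then show ?case by auto
next
  case (Suc k)
  obtain B where "\<forall>g\<in>\<F>. \<forall>x\<in>S. \<bar>g x\<bar> \<le> B" using bdd_derivs_bound[OF Suc.prems(1)] by auto
  then have "\<forall>g\<in>\<F>. \<forall>x\<in>T. \<bar>g x\<bar> \<le> B" using Suc.prems(2) by blast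
  moreover have "bdd_derivs k T (deriv_family \<F>)" using Suc.prems by (intro Suc.IH) auto
  moreover have "\<forall>g\<in>\<F>. \<forall>x\<in>T. g differentiable (at x)" using Suc.prems by auto
  ultimately show ?case unfolding bdd_derivs.simps(2) by (intro conjI exI[of _ B])
qed

lemma dir_derivs_vanish:
  assumes "\<And>k. bdd_derivs k (ball 0 R) {g}" "0 < R"
    and "\<And>\<zeta>. norm \<zeta> < R \<Longrightarrow> \<bar>g \<zeta>\<bar> \<le> A * norm \<zeta> ^ Suc (length vs)"
  shows "dir_derivs vs g 0 = 0"
  using assms
proof (induction vs arbitrary: g A R rule: rev_induct)
  case Nil
  then show ?case using Nil(3)[of 0] by simp
next
  case (snoc w vs)
  obtain A' where A': "\<And>\<zeta>. norm \<zeta> < R / 2 \<Longrightarrow> \<bar>frechet_derivative g (at \<zeta>) w\<bar> \<le> A' * norm \<zeta> ^ Suc (length vs)"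
    using frechet_derivative_vanishes[OF snoc.prems(1,2), of A "length vs" w] snoc.prems(3) by auto
  have sub: "ball 0 (R/2) \<subseteq> (ball 0 R :: complex set)" using snoc.prems(2) by (intro subset_ball) simp
  show ?case unfolding dir_derivs_snoc
    by (rule snoc.IH[OF bdd_derivs_mono_set[OF _ sub, OF bdd_derivs_frechet_derivative[OF snoc.prems(1) open_ball]] _ A']) (use snoc.prems in auto)
qed

lemma vanishing_order_ge:
  assumes "\<And>k. bdd_derivs k (ball 0 R) {g}" "0 < R"
    and "\<And>\<zeta>. norm \<zeta> < R \<Longrightarrow> \<bar>g \<zeta>\<bar> \<le> A * norm \<zeta> ^ n"
  shows "vanishing_order g \<ge> enat n"
proof (cases n)
  case (Suc m)
  have g0: "g 0 = 0" using assms(3)[of 0] \<open>0 < R\<close> Suc by simp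
  have A0: "A \<ge> 0"
  proof -
    have "norm (complex_of_real (R/2)) = R/2" using \<open>0 < R\<close> by simp
    then have "0 \<le> A * (R/2) ^ n" using assms(3)[of "of_real (R/2)"] \<open>0 < R\<close> abs_ge_zero order_trans by fastforce
    moreover have "0 < (R/2) ^ n" using \<open>0 < R\<close> by simp
    ultimately show ?thesis by (meson linorder_not_less mult_neg_pos)
  qed
  have "dir_derivs vs g 0 = 0" if vs: "length vs < n" for vs
  proof (rule dir_derivs_vanish)
    define \<rho> where "\<rho> = min R 1"
    show "0 < R" by fact
    show "bdd_derivs k (ball 0 R) {g}" for k by fact
    fix \<zeta> :: complex assume z: "norm \<zeta> < R"
    have "norm \<zeta> ^ n = norm \<zeta> ^ Suc (length vs) * norm \<zeta> ^ (n - Suc (length vs))"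
      using vs by (simp flip: power_add power_Suc del: power_Suc)
    also have "\<dots> \<le> norm \<zeta> ^ Suc (length vs) * (R + 1) ^ n"
    proof (rule mult_left_mono)
      have "norm \<zeta> ^ (n - Suc (length vs)) \<le> (R + 1) ^ (n - Suc (length vs))" using z by (intro power_mono) auto
      also have "\<dots> \<le> (R + 1) ^ n" using \<open>0 < R\<close> by (intro power_increasing) auto
      finally show "norm \<zeta> ^ (n - Suc (length vs)) \<le> (R + 1) ^ n" .
    qed simp
    finally have "A * norm \<zeta> ^ n \<le> A * (norm \<zeta> ^ Suc (length vs) * (R + 1) ^ n)" using A0 by (rule mult_left_mono)
    then show "\<bar>g \<zeta>\<bar> \<le> (A * (R + 1) ^ n) * norm \<zeta> ^ Suc (length vs)" using assms(3)[OF z] by (simp add: mult_ac)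
  qed
  then show ?thesis unfolding vanishing_order_def g0 by (intro Sup_upper) auto
qed (simp add: enat_0)

section \<open>Growth and lower bounds for a compact family\<close>

definition sup_abs :: "(complex \<Rightarrow> real) \<Rightarrow> real \<Rightarrow> real" where
  "sup_abs g t = (SUP \<zeta>\<in>cball 0 t. \<bar>g \<zeta>\<bar>)"

lemma bdd_above_abs_cball:
  assumes "continuous_on (cball 0 t) (g :: complex \<Rightarrow> real)"
  shows "bdd_above ((\<lambda>\<zeta>. \<bar>g \<zeta>\<bar>) ` cball 0 t)"
proof -
  have "compact ((\<lambda>\<zeta>. \<bar>g \<zeta>\<bar>) ` cball 0 t)"
    by (intro compact_continuous_image continuous_intros assms compact_cball)
  then show ?thesis by (simp add: bounded_imp_bdd_above compact_imp_bounded)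
qed

lemma abs_le_sup_abs:
  "continuous_on (cball 0 t) g \<Longrightarrow> norm \<zeta> \<le> t \<Longrightarrow> \<bar>g \<zeta>\<bar> \<le> sup_abs g t"
  unfolding sup_abs_def by (rule cSUP_upper[OF _ bdd_above_abs_cball]) auto

lemma sup_abs_least:
  "0 \<le> t \<Longrightarrow> (\<And>\<zeta>. norm \<zeta> \<le> t \<Longrightarrow> \<bar>g \<zeta>\<bar> \<le> M) \<Longrightarrow> sup_abs g t \<le> M"
  unfolding sup_abs_def by (rule cSUP_least) auto

lemma sup_abs_attained:
  assumes "continuous_on (cball 0 t) g" "0 \<le> t"
  obtains \<zeta> where "norm \<zeta> \<le> t" "sup_abs g t = \<bar>g \<zeta>\<bar>"
proof -
  have "\<exists>x\<in>cball 0 t. \<forall>y\<in>cball 0 t. \<bar>g y\<bar> \<le> \<bar>g x\<bar>"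
    by (rule continuous_attains_sup) (use assms in \<open>auto intro!: continuous_intros\<close>)
  then obtain x where x: "x \<in> cball 0 t" "\<And>y. y \<in> cball 0 t \<Longrightarrow> \<bar>g y\<bar> \<le> \<bar>g x\<bar>" by blast
  have "sup_abs g t \<le> \<bar>g x\<bar>" by (rule sup_abs_least) (use x assms in auto)
  then show ?thesis using that[of x] abs_le_sup_abs[OF assms(1), of x] x(1) by simp
qed

lemma derivs_le_continuous_on:
  assumes "derivs_le k B (ball 0 R) g" "t < R"
  shows "continuous_on (cball 0 t) g"
proof (intro continuous_at_imp_continuous_on ballI)
  fix x :: complex assume "x \<in> cball 0 t"
  then have "x \<in> ball 0 R" using assms(2) by simp
  then have "g differentiable (at x)" using assms(1)[unfolded derivs_le_def, rule_format, of "[]" x] by simp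
  then show "isCont g x" by (rule differentiable_imp_continuous_within)
qed

definition growth_const :: "nat \<Rightarrow> real" where "growth_const K = 2 * (real K + 1) * coeff_const K + 1"

lemma growth_const_ge_1: "growth_const K \<ge> 1"
  unfolding growth_const_def using coeff_const_ge_1[of K] by simp

text \<open>
  On each ray the function is a polynomial of degree \<open>K\<close> up to the Taylor remainder, and the
  coefficients of this polynomial are controlled by its values at distance at most \<open>t\<close>.
\<close>
lemma sup_abs_growth_aux:
  assumes g: "derivs_le (Suc K) B (ball 0 R) g" and t: "0 < t" "t \<le> T" "T < R"
  shows "sup_abs g T \<le> (real K + 1) * coeff_const K * (T / t) ^ K * (sup_abs g t + B * t ^ Suc K) + B * T ^ Suc K"
proof (rule sup_abs_least)
  fix \<zeta> :: complex assume z: "norm \<zeta> \<le> T"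
  define w where "w = sgn \<zeta>"
  define x where "x = norm \<zeta> / T"
  have w: "norm w \<le> 1" by (simp add: w_def norm_sgn)
  have x: "0 \<le> x" "x \<le> 1" using z t by (auto simp: x_def)
  have \<zeta>: "0 + of_real (x * T) * w = \<zeta>" using t by (cases "\<zeta> = 0") (auto simp: x_def w_def sgn_div_norm scaleR_conv_of_real)
  define d where "d = (\<lambda>k. dir_derivs (replicate k w) g 0)"
  define L where "L = coeff_const K * (sup_abs g t + B * t ^ Suc K)"
  have cont: "continuous_on (cball 0 t) g" using derivs_le_continuous_on[OF g] t by simp
  have d: "\<bar>d k\<bar> * t ^ k / fact k \<le> L" if "k \<le> K" for k
    unfolding d_def L_def
  proof (rule derivative_interpolation[OF g w _ _ _ that])
    fix y :: real assume y: "0 \<le> y" "y \<le> 1"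
    have "norm (of_real (y * t) * w) \<le> t"
      using y t w mult_mono[of y 1 t t] mult_mono[of "y * t" t "norm w" 1] by (simp add: norm_mult)
    then show "\<bar>g (0 + of_real (y * t) * w)\<bar> \<le> sup_abs g t"
      using abs_le_sup_abs[OF cont] by simp
  qed (use t in auto)
  have L0: "0 \<le> L" using d[of 0] by (simp add: order_trans[OF abs_ge_zero])
  have Tt: "T / t \<ge> 1" using t by simp
  have tm: "\<bar>d k * T ^ k / fact k * x ^ k\<bar> \<le> L * (T / t) ^ K" if k: "k \<le> K" for k
  proof -
    have "\<bar>d k * T ^ k / fact k * x ^ k\<bar> = (\<bar>d k\<bar> * t ^ k / fact k) * (T / t) ^ k * x ^ k"
      using t x by (simp add: abs_mult power_divide)
    also have "\<dots> \<le> (L * (T / t) ^ K) * 1"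
    proof (intro mult_mono d k)
      show "(T / t) ^ k \<le> (T / t) ^ K" using Tt k by (intro power_increasing) auto
      show "x ^ k \<le> 1" using x by (intro power_le_one) auto
    qed (use L0 t x in auto)
    finally show ?thesis by simp
  qed
  have "\<bar>\<Sum>k\<le>K. d k * T ^ k / fact k * x ^ k\<bar> \<le> (\<Sum>k\<le>K. L * (T / t) ^ K)"
    by (intro order_trans[OF sum_abs] sum_mono tm) simp
  also have "\<dots> = (real K + 1) * (L * (T / t) ^ K)" by (simp add: add.commute)
  finally have "\<bar>\<Sum>k\<le>K. d k * T ^ k / fact k * x ^ k\<bar> \<le> (real K + 1) * (L * (T / t) ^ K)" .
  moreover have "\<bar>g \<zeta> - (\<Sum>k\<le>K. d k * T ^ k / fact k * x ^ k)\<bar> \<le> B * T ^ Suc K"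
    using taylor_segment[OF g w, of T 0 x] t x unfolding \<zeta> d_def by simp
  moreover have "(real K + 1) * (L * (T / t) ^ K) = (real K + 1) * coeff_const K * (T / t) ^ K * (sup_abs g t + B * t ^ Suc K)"
    unfolding L_def by (simp only: mult_ac)
  ultimately show "\<bar>g \<zeta>\<bar> \<le> (real K + 1) * coeff_const K * (T / t) ^ K * (sup_abs g t + B * t ^ Suc K) + B * T ^ Suc K"
    by linarith
qed (use t in simp)

text \<open>
  With a lower bound of order \<open>K\<close> the Taylor remainder is absorbed on small discs. The point is
  that the constant depends on \<open>K\<close> only; \<open>B\<close> and \<open>c\<close> influence nothing but the range of radii.
\<close>
lemma sup_abs_growth:
  assumes g: "derivs_le (Suc K) B (ball 0 R) g" "0 \<le> B"
    and c: "\<And>s. 0 < s \<Longrightarrow> s \<le> t0 \<Longrightarrow> c * s ^ K \<le> sup_abs g s" and t0: "B * t0 \<le> c" "t0 < R"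
    and t: "0 < t" "t \<le> T" "T \<le> t0"
  shows "sup_abs g T \<le> growth_const K * (T / t) ^ K * sup_abs g t"
proof -
  let ?N = "sup_abs g t"
  have small: "B * s ^ Suc K \<le> c * s ^ K" if "0 < s" "s \<le> t0" for s
  proof -
    have "B * s \<le> c" using that g(2) t0(1) mult_left_mono[of s t0 B] by linarith
    then have "(B * s) * s ^ K \<le> c * s ^ K" using that by (intro mult_right_mono) auto
    then show ?thesis by (simp add: mult_ac)
  qed
  have 1: "B * t ^ Suc K \<le> ?N" using small[of t] c[of t] t by linarith
  have "c * T ^ K = (T / t) ^ K * (c * t ^ K)" using t by (simp add: power_divide)
  also have "\<dots> \<le> (T / t) ^ K * ?N" using c[of t] t by (intro mult_left_mono) auto
  finally have 2: "B * T ^ Suc K \<le> (T / t) ^ K * ?N" using small[of T] t by linarith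
  have "sup_abs g T \<le> (real K + 1) * coeff_const K * (T / t) ^ K * (?N + B * t ^ Suc K) + B * T ^ Suc K"
    by (rule sup_abs_growth_aux[OF g(1)]) (use t t0 in auto)
  also have "\<dots> \<le> (real K + 1) * coeff_const K * (T / t) ^ K * (?N + ?N) + (T / t) ^ K * ?N"
    using 1 2 t coeff_const_ge_1[of K] by (intro add_mono mult_left_mono) auto
  also have "\<dots> = growth_const K * (T / t) ^ K * ?N" by (simp add: growth_const_def algebra_simps)
  finally show ?thesis .
qed

definition lipschitz_const :: "nat \<Rightarrow> real" where "lipschitz_const K = coeff_const K * (growth_const K * 2 ^ K + 1) + 1"

lemma lipschitz_const_ge_1: "lipschitz_const K \<ge> 1"
  unfolding lipschitz_const_def using coeff_const_ge_1[of K] growth_const_ge_1[of K] by simp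

lemma sup_abs_lipschitz:
  assumes g: "derivs_le (Suc K) B (ball 0 R) g" "0 \<le> B" and K: "1 \<le> K"
    and c: "\<And>s. 0 < s \<Longrightarrow> s \<le> t0 \<Longrightarrow> c * s ^ K \<le> sup_abs g s" and t0: "B * t0 \<le> c" "t0 < R"
    and t: "0 < t" "2 * t \<le> t0" and z: "norm \<zeta> \<le> t" "norm \<xi> \<le> t"
  shows "\<bar>g \<zeta> - g \<xi>\<bar> \<le> lipschitz_const K * (sup_abs g t / t) * norm (\<zeta> - \<xi>)"
proof -
  let ?N = "sup_abs g t"
  have N0: "0 \<le> ?N"
    using abs_le_sup_abs[OF derivs_le_continuous_on[OF g(1)], of t 0] t t0 by force
  have diff: "g differentiable (at x)" if "norm x \<le> t" for x
    using g(1)[unfolded derivs_le_def, rule_format, of "[]" x] that t t0 by simp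
  have D1: "\<bar>frechet_derivative g (at x) w\<bar> \<le> lipschitz_const K * (?N / t)" if x: "norm x \<le> t" and w: "norm w \<le> 1" for x w
  proof -
    have cont: "continuous_on (cball 0 (2*t)) g" using derivs_le_continuous_on[OF g(1)] t t0 by simp
    have "\<bar>dir_derivs (replicate 1 w) g x\<bar> * t ^ 1 / fact 1 \<le> coeff_const K * (sup_abs g (2 * t) + B * t ^ Suc K)"
    proof (rule derivative_interpolation[OF g(1) w])
      fix y :: real assume y: "0 \<le> y" "y \<le> 1"
      have "norm (of_real (y * t) * w) \<le> t"
        using y t w mult_mono[of y 1 t t] mult_mono[of "y * t" t "norm w" 1] by (simp add: norm_mult)
      then have "norm (x + of_real (y * t) * w) \<le> 2 * t"
        using norm_triangle_ineq[of x "of_real (y * t) * w"] x by linarith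
      then show "\<bar>g (x + of_real (y * t) * w)\<bar> \<le> sup_abs g (2 * t)"
        using abs_le_sup_abs[OF cont] by simp
    qed (use t t0 x K in auto)
    also have "\<dots> \<le> coeff_const K * (growth_const K * 2 ^ K * ?N + ?N)"
    proof (intro mult_left_mono add_mono)
      show "sup_abs g (2 * t) \<le> growth_const K * 2 ^ K * ?N"
        using sup_abs_growth[OF g c t0, of t "2 * t"] t by simp
      have "B * t \<le> c" using t g(2) t0(1) mult_left_mono[of t t0 B] by linarith
      then have "(B * t) * t ^ K \<le> c * t ^ K" using t by (intro mult_right_mono) auto
      moreover have "(B * t) * t ^ K = B * t ^ Suc K" by simp
      ultimately show "B * t ^ Suc K \<le> ?N" using c[of t] t by linarith
    qed (use coeff_const_ge_1[of K] in auto)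
    also have "\<dots> \<le> lipschitz_const K * ?N" unfolding lipschitz_const_def using N0 by (simp add: algebra_simps)
    finally show ?thesis using t by (simp add: field_simps)
  qed
  have "norm (g \<zeta> - g \<xi>) \<le> lipschitz_const K * (?N / t) * norm (\<zeta> - \<xi>)"
  proof (rule differentiable_bound[of "cball 0 t" g "\<lambda>x. frechet_derivative g (at x)"])
    fix x :: complex assume x: "x \<in> cball 0 t"
    then have d: "(g has_derivative frechet_derivative g (at x)) (at x)" using diff frechet_derivative_works by auto
    then show "(g has_derivative frechet_derivative g (at x)) (at x within cball 0 t)" by (rule has_derivative_at_withinI)
    show "onorm (frechet_derivative g (at x)) \<le> lipschitz_const K * (?N / t)"
    proof (rule onorm_le)
      fix h :: complex
      have lin: "linear (frechet_derivative g (at x))" using d has_derivative_linear by blast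
      have "frechet_derivative g (at x) h = norm h * frechet_derivative g (at x) (sgn h)"
        using linear_scale[OF lin, of "norm h" "sgn h"] linear_0[OF lin] by (cases "h = 0") (auto simp: sgn_div_norm)
      then show "norm (frechet_derivative g (at x) h) \<le> lipschitz_const K * (?N / t) * norm h"
        using mult_left_mono[OF D1[of x "sgn h"], of "norm h"] x by (simp add: abs_mult norm_sgn mult_ac)
    qed
  qed (use z in auto)
  then show ?thesis by simp
qed

text \<open>
  Otherwise there are \<open>v\<^sub>j\<close> and \<open>t\<^sub>j\<close> tending to \<open>0\<close> for which \<open>G v\<^sub>j\<close> is \<open>o(t\<^sub>j\<^sup>K)\<close> on the disc of radius
  \<open>t\<^sub>j\<close>. By the growth estimate all terms of order at most \<open>K\<close> disappear in the limit, so that a limit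
  point \<open>v\<close> of the \<open>v\<^sub>j\<close> contradicts the last assumption.
\<close>
lemma uniform_lower_bound:
  fixes G :: "'v::metric_space \<Rightarrow> complex \<Rightarrow> real"
  assumes X: "compact X" and R: "0 < R" and B: "0 \<le> B"
    and G: "\<And>v. v \<in> X \<Longrightarrow> derivs_le (Suc K) B (ball 0 R) (G v)"
    and cont: "\<And>\<zeta>. norm \<zeta> < R \<Longrightarrow> continuous_on X (\<lambda>v. G v \<zeta>)"
    and nv: "\<And>v A. v \<in> X \<Longrightarrow> \<exists>\<zeta>. norm \<zeta> < R \<and> \<not> \<bar>G v \<zeta>\<bar> \<le> A * norm \<zeta> ^ Suc K"
  obtains c t0 where "0 < c" "0 < t0" "t0 < R"
    "\<And>v t. v \<in> X \<Longrightarrow> 0 < t \<Longrightarrow> t \<le> t0 \<Longrightarrow> c * t ^ K \<le> sup_abs (G v) t"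
proof (rule ccontr)
  assume "\<not> thesis"
  then have neg: "\<exists>v t. v \<in> X \<and> 0 < t \<and> t \<le> t0 \<and> sup_abs (G v) t < c * t ^ K"
    if "0 < c" "0 < t0" "t0 < R" for c t0
    using that \<open>\<And>t0 c. \<lbrakk>0 < c; 0 < t0; t0 < R; \<And>v t. \<lbrakk>v \<in> X; 0 < t; t \<le> t0\<rbrakk> \<Longrightarrow> c * t ^ K \<le> sup_abs (G v) t\<rbrakk> \<Longrightarrow> thesis\<close>
    by (meson not_le)
  define e where "e = (\<lambda>j::nat. 1 / (real j + 2))"
  have e: "0 < e j" "e j < 1" for j by (auto simp: e_def)
  have "\<forall>j. \<exists>v t. v \<in> X \<and> 0 < t \<and> t \<le> R * e j \<and> sup_abs (G v) t < e j * t ^ K"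
    using neg e R by (auto simp: mult_less_cancel_left1)
  then obtain v t where vt: "\<And>j. v j \<in> X" "\<And>j. 0 < t j" "\<And>j. t j \<le> R * e j"
    "\<And>j. sup_abs (G (v j)) (t j) < e j * t j ^ K" by metis
  obtain l \<sigma> where l: "l \<in> X" "strict_mono \<sigma>" "(v \<circ> \<sigma>) \<longlonglongrightarrow> l"
    using X vt(1) unfolding compact_def by metis
  have elim: "e \<longlonglongrightarrow> 0" unfolding e_def by real_asymp
  have \<sigma>: "filterlim \<sigma> sequentially sequentially" using l(2) by (rule filterlim_subseq)
  have eq: "(\<lambda>j. e (\<sigma> j)) \<longlonglongrightarrow> 0" using filterlim_compose[OF elim \<sigma>] .
  let ?C = "(real K + 1) * coeff_const K"
  have "\<bar>G l \<zeta>\<bar> \<le> B * norm \<zeta> ^ Suc K" if z: "norm \<zeta> < R" "\<zeta> \<noteq> 0" for \<zeta>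
  proof (rule tendsto_le[OF sequentially_bot])
    show "(\<lambda>j. ?C * norm \<zeta> ^ K * (e (\<sigma> j) + B * (R * e (\<sigma> j))) + B * norm \<zeta> ^ Suc K) \<longlonglongrightarrow> B * norm \<zeta> ^ Suc K"
      using eq by (auto intro!: tendsto_eq_intros)
    have "(\<lambda>j. G ((v \<circ> \<sigma>) j) \<zeta>) \<longlonglongrightarrow> G l \<zeta>"
      by (rule continuous_on_tendsto_compose[OF cont[OF z(1)] l(3) l(1)]) (use vt(1) in auto)
    then show "(\<lambda>j. \<bar>G (v (\<sigma> j)) \<zeta>\<bar>) \<longlonglongrightarrow> \<bar>G l \<zeta>\<bar>" by (auto intro!: tendsto_intros)
    have "(\<lambda>j. R * e (\<sigma> j)) \<longlonglongrightarrow> 0" using eq by (auto intro!: tendsto_eq_intros)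
    then have "\<forall>\<^sub>F j in sequentially. R * e (\<sigma> j) < norm \<zeta>" using z(2) by (intro order_tendstoD(2)) auto
    then show "\<forall>\<^sub>F j in sequentially. \<bar>G (v (\<sigma> j)) \<zeta>\<bar> \<le> ?C * norm \<zeta> ^ K * (e (\<sigma> j) + B * (R * e (\<sigma> j))) + B * norm \<zeta> ^ Suc K"
    proof eventually_elim
      case (elim j)
      let ?i = "\<sigma> j"
      have ti: "0 < t ?i" "t ?i \<le> norm \<zeta>" using vt(2,3)[of ?i] elim by auto
      have "\<bar>G (v ?i) \<zeta>\<bar> \<le> sup_abs (G (v ?i)) (norm \<zeta>)"
        by (rule abs_le_sup_abs[OF derivs_le_continuous_on[OF G[OF vt(1)] z(1)]]) simp
      also have "\<dots> \<le> ?C * (norm \<zeta> / t ?i) ^ K * (sup_abs (G (v ?i)) (t ?i) + B * t ?i ^ Suc K) + B * norm \<zeta> ^ Suc K"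
        by (rule sup_abs_growth_aux[OF G[OF vt(1)] ti z(1)])
      also have "\<dots> \<le> ?C * (norm \<zeta> / t ?i) ^ K * ((e ?i + B * (R * e ?i)) * t ?i ^ K) + B * norm \<zeta> ^ Suc K"
      proof (intro add_right_mono mult_left_mono)
        have "B * t ?i ^ Suc K \<le> B * (R * e ?i) * t ?i ^ K"
          using mult_right_mono[OF mult_left_mono[OF vt(3)[of ?i] B], of "t ?i ^ K"] vt(2)[of ?i] by (simp add: mult_ac)
        then show "sup_abs (G (v ?i)) (t ?i) + B * t ?i ^ Suc K \<le> (e ?i + B * (R * e ?i)) * t ?i ^ K"
          using vt(4)[of ?i] by (simp add: algebra_simps)
      qed (use ti coeff_const_ge_1[of K] in auto)
      also have "\<dots> = ?C * norm \<zeta> ^ K * (e ?i + B * (R * e ?i)) + B * norm \<zeta> ^ Suc K"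
        using ti(1) by (simp add: power_divide)
      finally show ?case .
    qed
  qed
  moreover have "\<bar>G l 0\<bar> \<le> B * norm (0::complex) ^ Suc K"
  proof -
    have "(\<lambda>j. G ((v \<circ> \<sigma>) j) 0) \<longlonglongrightarrow> G l 0"
      by (rule continuous_on_tendsto_compose[OF cont l(3) l(1)]) (use vt(1) R in auto)
    then have 1: "(\<lambda>j. \<bar>G (v (\<sigma> j)) 0\<bar>) \<longlonglongrightarrow> \<bar>G l 0\<bar>" by (auto intro!: tendsto_intros)
    have 2: "(\<lambda>j. e (\<sigma> j) * R ^ K) \<longlonglongrightarrow> 0" using eq by (auto intro!: tendsto_eq_intros)
    have 3: "\<bar>G (v (\<sigma> j)) 0\<bar> \<le> e (\<sigma> j) * R ^ K" for j
    proof -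
      have tR: "t (\<sigma> j) < R" using vt(3)[of "\<sigma> j"] e[of "\<sigma> j"] R mult_strict_left_mono[of "e (\<sigma> j)" 1 R] by linarith
      have "\<bar>G (v (\<sigma> j)) 0\<bar> \<le> sup_abs (G (v (\<sigma> j))) (t (\<sigma> j))"
        by (rule abs_le_sup_abs[OF derivs_le_continuous_on[OF G[OF vt(1)] tR]]) (use vt(2)[of "\<sigma> j"] in simp)
      also have "\<dots> \<le> e (\<sigma> j) * t (\<sigma> j) ^ K" using vt(4)[of "\<sigma> j"] by simp
      also have "\<dots> \<le> e (\<sigma> j) * R ^ K" using e(1)[of "\<sigma> j"] vt(2)[of "\<sigma> j"] tR
        by (intro mult_left_mono power_mono) auto
      finally show ?thesis .
    qed
    have "\<bar>G l 0\<bar> \<le> 0" by (rule LIMSEQ_le[OF 1 2]) (use 3 in auto)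
    then show ?thesis by simp
  qed
  ultimately have "\<And>\<zeta>. norm \<zeta> < R \<Longrightarrow> \<bar>G l \<zeta>\<bar> \<le> B * norm \<zeta> ^ Suc K" by metis
  then show False using nv[OF l(1), of B] by blast
qed

section \<open>A maximum principle on holomorphic discs\<close>

lemma holomorphic_circle_mean:
  assumes f: "f holomorphic_on cball 0 r" and r: "0 < r"
  shows "((\<lambda>t. f (of_real r * cis t)) has_integral 2 * of_real pi * f 0) {0..2 * pi}"
proof -
  have "((\<lambda>u. f u / (u - 0)) has_contour_integral (2 * of_real pi * \<i> * f 0)) (circlepath 0 r)"
    by (rule Cauchy_integral_circlepath_simple[OF f]) (use r in simp)
  then have "((\<lambda>t. f (0 + r * cis t) / (0 + r * cis t - 0) * r * \<i> * cis t) has_integral 2 * of_real pi * \<i> * f 0) {0..2 * pi}"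
    unfolding circlepath_def by (subst (asm) has_contour_integral_part_circlepath_iff) auto
  moreover have "(\<lambda>t. f (0 + r * cis t) / (0 + r * cis t - 0) * r * \<i> * cis t) = (\<lambda>t. \<i> * f (of_real r * cis t))"
    using r by (auto simp: field_simps)
  ultimately have "((\<lambda>t. \<i> * f (of_real r * cis t)) has_integral 2 * of_real pi * \<i> * f 0) {0..2 * pi}" by simp
  from has_integral_mult_right[OF this, of "-\<i>"]
  have "((\<lambda>t. - \<i> * (\<i> * f (of_real r * cis t))) has_integral - \<i> * (2 * of_real pi * \<i> * f 0)) {0..2 * pi}" .
  moreover have eq: "- \<i> * (2 * of_real pi * \<i> * f 0) = 2 * of_real pi * f 0" by (simp add: algebra_simps)
  ultimately show ?thesis unfolding eq by simp
qed

lemma holomorphic_second_order: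
  assumes f: "f holomorphic_on ball 0 R" and z: "norm z < R"
  obtains C \<tau> where "0 \<le> C" "0 < \<tau>" "\<And>h. norm h \<le> \<tau> \<Longrightarrow> cmod (f (z + h) - f z - h * deriv f z) \<le> C * norm h ^ 2"
proof -
  define \<tau> where "\<tau> = (R - norm z) / 2"
  have \<tau>: "0 < \<tau>" using z by (simp add: \<tau>_def)
  have sub: "cball z \<tau> \<subseteq> ball 0 R"
  proof
    fix w assume "w \<in> cball z \<tau>"
    then have "norm (w - z) \<le> \<tau>" by (simp add: dist_norm norm_minus_commute)
    then show "w \<in> ball 0 R" using norm_triangle_sub[of w z] z by (simp add: \<tau>_def)
  qed
  have d1: "deriv f holomorphic_on ball 0 R" by (rule holomorphic_deriv[OF f]) simp
  have d2: "deriv (deriv f) holomorphic_on ball 0 R" by (rule holomorphic_deriv[OF d1]) simp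
  have "continuous_on (cball z \<tau>) (deriv (deriv f))"
    using d2 sub holomorphic_on_imp_continuous_on continuous_on_subset by blast
  then have "bounded (deriv (deriv f) ` cball z \<tau>)"
    using compact_continuous_image compact_cball compact_imp_bounded by blast
  then obtain B where B: "\<And>w. w \<in> cball z \<tau> \<Longrightarrow> norm (deriv (deriv f) w) \<le> B" unfolding bounded_iff by blast
  have B0: "0 \<le> B" using B[of z] \<tau> by (auto intro: order_trans[OF norm_ge_zero])
  have "cmod (f (z + h) - f z - h * deriv f z) \<le> B * norm h ^ 2" if h: "norm h \<le> \<tau>" for h
  proof -
    let ?f = "\<lambda>i. (deriv ^^ i) f"
    have "cmod (?f 0 (z + h) - (\<Sum>i\<le>1. ?f i z * (z + h - z) ^ i / fact i)) \<le> B * cmod (z + h - z) ^ Suc 1 / fact 1"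
    proof (rule complex_Taylor[of "cball z \<tau>"])
      fix i :: nat and x assume x: "x \<in> cball z \<tau>" and i: "i \<le> 1"
      have "x \<in> ball 0 R" using x sub by blast
      moreover have "i = 0 \<or> i = 1" using i by auto
      ultimately have "(?f i has_field_derivative ?f (Suc i) x) (at x)"
        using holomorphic_derivI[OF f open_ball] holomorphic_derivI[OF d1 open_ball] by auto
      then show "(?f i has_field_derivative ?f (Suc i) x) (at x within cball z \<tau>)"
        by (rule has_field_derivative_at_within)
    qed (use B h \<tau> in \<open>auto simp: dist_norm\<close>)
    then show ?thesis by (simp add: power2_eq_square algebra_simps)
  qed
  then show ?thesis using that[OF B0 \<tau>] by blast
qed

lemma norm_vec_le_sum: "norm (x :: complex^'n) \<le> (\<Sum>i\<in>UNIV. norm (x $ i))"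
  unfolding norm_vec_def by (rule L2_set_le_sum) simp

text \<open>
  A curve differs from its tangent line by a term of second order. This is what makes affine discs
  usable as test discs for the behaviour on a curved one.
\<close>
lemma curve_second_order:
  fixes F :: "complex \<Rightarrow> complex^'n"
  assumes F: "\<And>i. (\<lambda>\<zeta>. F \<zeta> $ i) holomorphic_on ball 0 R" and z: "norm z < R"
  obtains C \<tau> where "0 \<le> C" "0 < \<tau>"
    "\<And>h. norm h \<le> \<tau> \<Longrightarrow> norm (F z + h *s (\<chi> i. deriv (\<lambda>\<zeta>. F \<zeta> $ i) z) - F (z + h)) \<le> C * norm h ^ 2"
proof -
  have "\<forall>i. \<exists>C \<tau>. 0 \<le> C \<and> 0 < \<tau> \<and> (\<forall>h. norm h \<le> \<tau> \<longrightarrow>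
      cmod (F (z + h) $ i - F z $ i - h * deriv (\<lambda>\<zeta>. F \<zeta> $ i) z) \<le> C * norm h ^ 2)"
    by (metis holomorphic_second_order[OF F z])
  then obtain C \<tau> where C: "\<And>i. 0 \<le> C i" and \<tau>: "\<And>i. 0 < \<tau> i"
    and e: "\<And>i h. norm h \<le> \<tau> i \<Longrightarrow> cmod (F (z + h) $ i - F z $ i - h * deriv (\<lambda>\<zeta>. F \<zeta> $ i) z) \<le> C i * norm h ^ 2"
    by metis
  show ?thesis
  proof (rule that[of "\<Sum>i\<in>UNIV. C i" "Min (range \<tau>)"])
    show "0 \<le> sum C UNIV" by (intro sum_nonneg C)
    show "0 < Min (range \<tau>)" using \<tau> by auto
    fix h :: complex assume h: "norm h \<le> Min (range \<tau>)"
    have "norm (F z + h *s (\<chi> i. deriv (\<lambda>\<zeta>. F \<zeta> $ i) z) - F (z + h)) \<le>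
      (\<Sum>i\<in>UNIV. norm ((F z + h *s (\<chi> i. deriv (\<lambda>\<zeta>. F \<zeta> $ i) z) - F (z + h)) $ i))" by (rule norm_vec_le_sum)
    also have "\<dots> \<le> (\<Sum>i\<in>UNIV. C i * norm h ^ 2)"
    proof (rule sum_mono)
      fix i
      have "norm h \<le> \<tau> i" using h Min_le[of "range \<tau>" "\<tau> i"] by auto
      from e[OF this] show "norm ((F z + h *s (\<chi> i. deriv (\<lambda>\<zeta>. F \<zeta> $ i) z) - F (z + h)) $ i) \<le> C i * norm h ^ 2"
        by (simp add: norm_minus_commute algebra_simps)
    qed
    finally show "norm (F z + h *s (\<chi> i. deriv (\<lambda>\<zeta>. F \<zeta> $ i) z) - F (z + h)) \<le> sum C UNIV * norm h ^ 2"
      by (simp add: sum_distrib_right)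
  qed
qed

lemma continuous_on_curve:
  fixes F :: "complex \<Rightarrow> complex^'n"
  assumes "\<And>i. (\<lambda>\<zeta>. F \<zeta> $ i) holomorphic_on S"
  shows "continuous_on S F"
proof -
  have "continuous_on S (\<lambda>\<zeta>. \<chi> i. F \<zeta> $ i)"
    by (intro continuous_on_vec_lambda holomorphic_on_imp_continuous_on assms)
  then show ?thesis by simp
qed

lemma inner_vec_Re: "inner (x :: complex^'n) y = Re (\<Sum>i\<in>UNIV. cnj (x $ i) * y $ i)"
  by (simp add: inner_vec_def inner_complex_def)

text \<open>
  Plurisubharmonicity is given by mean values over affine discs only, but the principle is needed
  on curved discs. Variables are doubled: maximise
  \<open>u z - Re (H \<zeta>) + \<epsilon> * \<bar>\<zeta>\<bar>\<^sup>2 - M * \<bar>z - F \<zeta>\<bar>\<^sup>2\<close> over pairs of a point \<open>\<zeta>\<close> of the disc and a point \<open>z\<close> near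
  \<open>F \<zeta>\<close>. At a maximum point let \<open>\<zeta>\<close> move to \<open>\<zeta> + h\<close> and \<open>z\<close> along the tangent of \<open>F\<close> to \<open>z + h *s F' \<zeta>\<close>.
  The difference \<open>z - F \<zeta>\<close> then changes by a holomorphic term of size \<open>O(\<bar>h\<bar>\<^sup>2)\<close>, so in the mean over
  a small circle the penalty changes by \<open>O(\<bar>h\<bar>\<^sup>4)\<close> only, whereas the mean of \<open>\<epsilon> * \<bar>\<zeta> + h\<bar>\<^sup>2\<close> grows by
  \<open>\<epsilon> * \<bar>h\<bar>\<^sup>2\<close>. This contradicts the affine mean value inequality for \<open>u\<close>.
\<close>
lemma psh_disc_maximum_principle:
  fixes u :: "complex^'n \<Rightarrow> real" and F :: "complex \<Rightarrow> complex^'n"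
  assumes psh: "continuous_plurisubharmonic_on u \<Omega>" and \<Omega>: "open \<Omega>"
    and F: "\<And>i. (\<lambda>\<zeta>. F \<zeta> $ i) holomorphic_on ball 0 R" and R: "1 < R"
    and F\<Omega>: "\<And>\<zeta>. norm \<zeta> \<le> 1 \<Longrightarrow> F \<zeta> \<in> \<Omega>"
    and H: "H holomorphic_on ball 0 R"
    and bd: "\<And>\<zeta>. norm \<zeta> = 1 \<Longrightarrow> u (F \<zeta>) \<le> Re (H \<zeta>)"
  shows "u (F 0) \<le> Re (H 0)"
proof (rule ccontr)
  assume "\<not> u (F 0) \<le> Re (H 0)"
  define m where "m = u (F 0) - Re (H 0)"
  have m: "0 < m" using \<open>\<not> u (F 0) \<le> Re (H 0)\<close> by (simp add: m_def)
  have u: "continuous_on \<Omega> u" using psh by (simp add: continuous_plurisubharmonic_on_def)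
  have sub: "cball 0 1 \<subseteq> (ball 0 R :: complex set)" using R by (simp add: cball_subset_ball_iff)
  have Fc: "continuous_on (cball 0 1) F"
    using continuous_on_subset[OF continuous_on_curve[OF F] sub] .
  have Hc: "continuous_on (cball 0 1) H"
    using continuous_on_subset[OF holomorphic_on_imp_continuous_on[OF H] sub] .
  have "compact (F ` cball 0 1)" using Fc by (intro compact_continuous_image) auto
  moreover have "F ` cball 0 1 \<subseteq> \<Omega>" using F\<Omega> by auto
  ultimately obtain \<eta>1 where \<eta>1: "0 < \<eta>1" "(\<Union>x\<in>F ` cball 0 1. cball x \<eta>1) \<subseteq> \<Omega>"
    using compact_subset_open_imp_cball_epsilon_subset[OF _ \<Omega>] by metis
  have in\<Omega>: "F \<zeta> + D \<in> \<Omega>" if "norm D \<le> \<eta>1" "norm \<zeta> \<le> 1" for D \<zeta>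
  proof -
    have "F \<zeta> + D \<in> cball (F \<zeta>) \<eta>1" using that by (simp add: dist_norm)
    moreover have "\<zeta> \<in> cball 0 1" using that by simp
    ultimately show ?thesis using \<eta>1(2) by blast
  qed
  \<comment> \<open>the pair \<open>(z, \<zeta>)\<close> is parametrised by \<open>D = z - F \<zeta>\<close> and \<open>\<zeta>\<close>\<close>
  define w where "w = (\<lambda>(D, \<zeta>). u (F \<zeta> + D))"
  have Fc2: "continuous_on (cball 0 \<eta>1 \<times> cball 0 1) (\<lambda>p. F (snd p))"
    by (rule continuous_on_compose2[OF Fc continuous_on_snd[OF continuous_on_id]]) auto
  have wc: "continuous_on (cball 0 \<eta>1 \<times> cball 0 1) w"
  proof -
    have "continuous_on (cball 0 \<eta>1 \<times> cball 0 1) (\<lambda>p. u (F (snd p) + fst p))"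
      by (rule continuous_on_compose2[OF u]) (use in\<Omega> in \<open>auto intro!: continuous_intros Fc2\<close>)
    then show ?thesis by (simp add: w_def case_prod_unfold)
  qed
  then have "uniformly_continuous_on (cball 0 \<eta>1 \<times> cball 0 1) w"
    by (intro compact_uniformly_continuous compact_Times) auto
  then obtain d where d: "0 < d"
    "\<And>p q. p \<in> cball 0 \<eta>1 \<times> cball 0 1 \<Longrightarrow> q \<in> cball 0 \<eta>1 \<times> cball 0 1 \<Longrightarrow> dist q p < d \<Longrightarrow> dist (w q) (w p) < m/4"
    using m unfolding uniformly_continuous_on_def by (elim allE[of _ "m/4"]) auto
  define \<eta> where "\<eta> = min \<eta>1 (d/2)"
  have \<eta>: "0 < \<eta>" "\<eta> \<le> \<eta>1" "\<eta> < d" using \<eta>1(1) d(1) by (auto simp: \<eta>_def)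
  have near: "u (F \<zeta> + D) \<le> u (F \<zeta>) + m/4" if "norm D \<le> \<eta>" "norm \<zeta> \<le> 1" for D \<zeta>
  proof -
    have "dist (w (D, \<zeta>)) (w (0, \<zeta>)) < m/4"
      by (rule d(2)) (use that \<eta> \<eta>1 in \<open>auto simp: dist_Pair_Pair\<close>)
    then have "\<bar>u (F \<zeta> + D) - u (F \<zeta>)\<bar> < m/4" by (simp add: w_def dist_real_def)
    then show ?thesis by linarith
  qed
  have "compact ((\<lambda>\<zeta>. u (F \<zeta>) - Re (H \<zeta>)) ` cball 0 1)"
    by (intro compact_continuous_image continuous_intros continuous_on_compose2[OF u Fc] Hc) (use F\<Omega> in auto)
  then obtain B where B: "\<And>\<zeta>. norm \<zeta> \<le> 1 \<Longrightarrow> \<bar>u (F \<zeta>) - Re (H \<zeta>)\<bar> \<le> B"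
  proof -
    assume *: "compact ((\<lambda>\<zeta>. u (F \<zeta>) - Re (H \<zeta>)) ` cball 0 1)"
      and **: "\<And>B. (\<And>\<zeta>. norm \<zeta> \<le> 1 \<Longrightarrow> \<bar>u (F \<zeta>) - Re (H \<zeta>)\<bar> \<le> B) \<Longrightarrow> thesis"
    from compact_imp_bounded[OF *] obtain B where "\<forall>x\<in>cball 0 1. norm (u (F x) - Re (H x)) \<le> B"
      unfolding bounded_iff by auto
    then show thesis by (intro **[of B]) auto
  qed
  \<comment> \<open>the penalty outweighs \<open>u\<close> on \<open>\<bar>D\<bar> = \<eta>\<close>, which keeps the maximum away from there\<close>
  define M where "M = (\<bar>B\<bar> + m) / \<eta>\<^sup>2"
  have M: "0 < M" "M * \<eta>\<^sup>2 = \<bar>B\<bar> + m" using \<eta>(1) m by (auto simp: M_def)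
  define \<epsilon> where "\<epsilon> = m/4"
  define \<Phi> where "\<Phi> = (\<lambda>(D, \<zeta>). u (F \<zeta> + D) - Re (H \<zeta>) + \<epsilon> * (norm \<zeta>)\<^sup>2 - M * (norm D)\<^sup>2)"
  have "continuous_on (cball 0 \<eta> \<times> cball 0 1) \<Phi>"
  proof -
    have "cball 0 \<eta> \<times> cball 0 1 \<subseteq> cball (0::complex^'n) \<eta>1 \<times> (cball 0 1 :: complex set)" using \<eta>(2) by auto
    from continuous_on_subset[OF wc this]
    have 1: "continuous_on (cball 0 \<eta> \<times> cball 0 1) (\<lambda>p. u (F (snd p) + fst p))" by (simp add: w_def case_prod_unfold)
    have 2: "continuous_on (cball 0 \<eta> \<times> cball 0 1) (\<lambda>p::(complex^'n) \<times> complex. H (snd p))"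
      by (rule continuous_on_compose2[OF Hc continuous_on_snd[OF continuous_on_id]]) auto
    have "continuous_on (cball 0 \<eta> \<times> cball 0 1)
      (\<lambda>p. u (F (snd p) + fst p) - Re (H (snd p)) + \<epsilon> * (norm (snd p))\<^sup>2 - M * (norm (fst p))\<^sup>2)"
      by (intro continuous_intros 1 2)
    then show ?thesis by (simp add: \<Phi>_def case_prod_unfold)
  qed
  then have "\<exists>x\<in>cball 0 \<eta> \<times> cball 0 1. \<forall>y\<in>cball 0 \<eta> \<times> cball 0 1. \<Phi> y \<le> \<Phi> x"
    by (intro continuous_attains_sup compact_Times) (use \<eta>(1) in auto)
  then obtain D z where Dz: "norm D \<le> \<eta>" "norm z \<le> 1"
    and max: "\<And>D' z'. norm D' \<le> \<eta> \<Longrightarrow> norm z' \<le> 1 \<Longrightarrow> \<Phi> (D', z') \<le> \<Phi> (D, z)"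
  proof -
    assume *: "\<exists>x\<in>cball 0 \<eta> \<times> cball 0 1. \<forall>y\<in>cball 0 \<eta> \<times> cball 0 1. \<Phi> y \<le> \<Phi> x"
      and **: "\<And>D z. norm D \<le> \<eta> \<Longrightarrow> norm z \<le> 1 \<Longrightarrow>
        (\<And>D' z'. norm D' \<le> \<eta> \<Longrightarrow> norm z' \<le> 1 \<Longrightarrow> \<Phi> (D', z') \<le> \<Phi> (D, z)) \<Longrightarrow> thesis"
    from * obtain D z where "norm D \<le> \<eta>" "norm z \<le> 1" "\<forall>y\<in>cball 0 \<eta> \<times> cball 0 1. \<Phi> y \<le> \<Phi> (D, z)" by auto
    then show thesis by (intro **[of D z]) auto
  qed
  have \<Phi>m: "m \<le> \<Phi> (D, z)" using max[of 0 0] \<eta>(1) by (simp add: \<Phi>_def m_def)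
  have \<epsilon>z: "\<epsilon> * (norm z)\<^sup>2 \<le> m/4"
    using Dz(2) m mult_left_mono[of "(norm z)\<^sup>2" 1 \<epsilon>] by (simp add: \<epsilon>_def power_le_one)
  have "norm D \<noteq> \<eta>"
  proof
    assume "norm D = \<eta>"
    then have "\<Phi> (D, z) \<le> B + m/4 + m/4 - (\<bar>B\<bar> + m)"
      using near[OF Dz] B[OF Dz(2)] \<epsilon>z M(2) unfolding \<Phi>_def by simp
    then show False using \<Phi>m m by linarith
  qed
  then have D: "norm D < \<eta>" using Dz(1) by simp
  \<comment> \<open>the bound for \<open>u \<circ> F\<close> on the circle, with room \<open>m/4\<close> for \<open>D\<close> and for the term \<open>\<epsilon> * \<bar>z\<bar>\<^sup>2\<close>\<close>
  have "norm z \<noteq> 1"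
  proof
    assume "norm z = 1"
    moreover have "0 \<le> M * (norm D)\<^sup>2" using M(1) by simp
    ultimately have "\<Phi> (D, z) \<le> m/4 + m/4"
      using near[OF Dz] bd[of z] \<epsilon>z unfolding \<Phi>_def case_prod_conv by linarith
    then show False using \<Phi>m m by linarith
  qed
  then have z: "norm z < 1" using Dz(2) by simp
  define b where "b = (\<chi> i. deriv (\<lambda>\<zeta>. F \<zeta> $ i) z)"
  obtain C \<tau>0 where C: "0 \<le> C" "0 < \<tau>0"
    "\<And>h. norm h \<le> \<tau>0 \<Longrightarrow> norm (F z + h *s b - F (z + h)) \<le> C * norm h ^ 2"
    using curve_second_order[OF F, of z] z R unfolding b_def by (metis less_trans)
  define e where "e = (\<lambda>h. F z + h *s b - F (z + h))"
  have "\<exists>\<tau>>0. \<tau> \<le> \<tau>0 \<and> norm z + \<tau> \<le> 1 \<and> norm D + C * \<tau>\<^sup>2 \<le> \<eta> \<and> M * (C\<^sup>2 * \<tau>\<^sup>2) < \<epsilon>"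
  proof -
    have "((\<lambda>\<tau>. norm D + C * \<tau>\<^sup>2) \<longlongrightarrow> norm D + C * 0\<^sup>2) (at_right 0)" by (intro tendsto_intros)
    then have 1: "\<forall>\<^sub>F \<tau> in at_right 0. norm D + C * \<tau>\<^sup>2 < \<eta>" by (rule order_tendstoD) (use D in simp)
    have "((\<lambda>\<tau>. M * (C\<^sup>2 * \<tau>\<^sup>2)) \<longlongrightarrow> M * (C\<^sup>2 * 0\<^sup>2)) (at_right 0)" by (intro tendsto_intros)
    then have 2: "\<forall>\<^sub>F \<tau> in at_right 0. M * (C\<^sup>2 * \<tau>\<^sup>2) < \<epsilon>" by (rule order_tendstoD) (use m in \<open>simp add: \<epsilon>_def\<close>)
    have 3: "\<forall>\<^sub>F \<tau> in at_right (0::real). 0 < \<tau> \<and> \<tau> < min \<tau>0 (1 - norm z)"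
      using C(2) z by (auto simp: eventually_at_right_field intro!: exI[of _ "min \<tau>0 (1 - norm z)"])
    have "\<forall>\<^sub>F \<tau> in at_right 0. 0 < \<tau> \<and> \<tau> \<le> \<tau>0 \<and> norm z + \<tau> \<le> 1 \<and> norm D + C * \<tau>\<^sup>2 \<le> \<eta> \<and> M * (C\<^sup>2 * \<tau>\<^sup>2) < \<epsilon>"
      using 1 2 3 by eventually_elim auto
    then show ?thesis using eventually_happens'[OF trivial_limit_at_right_real] by blast
  qed
  then obtain \<tau> where \<tau>: "0 < \<tau>" "\<tau> \<le> \<tau>0" "norm z + \<tau> \<le> 1" "norm D + C * \<tau>\<^sup>2 \<le> \<eta>" "M * (C\<^sup>2 * \<tau>\<^sup>2) < \<epsilon>"
    by blast
  have eb: "norm (e h) \<le> C * \<tau>\<^sup>2" if "norm h \<le> \<tau>" for h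
  proof -
    have "norm (e h) \<le> C * norm h ^ 2" using C(3)[of h] that \<tau>(2) by (simp add: e_def)
    also have "\<dots> \<le> C * \<tau>\<^sup>2" using C(1) that by (intro mult_left_mono power_mono) auto
    finally show ?thesis .
  qed
  have De: "norm (D + e h) \<le> \<eta>" if "norm h \<le> \<tau>" for h
    using norm_triangle_ineq[of D "e h"] eb[OF that] \<tau>(4) by linarith
  have zh: "norm (z + h) \<le> 1" if "norm h \<le> \<tau>" for h
    using norm_triangle_ineq[of z h] that \<tau>(3) by linarith
  have zb: "F z + D + h *s b = F (z + h) + (D + e h)" for h by (simp add: e_def)
  \<comment> \<open>the holomorphic part of the upper bound for \<open>u\<close> along the test disc; it takes care of all terms of first and second order except \<open>\<epsilon> * \<bar>h\<bar>\<^sup>2\<close>\<close>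
  define T where "T = (\<lambda>h. of_real (\<Phi> (D, z)) + H (z + h) - of_real \<epsilon> * (of_real ((norm z)\<^sup>2) + 2 * (cnj z * h))
      + of_real M * (of_real ((norm D)\<^sup>2) + 2 * (\<Sum>i\<in>UNIV. cnj (D $ i) * e h $ i)))"
  have e0: "e 0 = 0" by (simp add: e_def)
  have T0: "Re (T 0) = u (F z + D)" by (simp add: T_def e0 \<Phi>_def)
  have inR: "z + h \<in> ball 0 R" if "norm h \<le> \<tau>" for h using zh[OF that] R by simp
  have shift: "(\<lambda>h. f (z + h)) holomorphic_on cball 0 \<tau>" if "f holomorphic_on ball 0 R" for f
  proof -
    have "(f \<circ> (\<lambda>h. z + h)) holomorphic_on cball 0 \<tau>"
    proof (rule holomorphic_on_compose_gen[OF _ that])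
      show "(\<lambda>h. z + h) holomorphic_on cball 0 \<tau>" by (intro holomorphic_intros)
      show "(\<lambda>h. z + h) ` cball 0 \<tau> \<subseteq> ball 0 R" using inR by (intro image_subsetI) simp
    qed
    then show ?thesis by (simp add: o_def)
  qed
  have Thol: "T holomorphic_on cball 0 \<tau>"
  proof -
    have "(\<lambda>h. e h $ i) holomorphic_on cball 0 \<tau>" for i
      using shift[OF F[of i]] unfolding e_def by (auto intro!: holomorphic_intros)
    then show ?thesis unfolding T_def by (intro holomorphic_intros shift H)
  qed
  define \<kappa> where "\<kappa> = \<epsilon> * \<tau>\<^sup>2 - M * (C * \<tau>\<^sup>2)\<^sup>2"
  have \<kappa>: "0 < \<kappa>"
  proof -
    have "M * (C\<^sup>2 * \<tau>\<^sup>2) * \<tau>\<^sup>2 < \<epsilon> * \<tau>\<^sup>2" using \<tau>(1,5) by (intro mult_strict_right_mono) auto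
    then show ?thesis by (simp add: \<kappa>_def power2_eq_square mult_ac)
  qed
  have le: "u (F z + D + h *s b) \<le> Re (T h) - \<kappa>" if h: "norm h = \<tau>" for h
  proof -
    have "\<Phi> (D + e h, z + h) \<le> \<Phi> (D, z)" using max De zh h by simp
    then have "u (F z + D + h *s b) \<le> \<Phi> (D, z) + Re (H (z + h)) - \<epsilon> * (norm (z + h))\<^sup>2 + M * (norm (D + e h))\<^sup>2"
      unfolding zb by (simp add: \<Phi>_def)
    moreover have "(norm (z + h))\<^sup>2 = (norm z)\<^sup>2 + 2 * Re (cnj z * h) + \<tau>\<^sup>2"
      using h by (simp add: power2_norm_eq_inner inner_add inner_commute flip: h) (simp add: inner_complex_def)
    moreover have "(norm (D + e h))\<^sup>2 = (norm D)\<^sup>2 + 2 * Re (\<Sum>i\<in>UNIV. cnj (D $ i) * e h $ i) + (norm (e h))\<^sup>2"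
      by (simp only: inner_vec_Re[symmetric] power2_norm_eq_inner inner_add inner_commute[of "e h" D])
    moreover have "(norm (e h))\<^sup>2 \<le> (C * \<tau>\<^sup>2)\<^sup>2" using eb[of h] h by (intro power_mono) auto
    then have "M * (norm (e h))\<^sup>2 \<le> M * (C * \<tau>\<^sup>2)\<^sup>2" using M(1) by (intro mult_left_mono) auto
    ultimately show ?thesis by (simp add: T_def \<kappa>_def algebra_simps)
  qed
  have "u (F z + D) \<le> 1 / (2 * pi) * integral {0..2 * pi} (\<lambda>\<theta>. u (F z + D + cis \<theta> *s (of_real \<tau> *s b)))"
  proof -
    have "F z + D + \<zeta> *s (of_real \<tau> *s b) \<in> \<Omega>" if "cmod \<zeta> \<le> 1" for \<zeta>
    proof -
      have h: "norm (\<zeta> * of_real \<tau>) \<le> \<tau>" using that \<tau>(1) mult_right_mono[of "norm \<zeta>" 1 \<tau>] by (simp add: norm_mult)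
      have "F (z + \<zeta> * of_real \<tau>) + (D + e (\<zeta> * of_real \<tau>)) \<in> \<Omega>"
        by (rule in\<Omega>) (use De[OF h] zh[OF h] \<eta>(2) in auto)
      then have "F z + D + (\<zeta> * of_real \<tau>) *s b \<in> \<Omega>" unfolding zb .
      then show ?thesis by (simp add: vector_smult_assoc)
    qed
    then show ?thesis using psh unfolding continuous_plurisubharmonic_on_def by blast
  qed
  also have "\<dots> \<le> 1 / (2 * pi) * (2 * pi * (u (F z + D) - \<kappa>))"
  proof (rule mult_left_mono)
    show "integral {0..2 * pi} (\<lambda>\<theta>. u (F z + D + cis \<theta> *s (of_real \<tau> *s b))) \<le> 2 * pi * (u (F z + D) - \<kappa>)"
    proof -
      have "((\<lambda>t. T (of_real \<tau> * cis t)) has_integral 2 * of_real pi * T 0) {0..2 * pi}"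
        by (rule holomorphic_circle_mean[OF Thol \<tau>(1)])
      then have "((\<lambda>t. Re (T (of_real \<tau> * cis t))) has_integral Re (2 * of_real pi * T 0)) {0..2 * pi}"
        using has_integral_linear[OF _ bounded_linear_Re] unfolding o_def by blast
      then have 1: "((\<lambda>t. Re (T (of_real \<tau> * cis t)) - \<kappa>) has_integral 2 * pi * u (F z + D) - 2 * pi * \<kappa>) {0..2 * pi}"
        using has_integral_diff[OF _ has_integral_const_real[of \<kappa> 0 "2 * pi"]] T0 by simp
      have h: "norm (of_real \<tau> * cis t) = \<tau>" for t using \<tau>(1) by (simp add: norm_mult)
      have eqh: "cis t *s (of_real \<tau> *s b) = (of_real \<tau> * cis t) *s b" for t by (simp add: vector_smult_assoc mult.commute)
      have "continuous_on {0..2 * pi} (\<lambda>t. u (F z + D + (of_real \<tau> * cis t) *s b))"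
      proof (rule continuous_on_compose2[OF u])
        show "continuous_on {0..2 * pi} (\<lambda>t. F z + D + (of_real \<tau> * cis t) *s b)"
          unfolding vector_scalar_mult_def by (intro continuous_intros continuous_on_vec_lambda)
        show "(\<lambda>t. F z + D + (of_real \<tau> * cis t) *s b) ` {0..2 * pi} \<subseteq> \<Omega>"
        proof (intro image_subsetI)
          fix t
          show "F z + D + (of_real \<tau> * cis t) *s b \<in> \<Omega>"
            unfolding zb by (rule in\<Omega>) (use De[of "of_real \<tau> * cis t"] zh[of "of_real \<tau> * cis t"] h \<eta>(2) in auto)
        qed
      qed
      then have "(\<lambda>t. u (F z + D + cis t *s (of_real \<tau> *s b))) integrable_on {0..2 * pi}"
        unfolding eqh by (rule integrable_continuous_interval)
      then have "integral {0..2 * pi} (\<lambda>\<theta>. u (F z + D + cis \<theta> *s (of_real \<tau> *s b))) \<le> 2 * pi * u (F z + D) - 2 * pi * \<kappa>"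
        by (rule has_integral_le[OF integrable_integral 1]) (unfold eqh, rule le[OF h])
      then show ?thesis by (simp add: algebra_simps)
    qed
  qed simp
  finally show False using \<kappa> by simp
qed

section \<open>Defining functions and the distance to the boundary\<close>

lemma has_derivative_gradient:
  fixes f :: "'a::euclidean_space \<Rightarrow> real"
  assumes "f differentiable (at x)"
  shows "(f has_derivative (\<lambda>h. h \<bullet> gradient f x)) (at x)"
proof -
  let ?D = "frechet_derivative f (at x)"
  define a where "a = (\<Sum>b\<in>Basis. ?D b *\<^sub>R b)"
  have D: "(f has_derivative ?D) (at x)" using assms by (simp add: frechet_derivative_works)
  then have lin: "linear ?D" by (rule has_derivative_linear)
  have "?D h = h \<bullet> a" for h
  proof -
    have "?D h = ?D (\<Sum>b\<in>Basis. (h \<bullet> b) *\<^sub>R b)" by (simp add: euclidean_representation)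
    also have "\<dots> = (\<Sum>b\<in>Basis. (h \<bullet> b) * ?D b)" by (simp add: linear_sum[OF lin] linear_scale[OF lin])
    also have "\<dots> = h \<bullet> a" by (simp add: a_def inner_sum_right mult.commute)
    finally show ?thesis .
  qed
  then have eq: "?D = (\<lambda>h. h \<bullet> a)" by auto
  have "GDERIV f x :> a" using D eq by (simp add: gderiv_def)
  moreover have "a' = a" if "GDERIV f x :> a'" for a'
  proof -
    have "(\<lambda>h. h \<bullet> a') = (\<lambda>h. h \<bullet> a)" using that D eq has_derivative_unique by (metis gderiv_def)
    then have "(a' - a) \<bullet> (a' - a) = 0" by (metis inner_diff_right right_minus_eq)
    then show ?thesis by simp
  qed
  ultimately have "gradient f x = a" unfolding gradient_def by (rule the_equality)
  then show ?thesis using D eq by simp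
qed

lemma continuous_on_gradient:
  fixes r :: "'a::euclidean_space \<Rightarrow> real"
  assumes "smooth_on U r"
  shows "continuous_on U (gradient r)"
proof -
  have "continuous_on U (\<lambda>z. \<Sum>b\<in>Basis. frechet_derivative r (at z) b *\<^sub>R b)"
    using smooth_on_differentiable[OF smooth_on_frechet_derivative[OF assms]]
    by (intro continuous_intros continuous_at_imp_continuous_on ballI differentiable_imp_continuous_within)
  moreover have "(\<Sum>b\<in>Basis. frechet_derivative r (at z) b *\<^sub>R b) = gradient r z" if "z \<in> U" for z
  proof -
    have "frechet_derivative r (at z) = (\<lambda>h. h \<bullet> gradient r z)"
      by (rule frechet_derivative_at[OF has_derivative_gradient[OF smooth_on_differentiable[OF assms that]], symmetric])
    then show ?thesis by (simp add: inner_commute[of _ "gradient r z"] euclidean_representation)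
  qed
  ultimately show ?thesis by (simp cong: continuous_on_cong)
qed

text \<open>
  Strict differentiability is the only form in which the first-order behaviour of the defining
  function enters the geometric arguments.
\<close>
lemma strictly_differentiable:
  fixes r :: "'a::euclidean_space \<Rightarrow> real"
  assumes "smooth_on U r" "open U" "Q \<in> U" "0 < \<epsilon>"
  obtains \<eta> where "0 < \<eta>" "ball Q \<eta> \<subseteq> U"
    "\<And>x y. x \<in> ball Q \<eta> \<Longrightarrow> y \<in> ball Q \<eta> \<Longrightarrow> \<bar>r x - r y - (x - y) \<bullet> gradient r Q\<bar> \<le> \<epsilon> * norm (x - y)"
proof -
  let ?d = "\<lambda>b z. frechet_derivative r (at z) b"
  have rd: "r differentiable (at z)" if "z \<in> U" for z using smooth_on_differentiable[OF assms(1) that] .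
  have cont: "isCont (?d b) Q" for b
    using smooth_on_differentiable[OF smooth_on_frechet_derivative[OF assms(1)] assms(3)]
    by (rule differentiable_imp_continuous_within)
  define \<delta> where "\<delta> = \<epsilon> / real DIM('a)"
  have \<delta>: "0 < \<delta>" using assms(4) by (simp add: \<delta>_def)
  have "\<forall>b\<in>Basis. \<forall>\<^sub>F z in nhds Q. \<bar>?d b z - ?d b Q\<bar> < \<delta>"
  proof
    fix b :: 'a
    have "((\<lambda>z. ?d b z) \<longlongrightarrow> ?d b Q) (nhds Q)" 
      using cont[of b] unfolding isCont_def by (rule tendsto_at_iff_tendsto_nhds[THEN iffD1, of "?d b"])
    then have "\<forall>\<^sub>F z in nhds Q. dist (?d b z) (?d b Q) < \<delta>" using \<delta> by (rule tendstoD)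
    then show "\<forall>\<^sub>F z in nhds Q. \<bar>?d b z - ?d b Q\<bar> < \<delta>" by (simp add: dist_real_def)
  qed
  then have "\<forall>\<^sub>F z in nhds Q. \<forall>b\<in>Basis. \<bar>?d b z - ?d b Q\<bar> < \<delta>" by (simp add: eventually_ball_finite)
  moreover have "\<forall>\<^sub>F z in nhds Q. z \<in> U" using assms(2,3) by (rule eventually_nhds_in_open)
  ultimately have "\<forall>\<^sub>F z in nhds Q. z \<in> U \<and> (\<forall>b\<in>Basis. \<bar>?d b z - ?d b Q\<bar> < \<delta>)" by (rule eventually_conj[rotated])
  then obtain \<eta> where \<eta>: "0 < \<eta>" "\<And>z. dist z Q < \<eta> \<Longrightarrow> z \<in> U \<and> (\<forall>b\<in>Basis. \<bar>?d b z - ?d b Q\<bar> < \<delta>)"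
    unfolding eventually_nhds_metric by blast
  have fg: "frechet_derivative r (at Q) h = h \<bullet> gradient r Q" for h
    using frechet_derivative_at[OF has_derivative_gradient[OF rd[OF assms(3)]]] by metis
  show ?thesis
  proof (rule that[OF \<eta>(1)])
    show "ball Q \<eta> \<subseteq> U" using \<eta>(2) by (auto simp: dist_commute)
    fix x y assume x: "x \<in> ball Q \<eta>" and y: "y \<in> ball Q \<eta>"
    let ?k = "\<lambda>x. r x - x \<bullet> gradient r Q"
    have "norm (?k x - ?k y) \<le> \<epsilon> * norm (x - y)"
    proof (rule differentiable_bound[OF convex_ball _ _ x y])
      fix z assume "z \<in> ball Q \<eta>"
      then have z: "dist z Q < \<eta>" by (simp add: dist_commute)
      let ?D = "frechet_derivative r (at z)"
      have "z \<in> U" using \<eta>(2)[OF z] by blast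
      then have D: "(r has_derivative ?D) (at z)" by (rule frechet_derivative_works[THEN iffD1, OF rd])
      then show "(?k has_derivative (\<lambda>h. ?D h - h \<bullet> gradient r Q)) (at z within ball Q \<eta>)"
        by (intro has_derivative_at_withinI[OF has_derivative_diff] has_derivative_inner_left has_derivative_ident)
      show "onorm (\<lambda>h. ?D h - h \<bullet> gradient r Q) \<le> \<epsilon>"
      proof (rule onorm_le)
        fix h :: 'a
        have lin: "linear ?D" "linear (frechet_derivative r (at Q))"
          using rd[OF assms(3)] has_derivative_linear[OF D] by (simp_all add: linear_frechet_derivative)
        have e: "L h = (\<Sum>b\<in>Basis. (h \<bullet> b) * L b)" if "linear L" for L :: "'a \<Rightarrow> real"
        proof -
          have "L h = L (\<Sum>b\<in>Basis. (h \<bullet> b) *\<^sub>R b)" by (simp add: euclidean_representation)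
          then show ?thesis by (simp add: linear_sum[OF that] linear_scale[OF that])
        qed
        have "?D h - h \<bullet> gradient r Q = (\<Sum>b\<in>Basis. (h \<bullet> b) * (?D b - ?d b Q))"
          unfolding fg[symmetric] e[OF lin(1)] e[OF lin(2)] by (simp add: sum_subtractf right_diff_distrib)
        also have "norm \<dots> \<le> (\<Sum>b\<in>(Basis::'a set). norm h * \<delta>)"
        proof (rule sum_norm_le)
          fix b :: 'a assume b: "b \<in> Basis"
          have "\<bar>h \<bullet> b\<bar> * \<bar>?D b - ?d b Q\<bar> \<le> norm h * \<delta>"
            using \<eta>(2)[OF z] b Basis_le_norm[OF b, of h] by (intro mult_mono) (auto simp: less_imp_le)
          then show "norm ((h \<bullet> b) * (?D b - ?d b Q)) \<le> norm h * \<delta>" by (simp add: abs_mult)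
        qed
        also have "\<dots> = \<epsilon> * norm h" by (simp add: \<delta>_def)
        finally show "norm (?D h - h \<bullet> gradient r Q) \<le> \<epsilon> * norm h" .
      qed
    qed
    then show "\<bar>r x - r y - (x - y) \<bullet> gradient r Q\<bar> \<le> \<epsilon> * norm (x - y)"
      by (simp add: inner_diff_left algebra_simps)
  qed
qed

text \<open>
  In the applications \<open>a\<close> is the gradient of the defining function \<open>r\<close> at a boundary point, and the
  error is measured relative to its length.
\<close>
definition nearly_linear_on :: "'a::real_inner set \<Rightarrow> ('a \<Rightarrow> real) \<Rightarrow> 'a \<Rightarrow> real \<Rightarrow> bool" where
  "nearly_linear_on B r a e \<longleftrightarrow>
     (\<forall>x\<in>B. \<forall>y\<in>B. \<bar>r x - r y - (x - y) \<bullet> a\<bar> \<le> e * norm a * norm (x - y))"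

lemma nearly_linear_onD:
  assumes "nearly_linear_on B r a e" "x \<in> B" "y \<in> B"
  shows "r x - r y \<le> (x - y) \<bullet> a + e * norm a * norm (x - y)"
    "(x - y) \<bullet> a - e * norm a * norm (x - y) \<le> r x - r y"
    "r x - r y \<le> (1 + e) * norm a * norm (x - y)"
proof -
  have *: "\<bar>r x - r y - (x - y) \<bullet> a\<bar> \<le> e * norm a * norm (x - y)"
    using assms unfolding nearly_linear_on_def by blast
  then show 1: "r x - r y \<le> (x - y) \<bullet> a + e * norm a * norm (x - y)"
    and "(x - y) \<bullet> a - e * norm a * norm (x - y) \<le> r x - r y" by linarith+
  show "r x - r y \<le> (1 + e) * norm a * norm (x - y)"
    using 1 norm_cauchy_schwarz[of "x - y" a] by (simp add: algebra_simps)
qed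

lemma nearly_linear_on_shift:
  assumes "nearly_linear_on B r a e" "x \<in> B" "x - s *\<^sub>R sgn a \<in> B" "0 \<le> s" "a \<noteq> 0"
  shows "r (x - s *\<^sub>R sgn a) \<le> r x - s * norm a * (1 - e)"
    "r x - s * norm a * (1 + e) \<le> r (x - s *\<^sub>R sgn a)"
proof -
  have i: "sgn a \<bullet> a = norm a" using assms(5) by (simp add: sgn_div_norm power2_norm_eq_inner[symmetric] power2_eq_square)
  have n: "norm (x - s *\<^sub>R sgn a - x) = s" "(x - s *\<^sub>R sgn a - x) \<bullet> a = - (s * norm a)"
    using assms i by (simp_all add: norm_sgn)
  show "r (x - s *\<^sub>R sgn a) \<le> r x - s * norm a * (1 - e)"
    using nearly_linear_onD(1)[OF assms(1,3,2)] unfolding n by (simp add: algebra_simps)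
  show "r x - s * norm a * (1 + e) \<le> r (x - s *\<^sub>R sgn a)"
    using nearly_linear_onD(2)[OF assms(1,3,2)] unfolding n by (simp add: algebra_simps)
qed

text \<open>
  Near \<open>Q\<close> the distance to the boundary is \<open>- r / norm a\<close> up to factors \<open>1 + e\<close> and \<open>1 - e\<close>: the mean
  value inequality at a nearest boundary point bounds it from below, and the boundary point in
  the direction of the normal \<open>sgn a\<close> bounds it from above.
\<close>
lemma infdist_frontier_ge:
  assumes def: "defining_function_near \<Omega> Q r U" and Q: "Q \<in> frontier \<Omega>"
    and B: "ball Q \<eta> \<subseteq> U" "nearly_linear_on (ball Q \<eta>) r a e" "0 \<le> e"
    and z: "z \<in> ball Q (\<eta> / 2)"
  shows "- r z \<le> (1 + e) * norm a * infdist z (frontier \<Omega>)"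
proof -
  obtain y where y: "y \<in> frontier \<Omega>" "infdist z (frontier \<Omega>) = dist z y"
    using infdist_attains_inf[of "frontier \<Omega>" z] Q by auto
  have "dist z y \<le> dist z Q" using infdist_le[OF Q, of z] y by simp
  then have "dist Q y < \<eta>" using z dist_triangle[of Q y z] by (simp add: dist_commute)
  then have yB: "y \<in> ball Q \<eta>" by simp
  have "dist Q z < \<eta>" using z zero_le_dist[of Q z] unfolding mem_ball by linarith
  then have zB: "z \<in> ball Q \<eta>" by simp
  have "r y = 0" using def y(1) yB B(1) unfolding defining_function_near_def by blast
  then show ?thesis using nearly_linear_onD(3)[OF B(2) yB zB] y(2) by (simp add: dist_norm norm_minus_commute)
qed

lemma infdist_frontier_le:
  assumes def: "defining_function_near \<Omega> Q r U" and Q: "Q \<in> frontier \<Omega>"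
    and B: "ball Q \<eta> \<subseteq> U" "nearly_linear_on (ball Q \<eta>) r a e" "0 \<le> e" "e \<le> 1/4" and a: "a \<noteq> 0"
    and z: "z \<in> ball Q (\<eta> / 4)" "r z \<le> 0"
  shows "(1 - e) * norm a * infdist z (frontier \<Omega>) \<le> - r z"
proof -
  have \<eta>: "0 < \<eta>" using z(1) zero_le_dist[of Q z] unfolding mem_ball by linarith
  have QB: "Q \<in> ball Q \<eta>" and zB: "z \<in> ball Q \<eta>" using \<eta> z by auto
  have "r Q = 0" using def Q unfolding defining_function_near_def by blast
  then have rz: "- r z \<le> (1 + e) * norm a * dist Q z" using nearly_linear_onD(3)[OF B(2) QB zB] by (simp add: dist_norm)
  define s where "s = - r z / ((1 - e) * norm a)"
  have pos: "0 < (1 - e) * norm a" using B(4) a by simp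
  have s0: "0 \<le> s" using divide_nonpos_pos[OF z(2) pos] by (simp add: s_def)
  have ne: "(1 - e) * norm a \<noteq> 0" using pos by linarith
  have seq: "s * ((1 - e) * norm a) = - r z"
    unfolding s_def by (rule nonzero_divide_eq_eq[OF ne, THEN iffD1, OF refl, symmetric])
  have "s \<le> 2 * dist Q z"
  proof -
    have "- r z \<le> 2 * dist Q z * ((1 - e) * norm a)"
    proof -
      have "(1 + e) * (norm a * dist Q z) \<le> (2 * (1 - e)) * (norm a * dist Q z)"
        by (rule mult_right_mono) (use B in auto)
      moreover have "(1 + e) * norm a * dist Q z = (1 + e) * (norm a * dist Q z)"
        "2 * dist Q z * ((1 - e) * norm a) = (2 * (1 - e)) * (norm a * dist Q z)" by (simp_all only: mult_ac)
      ultimately show ?thesis using rz by linarith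
    qed
    then show ?thesis unfolding s_def by (rule pos_divide_le_eq[OF pos, THEN iffD2])
  qed
  then have s: "s + dist Q z < \<eta>" using z(1) zero_le_dist[of Q z] unfolding mem_ball by linarith
  have inB: "z + s' *\<^sub>R sgn a \<in> ball Q \<eta>" if "0 \<le> s'" "s' \<le> s" for s'
  proof -
    have "dist Q (z + s' *\<^sub>R sgn a) \<le> dist Q z + dist z (z + s' *\<^sub>R sgn a)" by (rule dist_triangle)
    also have "dist z (z + s' *\<^sub>R sgn a) = s'" using that a by (simp add: dist_norm norm_sgn)
    finally show ?thesis using s that by simp
  qed
  have "r (z + s *\<^sub>R sgn a - s *\<^sub>R sgn a) \<le> r (z + s *\<^sub>R sgn a) - s * norm a * (1 - e)"
    by (rule nearly_linear_on_shift[OF B(2)]) (use inB[of s] s0 zB a in auto)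
  then have end_ge: "0 \<le> r (z + s *\<^sub>R sgn a)" using seq by (simp add: mult_ac)
  have "continuous_on {0..s} (\<lambda>s'. r (z + s' *\<^sub>R sgn a))"
  proof (rule continuous_on_compose2[of "ball Q \<eta>" r])
    have "smooth_on U r" using def by (simp add: defining_function_near_def)
    then show "continuous_on (ball Q \<eta>) r" using B(1) smooth_on_differentiable
      by (intro continuous_at_imp_continuous_on ballI differentiable_imp_continuous_within) blast
  qed (use inB in \<open>auto intro!: continuous_intros\<close>)
  then obtain s' where s': "0 \<le> s'" "s' \<le> s" "r (z + s' *\<^sub>R sgn a) = 0"
    using IVT'[of "\<lambda>s'. r (z + s' *\<^sub>R sgn a)" 0 0 s] z(2) end_ge s0 by auto
  have "z + s' *\<^sub>R sgn a \<in> frontier \<Omega>"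
    using def inB[OF s'(1,2)] B(1) s'(3) unfolding defining_function_near_def by blast
  then have "infdist z (frontier \<Omega>) \<le> dist z (z + s' *\<^sub>R sgn a)" by (rule infdist_le)
  also have "\<dots> = s'" using s'(1) a by (simp add: dist_norm norm_sgn)
  finally have "infdist z (frontier \<Omega>) \<le> s" using s'(2) by simp
  then have "(1 - e) * norm a * infdist z (frontier \<Omega>) \<le> (1 - e) * norm a * s"
    using pos by (intro mult_left_mono) auto
  then show ?thesis using seq by (simp add: mult.commute)
qed

section \<open>Pseudoconvexity makes the defining function large on one side\<close>

lemma Re_poisson: "s \<noteq> \<zeta> \<Longrightarrow> Re ((s + \<zeta>) / (s - \<zeta>)) = ((norm s)\<^sup>2 - (norm \<zeta>)\<^sup>2) / (norm (s - \<zeta>))\<^sup>2"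
proof -
  assume "s \<noteq> \<zeta>"
  have "(s + \<zeta>) / (s - \<zeta>) = ((s + \<zeta>) * cnj (s - \<zeta>)) / of_real ((norm (s - \<zeta>))\<^sup>2)"
    by (rule complex_div_cnj)
  then have "Re ((s + \<zeta>) / (s - \<zeta>)) = Re ((s + \<zeta>) * cnj (s - \<zeta>)) / (norm (s - \<zeta>))\<^sup>2"
    by (simp only: Re_divide_of_real)
  moreover have "Re ((s + \<zeta>) * cnj (s - \<zeta>)) = (norm s)\<^sup>2 - (norm \<zeta>)\<^sup>2"
    unfolding cmod_power2 by (simp add: power2_eq_square algebra_simps)
  ultimately show ?thesis by simp
qed

text \<open>
  With \<open>\<kappa>\<close> for the multiple of the Poisson kernel in the barrier below, this is \<open>\<kappa> / 40\<close>: the error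
  terms in its application add up to \<open>10 * e\<close>, and they have to stay below \<open>\<kappa> / 2\<close>.
\<close>
definition positivity_const :: "real \<Rightarrow> real" where "positivity_const L = 1 / (46080 * L\<^sup>2)"


text \<open>
  The barrier is a constant minus a small multiple of a Poisson kernel whose pole lies slightly
  outside the disc, behind \<open>\<omega>\<close>. On the unit circle the kernel is large near \<open>\<omega>\<close> and at most \<open>1/2\<close>
  elsewhere, but its value at the centre is \<open>1\<close>.
\<close>
lemma harmonic_barrier:
  fixes \<omega> :: complex and L e :: real
  assumes L: "1 \<le> L" and e: "e = positivity_const L" and \<omega>: "norm \<omega> = 1"
  obtains H where "H holomorphic_on ball 0 (1 + 1 / (96 * L\<^sup>2))" "Re (H 0) < - 4 * e"
    "\<And>\<zeta>. norm \<zeta> = 1 \<Longrightarrow> 1 / (2 * L) \<le> norm (\<zeta> - \<omega>) \<Longrightarrow> 6 * e \<le> Re (H \<zeta>)"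
    "\<And>\<zeta>. norm \<zeta> = 1 \<Longrightarrow> - 1/4 \<le> Re (H \<zeta>)"
proof -
  define \<beta> where "\<beta> = 1 / (2 * L)"
  define \<eta> where "\<eta> = 1 / (96 * L\<^sup>2)"
  define \<kappa> where "\<kappa> = 1 / (1152 * L\<^sup>2)"
  have L2: "1 \<le> L\<^sup>2" using L by simp
  have \<beta>: "0 < \<beta>" "\<beta> \<le> 1/2" using L by (auto simp: \<beta>_def divide_simps)
  have \<eta>: "0 < \<eta>" "\<eta> \<le> 1" "24 * \<eta> = \<beta>\<^sup>2" using L L2 by (auto simp: \<eta>_def \<beta>_def power2_eq_square divide_simps)
  have \<kappa>: "0 < \<kappa>" "12 * \<kappa> = \<eta>" "40 * e = \<kappa>" "0 < e"
    using L L2 by (auto simp: \<kappa>_def \<eta>_def e positivity_const_def divide_simps)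
  have "24 * \<eta> \<le> \<beta> * (1/2)" unfolding \<eta>(3) power2_eq_square using \<beta> by (intro mult_left_mono) auto
  then have \<eta>\<beta>: "\<eta> \<le> \<beta> / 2" using \<beta> \<eta> by linarith
  define s where "s = of_real (1 + \<eta>) * \<omega>"
  have "norm (complex_of_real (1 + \<eta>)) = 1 + \<eta>" unfolding norm_of_real using \<eta> by simp
  then have ns: "norm s = 1 + \<eta>" using \<omega> by (simp add: s_def norm_mult del: of_real_add)
  define H where "H = (\<lambda>\<zeta>. of_real (6 * e + \<kappa>/2) - of_real \<kappa> * ((s + \<zeta>) / (s - \<zeta>)))"
  have ReH: "Re (H \<zeta>) = 6 * e + \<kappa>/2 - \<kappa> * (((1 + \<eta>)\<^sup>2 - (norm \<zeta>)\<^sup>2) / (norm (s - \<zeta>))\<^sup>2)"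
    if "norm \<zeta> < 1 + \<eta>" for \<zeta>
  proof -
    have "s \<noteq> \<zeta>" using that ns by auto
    then show ?thesis using Re_poisson[of s \<zeta>] ns by (simp add: H_def del: times_divide_eq_right)
  qed
  have num: "(1 + \<eta>)\<^sup>2 - 1\<^sup>2 \<le> 3 * \<eta>"
    using \<eta>(1,2) mult_left_mono[of \<eta> 1 \<eta>] by (simp add: power2_eq_square algebra_simps)
  show ?thesis
  proof (rule that[of H])
    show "H holomorphic_on ball 0 (1 + 1 / (96 * L\<^sup>2))"
      unfolding H_def \<eta>_def[symmetric] using ns by (intro holomorphic_intros) auto
    have "s \<noteq> 0" using ns \<eta> by auto
    then show "Re (H 0) < - 4 * e" using \<kappa> by (simp add: H_def)
    fix \<zeta> :: complex assume z: "norm \<zeta> = 1"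
    then have z1: "norm \<zeta> < 1 + \<eta>" using \<eta> by simp
    show "6 * e \<le> Re (H \<zeta>)" if far: "1 / (2 * L) \<le> norm (\<zeta> - \<omega>)"
    proof -
      have "norm (\<zeta> - \<omega>) \<le> norm (s - \<zeta>) + norm (s - \<omega>)"
        using norm_triangle_ineq4[of "s - \<omega>" "s - \<zeta>"] by (simp add: norm_minus_commute)
      moreover have "s - \<omega> = of_real \<eta> * \<omega>" by (simp add: s_def algebra_simps)
      then have "norm (s - \<omega>) = \<eta>" using \<omega> \<eta> by (simp add: norm_mult)
      ultimately have "\<beta> / 2 \<le> norm (s - \<zeta>)" using far \<eta>\<beta> by (simp add: \<beta>_def[symmetric])
      then have "(\<beta> / 2)\<^sup>2 \<le> (norm (s - \<zeta>))\<^sup>2" using \<beta> by (intro power_mono) auto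
      then have "6 * \<eta> \<le> (norm (s - \<zeta>))\<^sup>2" using \<eta>(3) by (simp add: power_divide)
      then have "((1 + \<eta>)\<^sup>2 - 1\<^sup>2) / (norm (s - \<zeta>))\<^sup>2 \<le> (3 * \<eta>) / (6 * \<eta>)"
        using num \<eta>(1) by (intro frac_le) auto
      also have "\<dots> = 1/2" using \<eta>(1) by simp
      finally have "\<kappa> * (((1 + \<eta>)\<^sup>2 - 1\<^sup>2) / (norm (s - \<zeta>))\<^sup>2) \<le> \<kappa> * (1/2)"
        using \<kappa>(1) by (intro mult_left_mono) auto
      then show ?thesis unfolding ReH[OF z1] z by simp
    qed
    show "- 1/4 \<le> Re (H \<zeta>)"
    proof -
      have "\<eta> \<le> norm (s - \<zeta>)" using norm_triangle_ineq2[of s \<zeta>] ns z by simp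
      then have "\<eta>\<^sup>2 \<le> (norm (s - \<zeta>))\<^sup>2" using \<eta> by (intro power_mono) auto
      then have "((1 + \<eta>)\<^sup>2 - 1\<^sup>2) / (norm (s - \<zeta>))\<^sup>2 \<le> (3 * \<eta>) / \<eta>\<^sup>2"
        using num \<eta>(1) by (intro frac_le) auto
      then have "\<kappa> * (((1 + \<eta>)\<^sup>2 - 1\<^sup>2) / (norm (s - \<zeta>))\<^sup>2) \<le> \<kappa> * ((3 * \<eta>) / \<eta>\<^sup>2)"
        using \<kappa>(1) by (intro mult_left_mono) auto
      also have "\<dots> = 1/4" using \<eta>(1) by (simp add: power2_eq_square flip: \<kappa>(2))
      finally show ?thesis unfolding ReH[OF z1] z using \<kappa> by simp
    qed
  qed
qed

lemma neg_ln_le: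
  fixes d :: real
  assumes "0 < c" "c * M \<le> d" "0 < M"
  shows "- ln d \<le> - ln M + (1 / c - 1)"
proof -
  have d: "0 < d" using assms by (meson less_le_trans mult_pos_pos)
  have "ln c + ln M \<le> ln d" using assms d by (simp flip: ln_mult_pos)
  moreover have "- ln c \<le> 1 / c - 1" using ln_le_minus_one[of "1/c"] assms(1) by (simp add: ln_div)
  ultimately show ?thesis by linarith
qed

lemma neg_ln_ge:
  fixes d :: real
  assumes "0 < d" "d \<le> c * M" "0 < M" "0 < c"
  shows "- ln M - (c - 1) \<le> - ln d"
proof -
  have "ln d \<le> ln c + ln M" using assms by (simp flip: ln_mult_pos)
  moreover have "ln c \<le> c - 1" using ln_le_minus_one[of c] assms by simp
  ultimately show ?thesis by linarith
qed

text \<open>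
  Suppose that \<open>r \<circ> F\<close>, whose absolute value reaches \<open>N\<close>, stays below \<open>e * N\<close>. Then it takes the value
  \<open>- N\<close> at some \<open>\<zeta>0\<close> and, by the Lipschitz bound, lies below \<open>- N/2\<close> on an arc around \<open>\<zeta>0\<close> whose size
  is controlled by \<open>L\<close>. Push the disc of radius \<open>\<bar>\<zeta>0\<bar>\<close> inwards by \<open>M = N / norm a\<close>. Up to terms of
  order \<open>e\<close>, the function \<open>- ln dist + ln M\<close> is then \<open>0\<close> at the centre, at most \<open>0\<close> on the boundary
  circle and less than \<open>- 1/4\<close> on the arc. The barrier and the maximum principle exclude this.
\<close>
lemma pseudoconvex_sup_bound:
  fixes F :: "complex \<Rightarrow> complex^'n"
  assumes \<Omega>: "open \<Omega>" "pseudoconvex \<Omega>" and Q: "Q \<in> frontier \<Omega>"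
    and def: "defining_function_near \<Omega> Q r U"
    and B: "ball Q \<eta> \<subseteq> U" "nearly_linear_on (ball Q \<eta>) r a e" and a: "a \<noteq> 0"
    and L: "1 \<le> L" and e: "e = positivity_const L"
    and F: "\<And>i. (\<lambda>\<zeta>. F \<zeta> $ i) holomorphic_on ball 0 R" and F0: "F 0 = Q"
    and t: "0 < t" "t < R" and FB: "\<And>\<zeta>. norm \<zeta> \<le> t \<Longrightarrow> F \<zeta> \<in> ball Q (\<eta> / 8)"
    and N: "0 < N" "N \<le> norm a * (\<eta> / 8)" and rN: "\<And>\<zeta>. norm \<zeta> \<le> t \<Longrightarrow> \<bar>r (F \<zeta>)\<bar> \<le> N"
    and \<zeta>0: "norm \<zeta>0 \<le> t" "\<bar>r (F \<zeta>0)\<bar> = N"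
    and lip: "\<And>\<zeta> \<xi>. norm \<zeta> \<le> t \<Longrightarrow> norm \<xi> \<le> t \<Longrightarrow> \<bar>r (F \<zeta>) - r (F \<xi>)\<bar> \<le> L * (N / t) * norm (\<zeta> - \<xi>)"
  shows "\<exists>\<zeta>. norm \<zeta> \<le> t \<and> e * N \<le> r (F \<zeta>)"
proof (rule ccontr)
  assume "\<not> ?thesis"
  then have up: "r (F \<zeta>) < e * N" if "norm \<zeta> \<le> t" for \<zeta> using that by (meson not_le)
  have L2: "1 \<le> L\<^sup>2" using L by simp
  have e0: "0 < e" "e \<le> 1/16" using L2 by (auto simp: e positivity_const_def divide_simps)
  have eN: "e * N < N" using e0 N by simp
  have neg: "r (F \<zeta>0) = - N" using \<zeta>0 up[OF \<zeta>0(1)] eN by linarith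
  have rQ: "r Q = 0" using def Q unfolding defining_function_near_def by blast
  define \<rho> where "\<rho> = norm \<zeta>0"
  have \<rho>: "0 < \<rho>" "\<rho> \<le> t"
  proof -
    have "\<zeta>0 \<noteq> 0" using neg F0 rQ N by auto
    then show "0 < \<rho>" by (simp add: \<rho>_def)
  qed (simp add: \<rho>_def \<zeta>0)
  define \<omega> where "\<omega> = sgn \<zeta>0"
  have \<omega>: "norm \<omega> = 1" "of_real \<rho> * \<omega> = \<zeta>0"
    using \<rho> by (simp add: \<omega>_def \<rho>_def norm_sgn) (use \<rho> in \<open>simp add: \<omega>_def \<rho>_def sgn_div_norm scaleR_conv_of_real\<close>)
  define M where "M = N / norm a"
  have M: "0 < M" "M \<le> \<eta> / 8" "M * norm a = N" using N a by (auto simp: M_def divide_simps mult.commute)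
  have \<eta>: "0 < \<eta>" using M by linarith
  \<comment> \<open>the disc through \<open>\<zeta>0\<close>, pushed inwards by \<open>M\<close> and rescaled to the unit disc\<close>
  define E where "E = (\<lambda>\<zeta>. F (of_real \<rho> * \<zeta>) - M *\<^sub>R sgn a)"
  have sub: "ball Q (\<eta>/8) \<subseteq> ball Q \<eta>" "ball Q (\<eta>/4) \<subseteq> ball Q (\<eta>/2)" "ball Q (\<eta>/4) \<subseteq> ball Q \<eta>"
    using \<eta> by (auto intro!: subset_ball)
  have nt: "norm (of_real \<rho> * \<zeta>) \<le> t" if "norm \<zeta> \<le> 1" for \<zeta> :: complex
    using that \<rho> mult_mono[of \<rho> t "norm \<zeta>" 1] by (simp add: norm_mult)
  have EB: "E \<zeta> \<in> ball Q (\<eta> / 4)" if "norm \<zeta> \<le> 1" for \<zeta>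
  proof -
    have "dist Q (E \<zeta>) \<le> dist Q (F (of_real \<rho> * \<zeta>)) + dist (F (of_real \<rho> * \<zeta>)) (E \<zeta>)" by (rule dist_triangle)
    also have "dist (F (of_real \<rho> * \<zeta>)) (E \<zeta>) = M" using M(1) a by (simp add: E_def dist_norm norm_sgn)
    finally show ?thesis using FB[OF nt[OF that]] M(2) by simp
  qed
  have rE: "r (E \<zeta>) \<le> r (F (of_real \<rho> * \<zeta>)) - N * (1 - e)" "r (F (of_real \<rho> * \<zeta>)) - N * (1 + e) \<le> r (E \<zeta>)"
    if "norm \<zeta> \<le> 1" for \<zeta>
  proof -
    have x: "F (of_real \<rho> * \<zeta>) \<in> ball Q \<eta>" using FB[OF nt[OF that]] sub by blast
    have y: "F (of_real \<rho> * \<zeta>) - M *\<^sub>R sgn a \<in> ball Q \<eta>" using EB[OF that] sub(3) unfolding E_def by blast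
    show "r (E \<zeta>) \<le> r (F (of_real \<rho> * \<zeta>)) - N * (1 - e)"
      using nearly_linear_on_shift(1)[OF B(2) x y _ a] M(1) unfolding E_def M(3) by simp
    show "r (F (of_real \<rho> * \<zeta>)) - N * (1 + e) \<le> r (E \<zeta>)"
      using nearly_linear_on_shift(2)[OF B(2) x y _ a] M(1) unfolding E_def M(3) by simp
  qed
  have rneg: "r (E \<zeta>) < 0" if "norm \<zeta> \<le> 1" for \<zeta>
  proof -
    have "r (E \<zeta>) < e * N - N * (1 - e)" using rE(1)[OF that] up[OF nt[OF that]] by linarith
    also have "\<dots> = - (N * (1 - 2 * e))" by (simp add: algebra_simps)
    also have "\<dots> \<le> 0" using N(1) e0 by simp
    finally show ?thesis .
  qed
  have E\<Omega>: "E \<zeta> \<in> \<Omega>" if "norm \<zeta> \<le> 1" for \<zeta>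
  proof -
    have "E \<zeta> \<in> U" using EB[OF that] sub(3) B(1) by blast
    then show ?thesis using rneg[OF that] def unfolding defining_function_near_def by blast
  qed
  let ?d = "\<lambda>z. infdist z (frontier \<Omega>)"
  have dge: "c * M \<le> ?d (E \<zeta>)" if z: "norm \<zeta> \<le> 1" and c: "N * ((1 + e) * c) \<le> - r (E \<zeta>)" for \<zeta> c
  proof -
    have "- r (E \<zeta>) \<le> (1 + e) * norm a * ?d (E \<zeta>)"
      by (rule infdist_frontier_ge[OF def Q B]) (use EB[OF z] sub e0 in auto)
    moreover have "(1 + e) * norm a * (c * M) = M * norm a * ((1 + e) * c)" by (simp only: mult_ac)
    ultimately have "(1 + e) * norm a * (c * M) \<le> (1 + e) * norm a * ?d (E \<zeta>)"
      using c unfolding M(3) by linarith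
    then show ?thesis using e0 a by simp
  qed
  obtain H where H: "H holomorphic_on ball 0 (1 + 1 / (96 * L\<^sup>2))" "Re (H 0) < - 4 * e"
    "\<And>\<zeta>. norm \<zeta> = 1 \<Longrightarrow> 1 / (2 * L) \<le> norm (\<zeta> - \<omega>) \<Longrightarrow> 6 * e \<le> Re (H \<zeta>)"
    "\<And>\<zeta>. norm \<zeta> = 1 \<Longrightarrow> - 1/4 \<le> Re (H \<zeta>)"
    using harmonic_barrier[OF L e \<omega>(1)] by metis
  define R' where "R' = min (R / \<rho>) (1 + 1 / (96 * L\<^sup>2))"
  have R': "1 < R'" using t \<rho> L2 by (auto simp: R'_def)
  have "- ln (?d (E 0)) \<le> Re (of_real (- ln M) + H 0)"
  proof (rule psh_disc_maximum_principle[where \<Omega> = \<Omega> and F = E and u = "\<lambda>z. - ln (?d z)" and R = R' and H = "\<lambda>\<zeta>. of_real (- ln M) + H \<zeta>"])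
    show "continuous_plurisubharmonic_on (\<lambda>z. - ln (?d z)) \<Omega>" using \<Omega>(2) by (simp add: pseudoconvex_def)
    show "open \<Omega>" "1 < R'" by fact+
    show "E \<zeta> \<in> \<Omega>" if "norm \<zeta> \<le> 1" for \<zeta> using E\<Omega>[OF that] .
    show "(\<lambda>\<zeta>. of_real (- ln M) + H \<zeta>) holomorphic_on ball 0 R'"
      by (intro holomorphic_on_add holomorphic_on_const holomorphic_on_subset[OF H(1)] subset_ball) (simp add: R'_def)
    show "(\<lambda>\<zeta>. E \<zeta> $ i) holomorphic_on ball 0 R'" for i
    proof -
      have "((\<lambda>\<zeta>. F \<zeta> $ i) \<circ> (\<lambda>\<zeta>. of_real \<rho> * \<zeta>)) holomorphic_on ball 0 R'"
      proof (rule holomorphic_on_compose_gen[OF _ F])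
        show "(\<lambda>\<zeta>::complex. of_real \<rho> * \<zeta>) ` ball 0 R' \<subseteq> ball 0 R"
        proof (intro image_subsetI)
          fix \<zeta> :: complex assume "\<zeta> \<in> ball 0 R'"
          then have "norm \<zeta> < R / \<rho>" by (simp add: R'_def)
          then show "of_real \<rho> * \<zeta> \<in> ball 0 R" using \<rho>(1) by (simp add: norm_mult field_simps)
        qed
      qed (intro holomorphic_intros)
      then show ?thesis unfolding E_def by (auto simp: o_def intro!: holomorphic_intros)
    qed
    fix \<zeta> :: complex assume z: "norm \<zeta> = 1"
    then have z1: "norm \<zeta> \<le> 1" by simp
    show "- ln (?d (E \<zeta>)) \<le> Re (of_real (- ln M) + H \<zeta>)"
    proof (cases "1 / (2 * L) \<le> norm (\<zeta> - \<omega>)")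
      case True
      let ?c = "(1 - 2 * e) / (1 + e)"
      have "(1 + e) * ?c = 1 - 2 * e" using e0 by simp
      then have "N * ((1 + e) * ?c) = N * (1 - e) - e * N" by (simp only:) (simp add: algebra_simps)
      then have "?c * M \<le> ?d (E \<zeta>)" using dge[OF z1, of ?c] rE(1)[OF z1] up[OF nt[OF z1]] by linarith
      moreover have c0: "0 < ?c" using e0 by simp
      ultimately have "- ln (?d (E \<zeta>)) \<le> - ln M + (1 / ?c - 1)" using neg_ln_le M(1) by blast
      also have "1 / ?c - 1 \<le> 6 * e"
      proof -
        have "1 / ?c - 1 = 3 * e / (1 - 2 * e)" using e0 by (simp add: field_simps)
        also have "\<dots> \<le> 3 * e / (1/2)" using e0 by (intro divide_left_mono) auto
        finally show ?thesis by simp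
      qed
      finally show ?thesis using H(3)[OF z True] by simp
    next
      case False
      have "\<bar>r (F (of_real \<rho> * \<zeta>)) - r (F \<zeta>0)\<bar> \<le> L * (N / t) * norm (of_real \<rho> * \<zeta> - \<zeta>0)"
        by (rule lip[OF nt[OF z1] \<zeta>0(1)])
      also have "norm (of_real \<rho> * \<zeta> - \<zeta>0) = \<rho> * norm (\<zeta> - \<omega>)"
        using \<rho>(1) by (simp add: \<omega>(2)[symmetric] norm_mult flip: right_diff_distrib)
      also have "L * (N / t) * (\<rho> * norm (\<zeta> - \<omega>)) \<le> L * (N / t) * (t * (1 / (2 * L)))"
        using L N t \<rho> False by (intro mult_left_mono mult_mono) auto
      also have "\<dots> = N / 2" using L t by simp
      finally have arc: "r (F (of_real \<rho> * \<zeta>)) \<le> - N / 2" using neg by linarith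
      have "N * ((1 + e) * (4/3)) \<le> N * (1 - e + 1/2)" using N(1) e0 by (intro mult_left_mono) auto
      moreover have "N * (1 - e + 1/2) = N * (1 - e) + N / 2" by (simp add: algebra_simps)
      ultimately have "N * ((1 + e) * (4/3)) \<le> - r (E \<zeta>)" using rE(1)[OF z1] arc by linarith
      then have d: "(4/3) * M \<le> ?d (E \<zeta>)" by (rule dge[OF z1])
      have "- ln (?d (E \<zeta>)) \<le> - ln M + (1 / (4/3) - 1)" by (rule neg_ln_le[OF _ d M(1)]) simp
      then show ?thesis using H(4)[OF z] by simp
    qed
  qed
  moreover have "- ln M - ((1 + e) / (1 - e) - 1) \<le> - ln (?d (E 0))"
  proof (rule neg_ln_ge)
    have "(1 + e) * ((1 - 2 * e) / (1 + e)) = 1 - 2 * e" using e0 by simp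
    then have "N * ((1 + e) * ((1 - 2 * e) / (1 + e))) = N * (1 - e) - e * N" by (simp only:) (simp add: algebra_simps)
    moreover have "r (E 0) \<le> r (F 0) - N * (1 - e)" using rE(1)[of 0] by simp
    moreover have "r (F 0) < e * N" using up[of 0] t by simp
    ultimately have "N * ((1 + e) * ((1 - 2 * e) / (1 + e))) \<le> - r (E 0)" by linarith
    then have "(1 - 2 * e) / (1 + e) * M \<le> ?d (E 0)" by (rule dge[of 0, rotated]) simp
    moreover have "0 < (1 - 2 * e) / (1 + e) * M" using e0 M(1) by (intro mult_pos_pos divide_pos_pos) auto
    ultimately show "0 < ?d (E 0)" by linarith
    have "(1 - e) * norm a * ?d (E 0) \<le> - r (E 0)"
      by (rule infdist_frontier_le[OF def Q B]) (use EB[of 0] rneg[of 0] e0 a in auto)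
    also have "\<dots> \<le> N * (1 + e)" using rE(2)[of 0] F0 rQ by simp
    also have "\<dots> = (1 + e) * M * norm a" using M(3) by (simp add: mult_ac)
    finally have "norm a * ((1 - e) * ?d (E 0)) \<le> norm a * ((1 + e) * M)" by (simp add: mult_ac)
    then have "(1 - e) * ?d (E 0) \<le> (1 + e) * M" using a by simp
    then show "?d (E 0) \<le> (1 + e) / (1 - e) * M" using e0 by (simp add: field_simps)
  qed (use e0 M in auto)
  moreover have "(1 + e) / (1 - e) - 1 \<le> 4 * e"
  proof -
    have "(1 + e) / (1 - e) - 1 = 2 * e / (1 - e)" using e0 by (simp add: field_simps)
    also have "\<dots> \<le> 2 * e / (1/2)" using e0 by (intro divide_left_mono) auto
    finally show ?thesis by simp
  qed
  ultimately show False using H(2) by simp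
qed

section \<open>Holomorphic curves and coordinates\<close>

lemma linear_smult_left: "linear (\<lambda>c::complex. c *s (v :: complex^'n))"
  by (rule linearI) (simp_all add: vec_eq_iff algebra_simps)

lemma has_derivative_vec_components:
  fixes \<psi> :: "'a::euclidean_space \<Rightarrow> complex^'n"
  assumes "\<And>i. ((\<lambda>z. \<psi> z $ i) has_derivative L i) (at x)"
  shows "(\<psi> has_derivative (\<lambda>v. \<chi> i. L i v)) (at x)"
proof -
  have "((\<lambda>z. \<Sum>i\<in>UNIV. \<psi> z $ i *s axis i (1::complex)) has_derivative (\<lambda>v. \<Sum>i\<in>UNIV. L i v *s axis i 1)) (at x)"
  proof (rule has_derivative_sum)
    fix i :: 'n
    have "bounded_linear (\<lambda>c::complex. c *s (axis i 1 :: complex^'n))"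
      using linear_smult_left linear_conv_bounded_linear by blast
    from bounded_linear.has_derivative[OF this assms[of i]]
    show "((\<lambda>z. \<psi> z $ i *s axis i (1::complex)) has_derivative (\<lambda>v. L i v *s axis i 1)) (at x)" .
  qed
  moreover have "(\<Sum>i\<in>UNIV. L i v *s axis i 1) = (\<chi> i. L i v)" for v
    using basis_expansion[of "\<chi> i. L i v"] by simp
  ultimately show ?thesis by (simp add: basis_expansion)
qed

lemma curve_has_derivative:
  fixes F :: "complex \<Rightarrow> complex^'n"
  assumes "\<And>i. (\<lambda>\<zeta>. F \<zeta> $ i) holomorphic_on S" "open S" "z \<in> S"
  shows "(F has_derivative (\<lambda>y. y *s (\<chi> i. deriv (\<lambda>\<zeta>. F \<zeta> $ i) z))) (at z)"
proof -
  have "((\<lambda>\<zeta>. F \<zeta> $ i) has_derivative (\<lambda>y. y * deriv (\<lambda>\<zeta>. F \<zeta> $ i) z)) (at z)" for i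
    using holomorphic_derivI[OF assms(1,2,3), of i] by (simp add: has_field_derivative_def mult_commute_abs)
  from has_derivative_vec_components[OF this] show ?thesis
    by (simp add: vector_scalar_mult_def)
qed

lemma holomorphic_fun_on_curve:
  fixes F :: "complex \<Rightarrow> complex^'n"
  assumes h: "holomorphic_fun_on h D" and F: "\<And>i. (\<lambda>\<zeta>. F \<zeta> $ i) holomorphic_on S" and S: "open S"
    and FD: "\<And>\<zeta>. \<zeta> \<in> S \<Longrightarrow> F \<zeta> \<in> D"
  shows "(\<lambda>\<zeta>. h (F \<zeta>)) holomorphic_on S"
proof (rule holomorphic_onI)
  fix z assume z: "z \<in> S"
  obtain L where L: "(h has_derivative L) (at (F z))" "\<And>c v. L (c *s v) = c * L v"
    using h FD[OF z] unfolding holomorphic_fun_on_def by blast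
  let ?b = "\<chi> i. deriv (\<lambda>\<zeta>. F \<zeta> $ i) z"
  have "((\<lambda>\<zeta>. h (F \<zeta>)) has_derivative (\<lambda>y. L (y *s ?b))) (at z)"
    by (rule has_derivative_compose[OF curve_has_derivative[OF F S z] L(1)])
  then have "((\<lambda>\<zeta>. h (F \<zeta>)) has_field_derivative L ?b) (at z)"
    by (simp add: has_field_derivative_def L(2) mult_commute_abs)
  then show "(\<lambda>\<zeta>. h (F \<zeta>)) field_differentiable at z within S"
    using field_differentiable_def field_differentiable_at_within by blast
qed

lemma holomorphic_affine_component: "(\<lambda>\<zeta>. (a + \<zeta> *s v :: complex^'n) $ i) holomorphic_on S"
  by (simp add: holomorphic_intros)

lemma Schwarz_scaled:
  fixes E :: "complex \<Rightarrow> complex"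
  assumes E: "E holomorphic_on ball 0 R" "E 0 = 0" and M: "\<And>\<zeta>. norm \<zeta> < R \<Longrightarrow> norm (E \<zeta>) \<le> M"
    and z: "norm \<zeta> < R"
  shows "norm (E \<zeta>) \<le> M * (norm \<zeta> / R)"
proof -
  have R: "0 < R" using z norm_ge_zero[of \<zeta>] by linarith
  have M0: "0 \<le> M" using M[of 0] E(2) R by simp
  have key: "norm (E \<zeta>) \<le> M' * (norm \<zeta> / R)" if M': "M < M'" for M'
  proof -
    define f where "f = (\<lambda>z. E (of_real R * z) / of_real M')"
    have in_ball: "norm (of_real R * z :: complex) < R" if "norm z < 1" for z
      using that R mult_strict_left_mono[of "norm z" 1 R] by (simp add: norm_mult)
    have "(E \<circ> (\<lambda>z. of_real R * z)) holomorphic_on ball 0 1"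
      by (rule holomorphic_on_compose_gen[OF _ E(1)]) (use in_ball in \<open>auto intro!: holomorphic_intros\<close>)
    then have hol: "f holomorphic_on ball 0 1"
      unfolding f_def o_def using M' M0 by (intro holomorphic_on_divide holomorphic_on_const) auto
    have f1: "norm (f z) < 1" if "norm z < 1" for z
      using M[OF in_ball[OF that]] M' M0 by (simp add: f_def norm_divide)
    have "norm (f (\<zeta> / of_real R)) \<le> norm (\<zeta> / of_real R)"
      by (rule Schwarz_Lemma(1)[OF hol _ f1]) (use z R E(2) in \<open>auto simp: f_def norm_divide\<close>)
    then show ?thesis using R M' M0 by (simp add: f_def norm_divide field_simps)
  qed
  show ?thesis
  proof (rule field_le_epsilon)
    fix \<epsilon> :: real assume \<epsilon>: "0 < \<epsilon>"
    have "norm (E \<zeta>) \<le> (M + \<epsilon>) * (norm \<zeta> / R)" by (rule key) (use \<epsilon> in simp)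
    also have "\<dots> \<le> M * (norm \<zeta> / R) + \<epsilon> * 1"
      using z R \<epsilon> by (simp only: distrib_right) (intro add_left_mono mult_left_mono, auto)
    finally show "norm (E \<zeta>) \<le> M * (norm \<zeta> / R) + \<epsilon>" by simp
  qed
qed

lemma of_real_smult: "complex_of_real c *s (v :: complex^'n) = c *\<^sub>R v"
  unfolding vec_eq_iff vector_smult_component vector_scaleR_component by (simp add: scaleR_conv_of_real)

lemma holomorphic_components_continuous:
  fixes \<psi> :: "complex^'n \<Rightarrow> complex^'n"
  assumes "\<And>i. holomorphic_fun_on (\<lambda>z. \<psi> z $ i) V"
  shows "continuous_on V \<psi>"
proof -
  have "continuous_on V (\<lambda>z. \<chi> i. \<psi> z $ i)"
  proof (intro continuous_on_vec_lambda continuous_at_imp_continuous_on ballI)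
    fix i z assume "z \<in> V"
    then obtain L where "((\<lambda>z. \<psi> z $ i) has_derivative L) (at z)"
      using assms[of i] unfolding holomorphic_fun_on_def by blast
    then show "isCont (\<lambda>z. \<psi> z $ i) z" by (rule has_derivative_continuous)
  qed
  then show ?thesis by simp
qed

lemma holomorphic_on_line:
  fixes \<psi> :: "complex^'n \<Rightarrow> complex^'n"
  assumes "\<And>i. holomorphic_fun_on (\<lambda>z. \<psi> z $ i) V" "open S" "\<And>\<zeta>. \<zeta> \<in> S \<Longrightarrow> x + \<zeta> *s v \<in> V"
  shows "(\<lambda>\<zeta>. \<psi> (x + \<zeta> *s v) $ i) holomorphic_on S"
  by (rule holomorphic_fun_on_curve[OF assms(1) holomorphic_affine_component assms(2,3)])

text \<open>
  This expresses the continuity at \<open>q\<close> of the derivative of \<open>\<psi>\<close> in the direction \<open>\<nu>\<close>. As functions of a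
  complex variable \<open>\<sigma>\<close>, the maps \<open>\<psi> (x + \<sigma> *s \<nu>)\<close> and \<open>\<psi> (q + \<sigma> *s \<nu>)\<close> are uniformly close, and the Schwarz
  lemma turns this into closeness of their increments relative to \<open>\<bar>\<sigma>\<bar>\<close>.
\<close>
lemma holomorphic_increment:
  fixes \<psi> :: "complex^'n \<Rightarrow> complex^'n"
  assumes \<psi>: "\<And>i. holomorphic_fun_on (\<lambda>z. \<psi> z $ i) V" and V: "open V" "q \<in> V"
    and \<nu>: "norm \<nu> = 1" and \<theta>: "0 < \<theta>"
  obtains R where "0 < R" "ball q (2 * R) \<subseteq> V"
    "\<And>x \<delta>. x \<in> ball q R \<Longrightarrow> 0 \<le> \<delta> \<Longrightarrow> \<delta> < R \<Longrightarrow>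
      norm ((\<psi> (x - \<delta> *\<^sub>R \<nu>) - \<psi> x) - (\<psi> (q - \<delta> *\<^sub>R \<nu>) - \<psi> q)) \<le> \<theta> * \<delta>"
proof -
  obtain \<rho>0 where \<rho>0: "0 < \<rho>0" "cball q \<rho>0 \<subseteq> V" using V open_contains_cball by metis
  define \<rho> where "\<rho> = \<rho>0 / 2"
  have \<rho>: "0 < \<rho>" "cball q (2 * \<rho>) \<subseteq> V" using \<rho>0 by (auto simp: \<rho>_def)
  define n where "n = real CARD('n)"
  have n: "0 < n" by (simp add: n_def)
  define \<epsilon> where "\<epsilon> = \<theta> * \<rho> / (2 * n)"
  have \<epsilon>: "0 < \<epsilon>" using \<theta> \<rho> n by (simp add: \<epsilon>_def)
  have "continuous_on (cball q (2 * \<rho>)) \<psi>"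
    using continuous_on_subset[OF holomorphic_components_continuous[OF \<psi>] \<rho>(2)] .
  then have "uniformly_continuous_on (cball q (2 * \<rho>)) \<psi>" by (intro compact_uniformly_continuous) auto
  then obtain d where d: "0 < d"
    "\<And>x y. x \<in> cball q (2 * \<rho>) \<Longrightarrow> y \<in> cball q (2 * \<rho>) \<Longrightarrow> dist y x < d \<Longrightarrow> dist (\<psi> y) (\<psi> x) < \<epsilon>"
    using \<epsilon> unfolding uniformly_continuous_on_def by (elim allE[of _ \<epsilon>]) auto
  define R where "R = min d \<rho>"
  have R: "0 < R" "R \<le> d" "R \<le> \<rho>" using d(1) \<rho>(1) by (auto simp: R_def)
  show ?thesis
  proof (rule that[OF R(1)])
    show "ball q (2 * R) \<subseteq> V" using R(3) \<rho>(2) by (intro order_trans[OF _ \<rho>(2)]) auto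
    fix x \<delta> assume x: "x \<in> ball q R" and \<delta>: "0 \<le> \<delta>" "\<delta> < R"
    have inV: "y + \<sigma> *s \<nu> \<in> cball q (2 * \<rho>)" if "dist q y < R" "norm \<sigma> < \<rho>" for y \<sigma>
    proof -
      have "dist q (y + \<sigma> *s \<nu>) \<le> dist q y + dist y (y + \<sigma> *s \<nu>)" by (rule dist_triangle)
      also have "dist y (y + \<sigma> *s \<nu>) = norm \<sigma>"
      proof -
        have "norm (\<sigma> *s \<nu>) = norm \<sigma> * norm \<nu>"
          unfolding norm_vec_def by (simp add: norm_mult L2_set_right_distrib)
        then show ?thesis using \<nu> by (simp add: dist_norm)
      qed
      finally show ?thesis using that R(3) by simp
    qed
    have xR: "dist q x < R" "dist q q < R" using x R(1) by auto
    define h where "h = (\<lambda>i \<sigma>. (\<psi> (x + \<sigma> *s \<nu>) - \<psi> (q + \<sigma> *s \<nu>) - (\<psi> x - \<psi> q)) $ i)"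
    have close: "norm (\<psi> (x + \<sigma> *s \<nu>) - \<psi> (q + \<sigma> *s \<nu>)) \<le> \<epsilon>" if "norm \<sigma> < \<rho>" for \<sigma>
    proof -
      have "dist (x + \<sigma> *s \<nu>) (q + \<sigma> *s \<nu>) = dist q x" by (simp add: dist_norm norm_minus_commute)
      then have "dist (\<psi> (x + \<sigma> *s \<nu>)) (\<psi> (q + \<sigma> *s \<nu>)) < \<epsilon>"
        by (intro d(2) inV that xR) (use xR R in auto)
      then show ?thesis by (simp add: dist_norm)
    qed
    have hi: "norm (h i (of_real (- \<delta>))) \<le> 2 * \<epsilon> * (\<delta> / \<rho>)" for i
    proof -
      have "norm (h i (of_real (- \<delta>))) \<le> 2 * \<epsilon> * (norm (complex_of_real (- \<delta>)) / \<rho>)"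
      proof (rule Schwarz_scaled)
        have 1: "(\<lambda>\<sigma>. \<psi> (x + \<sigma> *s \<nu>) $ i) holomorphic_on ball 0 \<rho>"
          by (rule holomorphic_on_line[OF \<psi> open_ball]) (use inV[OF xR(1)] \<rho>(2) in auto)
        have 2: "(\<lambda>\<sigma>. \<psi> (q + \<sigma> *s \<nu>) $ i) holomorphic_on ball 0 \<rho>"
          by (rule holomorphic_on_line[OF \<psi> open_ball]) (use inV[OF xR(2)] \<rho>(2) in auto)
        show "h i holomorphic_on ball 0 \<rho>"
          unfolding h_def using 1 2 by (auto intro!: holomorphic_intros)
        show "h i 0 = 0" by (simp add: h_def)
        show "norm (h i \<sigma>) \<le> 2 * \<epsilon>" if "norm \<sigma> < \<rho>" for \<sigma>
        proof -
          have "norm (h i \<sigma>) \<le> norm (\<psi> (x + \<sigma> *s \<nu>) - \<psi> (q + \<sigma> *s \<nu>) - (\<psi> x - \<psi> q))"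
            unfolding h_def by (rule Finite_Cartesian_Product.norm_nth_le)
          also have "\<dots> \<le> norm (\<psi> (x + \<sigma> *s \<nu>) - \<psi> (q + \<sigma> *s \<nu>)) + norm (\<psi> x - \<psi> q)"
            by (rule norm_triangle_ineq4)
          also have "\<dots> \<le> \<epsilon> + \<epsilon>" using close[OF that] close[of 0] \<rho>(1) by (intro add_mono) auto
          finally show ?thesis by simp
        qed
        show "norm (complex_of_real (- \<delta>)) < \<rho>" using \<delta> R(3) by simp
      qed
      then show ?thesis using \<delta>(1) by simp
    qed
    have sm: "of_real (- \<delta>) *s \<nu> = - (\<delta> *\<^sub>R \<nu>)" unfolding of_real_smult by simp
    have "norm ((\<psi> (x - \<delta> *\<^sub>R \<nu>) - \<psi> x) - (\<psi> (q - \<delta> *\<^sub>R \<nu>) - \<psi> q))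
        \<le> (\<Sum>i\<in>UNIV. norm (((\<psi> (x - \<delta> *\<^sub>R \<nu>) - \<psi> x) - (\<psi> (q - \<delta> *\<^sub>R \<nu>) - \<psi> q)) $ i))"
      by (rule norm_vec_le_sum)
    also have "\<dots> = (\<Sum>i\<in>UNIV. norm (h i (of_real (- \<delta>))))"
      unfolding h_def sm by (intro sum.cong) (simp_all add: algebra_simps)
    also have "\<dots> \<le> (\<Sum>i\<in>(UNIV::'n set). 2 * \<epsilon> * (\<delta> / \<rho>))" by (intro sum_mono hi)
    also have "\<dots> = \<theta> * \<delta>" using \<rho>(1) n by (simp add: \<epsilon>_def n_def[symmetric])
    finally show "norm ((\<psi> (x - \<delta> *\<^sub>R \<nu>) - \<psi> x) - (\<psi> (q - \<delta> *\<^sub>R \<nu>) - \<psi> q)) \<le> \<theta> * \<delta>" .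
  qed
qed

lemma norm_smult: "norm (c *s (v :: complex^'n)) = norm c * norm v"
  unfolding norm_vec_def by (simp add: norm_mult L2_set_right_distrib)

lemma holomorphic_components_derivative:
  fixes \<psi> :: "complex^'n \<Rightarrow> complex^'n"
  assumes "\<And>i. holomorphic_fun_on (\<lambda>z. \<psi> z $ i) V" "x \<in> V"
  obtains D where "(\<psi> has_derivative D) (at x)" "\<And>c v. D (c *s v) = c *s D v"
proof -
  have "\<forall>i. \<exists>L. ((\<lambda>z. \<psi> z $ i) has_derivative L) (at x) \<and> (\<forall>c v. L (c *s v) = c * L v)"
    using assms unfolding holomorphic_fun_on_def by blast
  then obtain L where L: "\<And>i. ((\<lambda>z. \<psi> z $ i) has_derivative L i) (at x)" "\<And>i c v. L i (c *s v) = c * L i v"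
    by metis
  show ?thesis
    by (rule that[OF has_derivative_vec_components[OF L(1)]]) (simp add: L(2) vec_eq_iff)
qed

lemma coordinates_derivatives:
  assumes hc: "holomorphic_coordinates_near P \<phi> \<psi> W"
  obtains D D' where "(\<psi> has_derivative D) (at (\<phi> P))" "\<And>c v. D (c *s v) = c *s D v"
    "\<And>v. D (D' v) = v" "\<And>v. D v = 0 \<Longrightarrow> v = 0"
proof -
  have W: "open W" "P \<in> W" "open (\<phi> ` W)" "\<And>z. z \<in> W \<Longrightarrow> \<psi> (\<phi> z) = z"
    "\<And>i. holomorphic_fun_on (\<lambda>z. \<phi> z $ i) W" "\<And>i. holomorphic_fun_on (\<lambda>z. \<psi> z $ i) (\<phi> ` W)"
    using hc unfolding holomorphic_coordinates_near_def by auto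
  have Q: "\<phi> P \<in> \<phi> ` W" using W(2) by simp
  obtain D where D: "(\<psi> has_derivative D) (at (\<phi> P))" "\<And>c v. D (c *s v) = c *s D v"
    using holomorphic_components_derivative[OF W(6) Q] by metis
  obtain D' where D': "(\<phi> has_derivative D') (at P)"
    using holomorphic_components_derivative[OF W(5,2)] by metis
  have "((\<lambda>z. \<psi> (\<phi> z)) has_derivative (\<lambda>v. D (D' v))) (at P)" by (rule has_derivative_compose[OF D' D(1)])
  then have "((\<lambda>z. z) has_derivative (\<lambda>v. D (D' v))) (at P)"
    by (rule has_derivative_transform_within_open[OF _ W(1,2)]) (use W(4) in auto)
  from has_derivative_unique[OF this has_derivative_ident] have 1: "D (D' v) = v" for v by metis
  have "((\<lambda>y. \<phi> (\<psi> y)) has_derivative (\<lambda>v. D' (D v))) (at (\<phi> P))"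
    by (rule has_derivative_compose[OF D(1)]) (use D' W in auto)
  then have "((\<lambda>y. y) has_derivative (\<lambda>v. D' (D v))) (at (\<phi> P))"
    by (rule has_derivative_transform_within_open[OF _ W(3) Q]) (use W(4) in auto)
  from has_derivative_unique[OF this has_derivative_ident] have 2: "D' (D v) = v" for v by metis
  have "D' 0 = 0" using has_derivative_linear[OF D'] by (rule linear_0)
  then have "v = 0" if "D v = 0" for v using 2[of v] that by simp
  then show ?thesis using that D 1 by blast
qed

text \<open>
  The normal of the new coordinates is not mapped to the normal at \<open>P\<close>, but to a direction that
  is still transversal: its product with the gradient of \<open>r\<close> is the length of the gradient of
  \<open>r \<circ> \<psi>\<close>, hence positive.
\<close>
lemma coordinates_transversal:
  assumes hc: "holomorphic_coordinates_near P \<phi> \<psi> W" and U: "smooth_on U r" "open U" "P \<in> U"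
    and a: "gradient r P \<noteq> 0"
  obtains R C where "0 < R" "0 \<le> C"
    "\<And>x \<delta>. x \<in> ball (\<phi> P) R \<Longrightarrow> 0 \<le> \<delta> \<Longrightarrow> \<delta> < R \<Longrightarrow>
      r (\<psi> (x - \<delta> *\<^sub>R outer_normal (r \<circ> \<psi>) (\<phi> P))) \<le> r (\<psi> x) \<and>
      r (\<psi> x) \<le> r (\<psi> (x - \<delta> *\<^sub>R outer_normal (r \<circ> \<psi>) (\<phi> P))) + C * \<delta>"
    "norm (outer_normal (r \<circ> \<psi>) (\<phi> P)) = 1"
proof -
  have W: "open W" "P \<in> W" "open (\<phi> ` W)" "\<And>z. z \<in> W \<Longrightarrow> \<psi> (\<phi> z) = z"
    "\<And>i. holomorphic_fun_on (\<lambda>z. \<psi> z $ i) (\<phi> ` W)"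
    using hc unfolding holomorphic_coordinates_near_def by auto
  let ?q = "\<phi> P" and ?a = "gradient r P"
  have \<psi>q: "\<psi> ?q = P" using W by simp
  have Q: "?q \<in> \<phi> ` W" using W(2) by simp
  obtain D D' where D: "(\<psi> has_derivative D) (at ?q)" "\<And>v. D (D' v) = v"
    using coordinates_derivatives[OF hc] by metis
  have "(r has_derivative (\<lambda>h. h \<bullet> ?a)) (at (\<psi> ?q))"
    unfolding \<psi>q by (rule has_derivative_gradient[OF smooth_on_differentiable[OF U(1,3)]])
  from has_derivative_compose[OF D(1) this]
  have rD: "(r \<circ> \<psi> has_derivative (\<lambda>v. D v \<bullet> ?a)) (at ?q)" by (simp add: o_def)
  define a' where "a' = gradient (r \<circ> \<psi>) ?q"
  have "(r \<circ> \<psi> has_derivative (\<lambda>v. v \<bullet> a')) (at ?q)"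
    unfolding a'_def by (rule has_derivative_gradient) (use rD in \<open>auto simp: differentiable_def\<close>)
  from has_derivative_unique[OF this rD] have eq: "v \<bullet> a' = D v \<bullet> ?a" for v by metis
  have a': "a' \<noteq> 0" using eq[of "D' ?a"] D(2)[of ?a] a by auto
  define \<nu> where "\<nu> = sgn a'"
  have \<nu>: "norm \<nu> = 1" using a' by (simp add: \<nu>_def norm_sgn)
  define g where "g = norm a'"
  have g: "0 < g" using a' by (simp add: g_def)
  have Dg: "D \<nu> \<bullet> ?a = g"
    unfolding eq[symmetric] \<nu>_def g_def using a' by (simp add: sgn_div_norm power2_norm_eq_inner[symmetric] power2_eq_square)
  define d where "d = norm (D \<nu>)"
  have d: "0 \<le> d" by (simp add: d_def)
  define \<epsilon> where "\<epsilon> = g / 4 / (d + 1)"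
  have d1: "d + 1 \<noteq> 0" using d by linarith
  have \<epsilon>0: "0 < \<epsilon>" using g d by (simp add: \<epsilon>_def)
  have "\<epsilon> * (d + 1) = g / 4"
    unfolding \<epsilon>_def by (rule nonzero_divide_eq_eq[OF d1, THEN iffD1, OF refl, symmetric])
  note \<epsilon> = \<epsilon>0 this
  define A where "A = norm ?a + 1"
  have A: "0 < A" "norm ?a \<le> A" by (auto simp: A_def add_nonneg_pos)
  define \<theta> where "\<theta> = min 1 (g / (4 * A))"
  have \<theta>: "0 < \<theta>" "\<theta> \<le> 1" "\<theta> * A \<le> g / 4"
  proof -
    show "0 < \<theta>" "\<theta> \<le> 1" using g A by (auto simp: \<theta>_def)
    have "\<theta> \<le> g / (4 * A)" by (simp add: \<theta>_def)
    then have "\<theta> * A \<le> g / (4 * A) * A" using A by (intro mult_right_mono) auto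
    then show "\<theta> * A \<le> g / 4" using A by simp
  qed
  obtain \<eta> where \<eta>: "0 < \<eta>" "ball P \<eta> \<subseteq> U"
    "\<And>x y. x \<in> ball P \<eta> \<Longrightarrow> y \<in> ball P \<eta> \<Longrightarrow> \<bar>r x - r y - (x - y) \<bullet> ?a\<bar> \<le> \<epsilon> * norm (x - y)"
    using strictly_differentiable[OF U \<epsilon>(1)] by blast
  obtain R1 where R1: "0 < R1" "ball ?q (2 * R1) \<subseteq> \<phi> ` W"
    "\<And>x \<delta>. x \<in> ball ?q R1 \<Longrightarrow> 0 \<le> \<delta> \<Longrightarrow> \<delta> < R1 \<Longrightarrow>
      norm ((\<psi> (x - \<delta> *\<^sub>R \<nu>) - \<psi> x) - (\<psi> (?q - \<delta> *\<^sub>R \<nu>) - \<psi> ?q)) \<le> \<theta> / 2 * \<delta>"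
    using holomorphic_increment[OF W(5) W(3) Q \<nu>, of "\<theta> / 2"] \<theta>(1) by auto
  have "isCont \<psi> ?q" using D(1) by (rule has_derivative_continuous)
  then obtain R2 where R2: "0 < R2" "\<And>x. dist x ?q < R2 \<Longrightarrow> dist (\<psi> x) P < \<eta>"
    using \<eta>(1) unfolding continuous_at_eps_delta \<psi>q by (elim allE[of _ \<eta>]) auto
  obtain R3 where R3: "0 < R3" "\<And>y. norm (y - ?q) < R3 \<Longrightarrow> norm (\<psi> y - \<psi> ?q - D (y - ?q)) \<le> \<theta> / 2 * norm (y - ?q)"
    using D(1) \<theta>(1) unfolding has_derivative_at_alt by (elim conjE allE[of _ "\<theta>/2"]) auto
  define R where "R = min R1 (min (R2 / 2) R3)"
  have R: "0 < R" "R \<le> R1" "2 * R \<le> R2" "R \<le> R3" using R1(1) R2(1) R3(1) by (auto simp: R_def)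
  have linD: "linear D" using D(1) by (rule has_derivative_linear)
  have main: "r (\<psi> (x - \<delta> *\<^sub>R \<nu>)) \<le> r (\<psi> x) \<and> r (\<psi> x) \<le> r (\<psi> (x - \<delta> *\<^sub>R \<nu>)) + (A + \<epsilon>) * (d + 1) * \<delta>"
    if x: "x \<in> ball ?q R" and \<delta>: "0 \<le> \<delta>" "\<delta> < R" for x \<delta>
  proof -
    define \<Delta> where "\<Delta> = \<psi> (x - \<delta> *\<^sub>R \<nu>) - \<psi> x"
    have n\<delta>: "norm (\<delta> *\<^sub>R \<nu>) = \<delta>" using \<delta> \<nu> by simp
    have 1: "norm (\<Delta> - (\<psi> (?q - \<delta> *\<^sub>R \<nu>) - \<psi> ?q)) \<le> \<theta> / 2 * \<delta>"
      unfolding \<Delta>_def by (rule R1(3)) (use x \<delta> R in auto)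
    have "norm (\<psi> (?q - \<delta> *\<^sub>R \<nu>) - \<psi> ?q - D (?q - \<delta> *\<^sub>R \<nu> - ?q)) \<le> \<theta> / 2 * norm (?q - \<delta> *\<^sub>R \<nu> - ?q)"
      by (rule R3(2)) (use \<nu> \<delta> R in simp)
    then have 2: "norm (\<psi> (?q - \<delta> *\<^sub>R \<nu>) - \<psi> ?q + \<delta> *\<^sub>R D \<nu>) \<le> \<theta> / 2 * \<delta>"
      using n\<delta> by (simp add: linear_neg[OF linD] linear_scale[OF linD])
    define E where "E = \<Delta> + \<delta> *\<^sub>R D \<nu>"
    have "E = (\<Delta> - (\<psi> (?q - \<delta> *\<^sub>R \<nu>) - \<psi> ?q)) + (\<psi> (?q - \<delta> *\<^sub>R \<nu>) - \<psi> ?q + \<delta> *\<^sub>R D \<nu>)" by (simp add: E_def)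
    then have "norm E \<le> \<theta> / 2 * \<delta> + \<theta> / 2 * \<delta>" using 1 2 norm_triangle_le add_mono by metis
    then have E: "norm E \<le> \<theta> * \<delta>" by (simp add: mult.commute)
    have \<Delta>E: "\<Delta> = E - \<delta> *\<^sub>R D \<nu>" by (simp add: E_def)
    have "norm \<Delta> \<le> \<theta> * \<delta> + \<delta> * d"
      unfolding \<Delta>E using E \<delta>(1) by (intro order_trans[OF norm_triangle_ineq4] add_mono) (auto simp: d_def)
    also have "\<dots> \<le> 1 * \<delta> + \<delta> * d" using \<theta>(2) \<delta>(1) by (intro add_right_mono mult_right_mono) auto
    finally have n\<Delta>: "norm \<Delta> \<le> (d + 1) * \<delta>" by (simp add: algebra_simps)
    have "dist ?q (x - \<delta> *\<^sub>R \<nu>) \<le> dist ?q x + dist x (x - \<delta> *\<^sub>R \<nu>)" by (rule dist_triangle)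
    also have "dist x (x - \<delta> *\<^sub>R \<nu>) = \<delta>" using n\<delta> by (simp add: dist_norm)
    finally have "dist (x - \<delta> *\<^sub>R \<nu>) ?q < R2" using x \<delta>(2) R(3) by (simp add: dist_commute)
    moreover have "dist x ?q < R2" using x R(1,3) by (simp add: dist_commute)
    ultimately have inB: "\<psi> (x - \<delta> *\<^sub>R \<nu>) \<in> ball P \<eta>" "\<psi> x \<in> ball P \<eta>"
      using R2(2) by (auto simp: dist_commute)
    have s: "\<bar>r (\<psi> (x - \<delta> *\<^sub>R \<nu>)) - r (\<psi> x) - \<Delta> \<bullet> ?a\<bar> \<le> \<epsilon> * norm \<Delta>"
      using \<eta>(3)[OF inB] by (simp add: \<Delta>_def)
    have \<epsilon>\<Delta>: "\<epsilon> * norm \<Delta> \<le> g / 4 * \<delta>"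
    proof -
      have "\<epsilon> * norm \<Delta> \<le> \<epsilon> * ((d + 1) * \<delta>)" using n\<Delta> \<epsilon>(1) by (intro mult_left_mono) auto
      then show ?thesis unfolding mult.assoc[symmetric] \<epsilon>(2) .
    qed
    have "\<bar>E \<bullet> ?a\<bar> \<le> norm E * norm ?a" by (rule Cauchy_Schwarz_ineq2)
    also have "\<dots> \<le> (\<theta> * \<delta>) * A" using E A \<theta>(1) \<delta>(1) by (intro mult_mono) auto
    also have "\<dots> = (\<theta> * A) * \<delta>" by (simp only: mult_ac)
    also have "\<dots> \<le> g / 4 * \<delta>" using \<theta>(3) \<delta>(1) by (rule mult_right_mono)
    finally have "\<bar>E \<bullet> ?a\<bar> \<le> g / 4 * \<delta>" .
    moreover have "\<Delta> \<bullet> ?a = E \<bullet> ?a - \<delta> * g" by (simp add: \<Delta>E inner_diff_left Dg)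
    ultimately have "r (\<psi> (x - \<delta> *\<^sub>R \<nu>)) - r (\<psi> x) \<le> - (g / 2 * \<delta>)" using s \<epsilon>\<Delta> by (simp add: algebra_simps)
    moreover have "0 \<le> g / 2 * \<delta>" using g \<delta>(1) by simp
    ultimately have up: "r (\<psi> (x - \<delta> *\<^sub>R \<nu>)) \<le> r (\<psi> x)" by linarith
    have "\<bar>\<Delta> \<bullet> ?a\<bar> \<le> norm \<Delta> * norm ?a" by (rule Cauchy_Schwarz_ineq2)
    also have "\<dots> \<le> norm \<Delta> * A" using A by (intro mult_left_mono) auto
    finally have "r (\<psi> x) - r (\<psi> (x - \<delta> *\<^sub>R \<nu>)) \<le> (A + \<epsilon>) * norm \<Delta>" using s by (simp add: algebra_simps)
    also have "\<dots> \<le> (A + \<epsilon>) * ((d + 1) * \<delta>)" using n\<Delta> A(1) \<epsilon>(1) by (intro mult_left_mono) auto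
    finally show ?thesis using up by (simp add: mult.assoc)
  qed
  show ?thesis
  proof (rule that[of R "(A + \<epsilon>) * (d + 1)"])
    show "0 \<le> (A + \<epsilon>) * (d + 1)" using A \<epsilon> d by (intro mult_nonneg_nonneg) auto
    show "norm (outer_normal (r \<circ> \<psi>) (\<phi> P)) = 1" using \<nu> unfolding \<nu>_def a'_def outer_normal_def .
  qed (use R main in \<open>auto simp: outer_normal_def \<nu>_def a'_def\<close>)
qed

section \<open>Uniform bounds for the complex lines through a boundary point\<close>

lemma S_fun_upper:
  assumes "continuous_on (cball 0 t) (\<lambda>\<zeta>. r (P + \<zeta> *s v))" "norm \<zeta> \<le> t"
  shows "r (P + \<zeta> *s v) \<le> S_fun r P v t"
proof -
  have "compact ((\<lambda>\<zeta>. r (P + \<zeta> *s v)) ` cball 0 t)"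
    by (intro compact_continuous_image assms compact_cball)
  then have "bdd_above ((\<lambda>\<zeta>. r (P + \<zeta> *s v)) ` cball 0 t)" by (simp add: bounded_imp_bdd_above compact_imp_bounded)
  then show ?thesis unfolding S_fun_def by (rule cSUP_upper[rotated]) (use assms in auto)
qed

lemma S_fun_least:
  assumes "0 \<le> t" "\<And>\<zeta>. norm \<zeta> \<le> t \<Longrightarrow> r (P + \<zeta> *s v) \<le> M"
  shows "S_fun r P v t \<le> M"
  unfolding S_fun_def by (rule cSUP_least) (use assms in auto)

text \<open>
  A regular curve has order of vanishing \<open>1\<close>, so that the quotient in the definition of the type
  is the order of contact itself.
\<close>
lemma regular_type_ge:
  assumes F: "regular_curve_at P F"
  shows "ereal_of_enat (vanishing_order (r \<circ> F)) \<le> regular_type r P"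
proof -
  have ge: "1 \<le> vanishing_order (\<lambda>\<zeta>. F \<zeta> $ i)" for i
    unfolding vanishing_order_def one_enat_def by (rule Sup_upper) auto
  obtain e i where e: "0 < e" "\<And>i. (\<lambda>\<zeta>. F \<zeta> $ i) holomorphic_on ball 0 e" and i: "deriv (\<lambda>\<zeta>. F \<zeta> $ i) 0 \<noteq> 0"
    using F unfolding regular_curve_at_def by blast
  have le: "vanishing_order (\<lambda>\<zeta>. F \<zeta> $ i) \<le> 1"
    unfolding vanishing_order_def
  proof (rule Sup_least)
    fix x assume "x \<in> {enat k |k. \<forall>vs. length vs < k \<longrightarrow> dir_derivs vs (\<lambda>\<zeta>. F \<zeta> $ i - F 0 $ i) 0 = 0}"
    then obtain k where k: "x = enat k" "\<And>vs. length vs < k \<Longrightarrow> dir_derivs vs (\<lambda>\<zeta>. F \<zeta> $ i - F 0 $ i) 0 = 0" by blast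
    have "((\<lambda>\<zeta>. F \<zeta> $ i) has_field_derivative deriv (\<lambda>\<zeta>. F \<zeta> $ i) 0) (at 0)"
      by (rule holomorphic_derivI[OF e(2) open_ball]) (use e(1) in simp)
    then have "((\<lambda>\<zeta>. F \<zeta> $ i - F 0 $ i) has_field_derivative deriv (\<lambda>\<zeta>. F \<zeta> $ i) 0) (at 0)"
      by (auto intro!: derivative_eq_intros)
    then have "((\<lambda>\<zeta>. F \<zeta> $ i - F 0 $ i) has_derivative (*) (deriv (\<lambda>\<zeta>. F \<zeta> $ i) 0)) (at 0)"
      by (simp add: has_field_derivative_def)
    from frechet_derivative_at[OF this]
    have "dir_derivs [1] (\<lambda>\<zeta>. F \<zeta> $ i - F 0 $ i) 0 = deriv (\<lambda>\<zeta>. F \<zeta> $ i) 0" by (simp flip: \<open>_ = frechet_derivative _ _\<close>)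
    then have "\<not> 1 < k" using k(2)[of "[1]"] i by auto
    then show "x \<le> 1" using k(1) by (simp add: one_enat_def)
  qed
  have "vanishing_order_vec F = 1"
  proof (rule antisym)
    show "vanishing_order_vec F \<le> 1" unfolding vanishing_order_vec_def by (rule INF_lower2[where i = i]) (use le in simp_all)
    show "1 \<le> vanishing_order_vec F" unfolding vanishing_order_vec_def by (rule INF_greatest) (rule ge)
  qed
  then have "ereal_of_enat (vanishing_order (r \<circ> F)) = ereal_of_enat (vanishing_order (r \<circ> F)) / ereal_of_enat (vanishing_order_vec F)"
    by (simp add: one_enat_def one_ereal_def[symmetric])
  also have "\<dots> \<le> regular_type r P" unfolding regular_type_def by (rule SUP_upper) (use F in simp)
  finally show ?thesis .
qed

lemma bdd_derivs_curve_family: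
  fixes F :: "'v \<Rightarrow> complex \<Rightarrow> complex^'n"
  assumes F: "\<And>v i. v \<in> X \<Longrightarrow> (\<lambda>\<zeta>. F v \<zeta> $ i) holomorphic_on ball 0 R'" and R: "R < R'"
    and C: "compact C" "C \<subseteq> U" "open U" "\<And>v \<zeta>. v \<in> X \<Longrightarrow> norm \<zeta> < R' \<Longrightarrow> F v \<zeta> \<in> C"
    and r: "smooth_on U r"
  shows "bdd_derivs k (ball 0 R) ((\<lambda>v \<zeta>. r (F v \<zeta>)) ` X)"
proof -
  have "bdd_derivs k (ball 0 R) ((\<lambda>G \<zeta>. r (G \<zeta>)) ` (F ` X))"
  proof (rule bdd_derivs_compose[OF open_ball C(1-3)])
    show "G \<zeta> \<in> C" if "G \<in> F ` X" "\<zeta> \<in> ball 0 R" for G \<zeta> using that C(4) R by force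
    fix b :: "complex^'n" and k
    let ?h = "\<lambda>v \<zeta>. \<Sum>i\<in>UNIV. cnj (b $ i) * F v \<zeta> $ i"
    obtain B where B: "\<And>x. x \<in> C \<Longrightarrow> norm x \<le> B" using compact_imp_bounded[OF C(1)] unfolding bounded_iff by blast
    have "bdd_derivs k (ball 0 R) ((\<lambda>h \<zeta>. Re (h \<zeta>)) ` (?h ` X))"
    proof (rule bdd_derivs_Re_holomorphic[OF R])
      show "h holomorphic_on ball 0 R'" if "h \<in> ?h ` X" for h
        using that F by (auto intro!: holomorphic_intros)
      fix h and \<zeta> :: complex assume "h \<in> ?h ` X" "\<zeta> \<in> ball 0 R'"
      then obtain v where v: "v \<in> X" "h = ?h v" "F v \<zeta> \<in> C" using C(4) by auto
      have "norm (h \<zeta>) \<le> (\<Sum>i\<in>(UNIV::'n set). norm b * B)"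
        unfolding v(2)
      proof (rule sum_norm_le)
        fix i
        have "norm (b $ i) \<le> norm b" "norm (F v \<zeta> $ i) \<le> B"
          using Finite_Cartesian_Product.norm_nth_le[of b i] Finite_Cartesian_Product.norm_nth_le[of "F v \<zeta>" i] B[OF v(3)] by auto
        then show "norm (cnj (b $ i) * F v \<zeta> $ i) \<le> norm b * B" unfolding norm_mult complex_mod_cnj by (intro mult_mono) auto
      qed
      then show "norm (h \<zeta>) \<le> real CARD('n) * (norm b * B)" by simp
    qed
    moreover have "Re (?h v \<zeta>) = F v \<zeta> \<bullet> b" for v \<zeta>
      using inner_vec_Re[of b "F v \<zeta>"] inner_commute[of b "F v \<zeta>"] by linarith
    then have "(\<lambda>h \<zeta>. Re (h \<zeta>)) ` (?h ` X) = (\<lambda>G \<zeta>. G \<zeta> \<bullet> b) ` (F ` X)"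
      by (simp only: image_image)
    ultimately show "bdd_derivs k (ball 0 R) ((\<lambda>G \<zeta>. G \<zeta> \<bullet> b) ` (F ` X))" by simp
  qed (rule r)
  then show ?thesis by (simp add: image_image)
qed

text \<open>
  Everything that the final argument needs to know about the coordinates. The factor in the growth
  estimate for \<open>S\<close> depends on \<open>K\<close> only; all quantities that depend on the coordinates (\<open>\<eta>\<close>, \<open>R\<close>, \<open>c\<close>, \<open>t0\<close>
  and \<open>Cd\<close>) will only restrict the size of \<open>\<delta>\<close>.
\<close>
lemma disc_family_bounds:
  fixes \<Omega> U W :: "(complex^'n) set" and r :: "complex^'n \<Rightarrow> real"
  assumes \<Omega>: "open \<Omega>" "pseudoconvex \<Omega>" and Q: "Q \<in> frontier \<Omega>"
    and def: "defining_function_near \<Omega> Q r U"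
    and hc: "holomorphic_coordinates_near Q \<phi> \<psi> W" and K: "1 \<le> K"
    and type: "\<And>F. regular_curve_at Q F \<Longrightarrow> vanishing_order (r \<circ> F) \<le> enat K"
  obtains \<eta> R c t0 Cd where "0 < \<eta>" "\<eta> \<le> 1" "ball Q \<eta> \<subseteq> U" "nearly_linear_on (ball Q \<eta>) r (gradient r Q) (1/16)"
    "0 < R" "\<And>y. y \<in> ball (\<phi> Q) (3 * R) \<Longrightarrow> y \<in> \<phi> ` W \<and> \<psi> y \<in> ball Q (\<eta> / 16)"
    "0 < c" "0 < t0" "t0 < R" "0 \<le> Cd" "norm (outer_normal (r \<circ> \<psi>) (\<phi> Q)) = 1"
    "\<And>x \<delta>. x \<in> ball (\<phi> Q) (2 * R) \<Longrightarrow> 0 \<le> \<delta> \<Longrightarrow> \<delta> < R \<Longrightarrow>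
      r (\<psi> (x - \<delta> *\<^sub>R outer_normal (r \<circ> \<psi>) (\<phi> Q))) \<le> r (\<psi> x) \<and>
      r (\<psi> x) \<le> r (\<psi> (x - \<delta> *\<^sub>R outer_normal (r \<circ> \<psi>) (\<phi> Q))) + Cd * \<delta>"
    "\<And>v t. norm v = 1 \<Longrightarrow> 0 < t \<Longrightarrow> t \<le> t0 \<Longrightarrow> c * t ^ K \<le> S_fun (r \<circ> \<psi>) (\<phi> Q) v t"
    "\<And>v t T. norm v = 1 \<Longrightarrow> 0 < t \<Longrightarrow> t \<le> T \<Longrightarrow> T \<le> t0 \<Longrightarrow>
      S_fun (r \<circ> \<psi>) (\<phi> Q) v T \<le> growth_const K / positivity_const (lipschitz_const K) * (T / t) ^ K * S_fun (r \<circ> \<psi>) (\<phi> Q) v t"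
    "\<And>v t \<zeta>. norm v = 1 \<Longrightarrow> t \<le> t0 \<Longrightarrow> norm \<zeta> \<le> t \<Longrightarrow> r (\<psi> (\<phi> Q + \<zeta> *s v)) \<le> S_fun (r \<circ> \<psi>) (\<phi> Q) v t"
    "\<And>v t. norm v = 1 \<Longrightarrow> 0 < t \<Longrightarrow> t \<le> t0 \<Longrightarrow> S_fun (r \<circ> \<psi>) (\<phi> Q) v t \<le> norm (gradient r Q) * (\<eta> / 8)"
proof -
  let ?q = "\<phi> Q" and ?a = "gradient r Q" and ?\<nu> = "outer_normal (r \<circ> \<psi>) (\<phi> Q)"
  have W: "open W" "Q \<in> W" "open (\<phi> ` W)" "\<And>z. z \<in> W \<Longrightarrow> \<psi> (\<phi> z) = z"
    "\<And>i. holomorphic_fun_on (\<lambda>z. \<psi> z $ i) (\<phi> ` W)"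
    using hc unfolding holomorphic_coordinates_near_def by auto
  have U: "open U" "Q \<in> U" "smooth_on U r" and a: "?a \<noteq> 0" and rQ: "r Q = 0"
    using def Q unfolding defining_function_near_def by auto
  have \<psi>q: "\<psi> ?q = Q" using W by simp
  have qW: "?q \<in> \<phi> ` W" using W(2) by simp
  define g where "g = norm ?a"
  have g: "0 < g" using a by (simp add: g_def)
  define e where "e = positivity_const (lipschitz_const K)"
  have L2: "1 \<le> (lipschitz_const K)\<^sup>2" using lipschitz_const_ge_1[of K] by simp
  have e: "0 < e" "e \<le> 1/16" using L2 by (auto simp: e_def positivity_const_def divide_simps)
  obtain \<eta>0 where \<eta>0: "0 < \<eta>0" "ball Q \<eta>0 \<subseteq> U"
    "\<And>x y. x \<in> ball Q \<eta>0 \<Longrightarrow> y \<in> ball Q \<eta>0 \<Longrightarrow> \<bar>r x - r y - (x - y) \<bullet> ?a\<bar> \<le> (e * g) * norm (x - y)"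
    using strictly_differentiable[OF U(3,1,2), of "e * g"] e g by (metis mult_pos_pos)
  define \<eta> where "\<eta> = min \<eta>0 1"
  have \<eta>: "0 < \<eta>" "\<eta> \<le> 1" "\<eta> \<le> \<eta>0" using \<eta>0(1) by (auto simp: \<eta>_def)
  have sub: "ball Q \<eta> \<subseteq> ball Q \<eta>0" using \<eta>(3) by (rule subset_ball)
  have \<eta>U: "ball Q \<eta> \<subseteq> U" using sub \<eta>0(2) by blast
  have nl: "nearly_linear_on (ball Q \<eta>) r ?a e"
    unfolding nearly_linear_on_def g_def[symmetric] using \<eta>0(3) sub by blast
  have nl16: "nearly_linear_on (ball Q \<eta>) r ?a (1/16)"
    unfolding nearly_linear_on_def
  proof (intro ballI)
    fix x y assume "x \<in> ball Q \<eta>" "y \<in> ball Q \<eta>"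
    then have "\<bar>r x - r y - (x - y) \<bullet> ?a\<bar> \<le> e * norm ?a * norm (x - y)"
      using nl unfolding nearly_linear_on_def by blast
    also have "\<dots> \<le> 1/16 * norm ?a * norm (x - y)" using e by (intro mult_right_mono) auto
    finally show "\<bar>r x - r y - (x - y) \<bullet> ?a\<bar> \<le> 1/16 * norm ?a * norm (x - y)" .
  qed
  obtain R1 Cd where R1: "0 < R1" "0 \<le> Cd" "norm ?\<nu> = 1"
    "\<And>x \<delta>. x \<in> ball ?q R1 \<Longrightarrow> 0 \<le> \<delta> \<Longrightarrow> \<delta> < R1 \<Longrightarrow>
      r (\<psi> (x - \<delta> *\<^sub>R ?\<nu>)) \<le> r (\<psi> x) \<and> r (\<psi> x) \<le> r (\<psi> (x - \<delta> *\<^sub>R ?\<nu>)) + Cd * \<delta>"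
    using coordinates_transversal[OF hc U(3,1,2) a] by metis
  have contV: "continuous_on (\<phi> ` W) \<psi>" by (rule holomorphic_components_continuous[OF W(5)])
  have "isCont \<psi> ?q" using contV W(3) qW continuous_on_eq_continuous_at by blast
  then obtain R2 where R2: "0 < R2" "\<And>x. dist x ?q < R2 \<Longrightarrow> dist (\<psi> x) Q < \<eta> / 16"
    using \<eta>(1) unfolding continuous_at_eps_delta \<psi>q by (elim allE[of _ "\<eta> / 16"]) auto
  obtain R3 where R3: "0 < R3" "ball ?q R3 \<subseteq> \<phi> ` W" using W(3) qW open_contains_ball by metis
  define R where "R = min R1 (min R2 R3) / 3"
  have R: "0 < R" "3 * R \<le> R1" "3 * R \<le> R2" "3 * R \<le> R3" using R1(1) R2(1) R3(1) by (auto simp: R_def)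
  have near: "y \<in> \<phi> ` W \<and> \<psi> y \<in> ball Q (\<eta> / 16)" if "y \<in> ball ?q (3 * R)" for y
    using that R R2(2)[of y] R3(2) by (auto simp: dist_commute subset_eq)
  define F where "F = (\<lambda>v \<zeta>. \<psi> (?q + \<zeta> *s v))"
  define G where "G = (\<lambda>v \<zeta>. r (F v \<zeta>))"
  define X where "X = {v :: complex^'n. norm v = 1}"
  have inq: "?q + \<zeta> *s v \<in> ball ?q (3 * R)" if "v \<in> X" "norm \<zeta> < 2 * R" for v \<zeta>
    using that R(1) by (simp add: X_def dist_norm norm_smult)
  have hol: "(\<lambda>\<zeta>. F v \<zeta> $ i) holomorphic_on ball 0 (2 * R)" if "v \<in> X" for v i
    unfolding F_def by (rule holomorphic_on_line[OF W(5) open_ball]) (use near[OF inq[OF that]] in auto)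
  have FB: "F v \<zeta> \<in> ball Q (\<eta> / 16)" if "v \<in> X" "norm \<zeta> < 2 * R" for v \<zeta>
    unfolding F_def using near[OF inq[OF that]] by blast
  have F0: "F v 0 = Q" for v by (simp add: F_def \<psi>q)
  have G0: "G v 0 = 0" for v by (simp add: G_def F0 rQ)
  have cU: "cball Q (\<eta> / 16) \<subseteq> U" using \<eta>U \<eta>(1) by (intro order_trans[OF _ \<eta>U]) auto
  have bd: "bdd_derivs k (ball 0 R) (G ` X)" for k
    unfolding G_def
    by (rule bdd_derivs_curve_family[OF hol _ compact_cball cU U(1) _ U(3)]) (use R(1) FB in \<open>auto simp: less_imp_le\<close>)
  obtain B where B: "0 \<le> B" "\<And>v. v \<in> X \<Longrightarrow> derivs_le (Suc K) B (ball 0 R) (G v)"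
    using bdd_derivs_imp_derivs_le[OF bd] by blast
  \<comment> \<open>otherwise the regular curve \<open>F v\<close> would have order of contact greater than \<open>K\<close>\<close>
  have nv: "\<exists>\<zeta>. norm \<zeta> < R \<and> \<not> \<bar>G v \<zeta>\<bar> \<le> A * norm \<zeta> ^ Suc K" if v: "v \<in> X" for v A
  proof (rule ccontr)
    assume "\<not> ?thesis"
    then have small: "\<bar>G v \<zeta>\<bar> \<le> A * norm \<zeta> ^ Suc K" if "norm \<zeta> < R" for \<zeta> using that by blast
    have "bdd_derivs k (ball 0 R) {G v}" for k by (rule bdd_derivs_subset[OF open_ball bd]) (use v in simp)
    from vanishing_order_ge[OF this R(1) small] have ge: "enat (Suc K) \<le> vanishing_order (r \<circ> F v)"
      by (simp add: G_def o_def)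
    obtain D where D: "(\<psi> has_derivative D) (at ?q)" "\<And>c v. D (c *s v) = c *s D v" "\<And>v. D v = 0 \<Longrightarrow> v = 0"
      using coordinates_derivatives[OF hc] by metis
    have "((\<lambda>\<zeta>. ?q + \<zeta> *s v) has_derivative (\<lambda>\<zeta>. \<zeta> *s v)) (at 0)"
    proof -
      have "bounded_linear (\<lambda>c::complex. c *s v)" using linear_smult_left linear_conv_bounded_linear by blast
      from bounded_linear.has_derivative[OF this has_derivative_ident] have "((\<lambda>\<zeta>. \<zeta> *s v) has_derivative (\<lambda>\<zeta>. \<zeta> *s v)) (at 0)" .
      from has_derivative_add[OF has_derivative_const this] show ?thesis by simp
    qed
    from has_derivative_compose[OF this, of \<psi> D] D(1)
    have "(F v has_derivative (\<lambda>\<zeta>. \<zeta> *s D v)) (at 0)" by (simp add: F_def D(2))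
    moreover have "(F v has_derivative (\<lambda>y. y *s (\<chi> i. deriv (\<lambda>\<zeta>. F v \<zeta> $ i) 0))) (at 0)"
      by (rule curve_has_derivative[OF hol[OF v] open_ball]) (use R(1) in simp)
    ultimately have "1 *s D v = 1 *s (\<chi> i. deriv (\<lambda>\<zeta>. F v \<zeta> $ i) 0)" by (metis has_derivative_unique)
    then have "D v = (\<chi> i. deriv (\<lambda>\<zeta>. F v \<zeta> $ i) 0)" by simp
    moreover have "D v \<noteq> 0" using D(3)[of v] v by (auto simp: X_def)
    ultimately obtain i where "deriv (\<lambda>\<zeta>. F v \<zeta> $ i) 0 \<noteq> 0" by (metis (mono_tags, lifting) vec_eq_iff vec_lambda_beta zero_index)
    then have "regular_curve_at Q (F v)"
      unfolding regular_curve_at_def using F0 hol[OF v] R(1) by (metis mult_pos_pos zero_less_numeral)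
    then have "enat (Suc K) \<le> enat K" using type ge order_trans by blast
    then show False by simp
  qed
  have contG: "continuous_on X (\<lambda>v. G v \<zeta>)" if z: "norm \<zeta> < R" for \<zeta>
  proof -
    have lin: "continuous_on X (\<lambda>v. ?q + \<zeta> *s v)"
      unfolding vector_scalar_mult_def by (intro continuous_intros continuous_on_vec_lambda continuous_on_component)
    have 1: "continuous_on X (\<lambda>v. F v \<zeta>)"
      unfolding F_def by (rule continuous_on_compose2[OF contV lin]) (use near inq z R(1) in force)
    have rc: "continuous_on U r"
      using smooth_on_differentiable[OF U(3)] by (intro continuous_at_imp_continuous_on ballI differentiable_imp_continuous_within)
    show ?thesis unfolding G_def
    proof (rule continuous_on_compose2[OF rc 1], intro image_subsetI)
      fix v assume "v \<in> X"
      then have "F v \<zeta> \<in> ball Q (\<eta> / 16)" by (rule FB) (use z R(1) in simp)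
      then show "F v \<zeta> \<in> U" using cU by auto
    qed
  qed
  have "compact X" unfolding X_def using compact_sphere[of "0::complex^'n" 1] by (simp add: sphere_def)
  then obtain c1 t1 where t1: "0 < c1" "0 < t1" "t1 < R"
    "\<And>v t. v \<in> X \<Longrightarrow> 0 < t \<Longrightarrow> t \<le> t1 \<Longrightarrow> c1 * t ^ K \<le> sup_abs (G v) t"
    using uniform_lower_bound[of X R B K G] R(1) B contG nv by metis
  \<comment> \<open>on discs of radius at most \<open>t2\<close> the Taylor remainder is absorbed by the lower bound\<close>
  define t2 where "t2 = min t1 (c1 / (B + 1))"
  have t2: "0 < t2" "t2 < R" "t2 \<le> t1" using t1 B(1) by (auto simp: t2_def)
  have Bt2: "B * t2 \<le> c1"
  proof -
    have "t2 \<le> c1 / (B + 1)" by (simp add: t2_def)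
    then have "(B + 1) * t2 \<le> c1" using B(1) by (simp add: pos_le_divide_eq mult.commute)
    then show ?thesis using t2(1) by (simp add: algebra_simps)
  qed
  have low: "c1 * t ^ K \<le> sup_abs (G v) t" if "v \<in> X" "0 < t" "t \<le> t2" for v t
    using t1(4) that t2(3) by simp
  \<comment> \<open>half of \<open>t2\<close>, since the Lipschitz bound on a disc uses the values on the disc of twice the radius\<close>
  define t0 where "t0 = t2 / 2"
  have t0: "0 < t0" "t0 < R" "2 * t0 = t2" "t0 \<le> t2" using t2 by (auto simp: t0_def)
  have Gc: "continuous_on (cball 0 t) (G v)" if "v \<in> X" "t \<le> t0" for v t
    using derivs_le_continuous_on[OF B(2)[OF that(1)]] that(2) t0(2) by simp
  let ?S = "S_fun (r \<circ> \<psi>) ?q"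
  have Seq: "(r \<circ> \<psi>) (?q + \<zeta> *s v) = G v \<zeta>" for v \<zeta> by (simp add: G_def F_def)
  have GS: "G v \<zeta> \<le> ?S v t" if "v \<in> X" "t \<le> t0" "norm \<zeta> \<le> t" for v t \<zeta>
    unfolding Seq[symmetric] by (rule S_fun_upper) (use Gc[OF that(1,2)] that(3) in \<open>simp_all add: Seq[unfolded o_def]\<close>)
  have Gb: "\<bar>G v \<zeta>\<bar> \<le> g * (\<eta> / 8)" if "v \<in> X" "norm \<zeta> < R" for v \<zeta>
  proof -
    have F: "F v \<zeta> \<in> ball Q (\<eta> / 16)" using FB that R(1) by simp
    then have F1: "F v \<zeta> \<in> ball Q \<eta>" "Q \<in> ball Q \<eta>" using \<eta>(1) by auto
    have "\<bar>G v \<zeta>\<bar> \<le> (1 + e) * norm ?a * norm (F v \<zeta> - Q)"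
      using nearly_linear_onD(3)[OF nl F1] nearly_linear_onD(3)[OF nl F1(2,1)] rQ
      by (simp add: G_def norm_minus_commute abs_le_iff)
    also have "\<dots> \<le> 2 * norm ?a * (\<eta> / 16)"
      using F e by (intro mult_mono) (auto simp: dist_norm norm_minus_commute)
    finally show ?thesis by (simp add: g_def mult.commute)
  qed
  have Sle: "?S v t \<le> sup_abs (G v) t" if "v \<in> X" "0 < t" "t \<le> t0" for v t
  proof (rule S_fun_least)
    fix \<zeta> :: complex assume "norm \<zeta> \<le> t"
    then show "(r \<circ> \<psi>) (?q + \<zeta> *s v) \<le> sup_abs (G v) t"
      unfolding Seq using abs_le_sup_abs[OF Gc[OF that(1,3)]] by force
  qed (use that in simp)
  have Sge: "e * sup_abs (G v) t \<le> ?S v t" if v: "v \<in> X" and t: "0 < t" "t \<le> t0" for v t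
  proof -
    let ?N = "sup_abs (G v) t"
    have N: "0 < ?N"
    proof -
      have "0 < c1 * t ^ K" using t1(1) t by simp
      also have "\<dots> \<le> ?N" using low[OF v t(1)] t t0 by simp
      finally show ?thesis .
    qed
    obtain \<zeta>0 where \<zeta>0: "norm \<zeta>0 \<le> t" "?N = \<bar>G v \<zeta>0\<bar>"
      using sup_abs_attained[OF Gc[OF v t(2)]] t(1) by (metis less_imp_le)
    have "\<exists>\<zeta>. norm \<zeta> \<le> t \<and> e * ?N \<le> r (F v \<zeta>)"
    proof (rule pseudoconvex_sup_bound[OF \<Omega> Q def \<eta>U nl a lipschitz_const_ge_1[of K] e_def hol[OF v] F0 t(1)])
      show "t < 2 * R" using t t0 R(1) by simp
      show "F v \<zeta> \<in> ball Q (\<eta> / 8)" if "norm \<zeta> \<le> t" for \<zeta>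
      proof -
        have "F v \<zeta> \<in> ball Q (\<eta> / 16)" using FB[OF v] that t t0 R(1) by simp
        then show ?thesis using \<eta>(1) by simp
      qed
      show "0 < ?N" by fact
      show "?N \<le> norm ?a * (\<eta> / 8)" using \<zeta>0 Gb[OF v, of \<zeta>0] t t0 by (simp add: g_def)
      show "\<bar>r (F v \<zeta>)\<bar> \<le> ?N" if "norm \<zeta> \<le> t" for \<zeta>
        using abs_le_sup_abs[OF Gc[OF v t(2)] that] by (simp add: G_def)
      show "norm \<zeta>0 \<le> t" "\<bar>r (F v \<zeta>0)\<bar> = ?N" using \<zeta>0 by (auto simp: G_def)
      show "\<bar>r (F v \<zeta>) - r (F v \<xi>)\<bar> \<le> lipschitz_const K * (?N / t) * norm (\<zeta> - \<xi>)" if "norm \<zeta> \<le> t" "norm \<xi> \<le> t" for \<zeta> \<xi>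
        using sup_abs_lipschitz[OF B(2)[OF v] B(1) K low[OF v] Bt2 t2(2) t(1) _ that] t t0 by (simp add: G_def)
    qed
    then obtain \<zeta> where "norm \<zeta> \<le> t" "e * ?N \<le> G v \<zeta>" by (auto simp: G_def)
    then show ?thesis using GS[OF v t(2)] by force
  qed
  show ?thesis
  proof (rule that[of \<eta> R "e * c1" t0 Cd])
    show "0 < e * c1" using e t1(1) by simp
    show "r (\<psi> (x - \<delta> *\<^sub>R ?\<nu>)) \<le> r (\<psi> x) \<and> r (\<psi> x) \<le> r (\<psi> (x - \<delta> *\<^sub>R ?\<nu>)) + Cd * \<delta>"
      if "x \<in> ball ?q (2 * R)" "0 \<le> \<delta>" "\<delta> < R" for x \<delta>
      by (rule R1(4)) (use that R(1,2) in auto)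
    fix v :: "complex^'n" assume "norm v = 1"
    then have v: "v \<in> X" by (simp add: X_def)
    show "e * c1 * t ^ K \<le> ?S v t" if t: "0 < t" "t \<le> t0" for t
    proof -
      have "c1 * t ^ K \<le> sup_abs (G v) t" using low[OF v t(1)] t t0(4) by simp
      then have "e * (c1 * t ^ K) \<le> e * sup_abs (G v) t" using e(1) by (intro mult_left_mono) auto
      then show ?thesis using Sge[OF v t] by (simp add: mult.assoc)
    qed
    show "?S v T \<le> growth_const K / positivity_const (lipschitz_const K) * (T / t) ^ K * ?S v t" if t: "0 < t" "t \<le> T" "T \<le> t0" for t T
    proof -
      have "?S v T \<le> sup_abs (G v) T" using Sle[OF v] t by simp
      also have "\<dots> \<le> growth_const K * (T / t) ^ K * sup_abs (G v) t"
        by (rule sup_abs_growth[OF B(2)[OF v] B(1) low[OF v] Bt2 t2(2) t(1,2)]) (use t t0 in auto)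
      also have "\<dots> \<le> growth_const K * (T / t) ^ K * (?S v t / e)"
      proof (rule mult_left_mono)
        show "sup_abs (G v) t \<le> ?S v t / e" using Sge[OF v t(1)] t e(1) by (simp add: pos_le_divide_eq mult.commute)
        show "0 \<le> growth_const K * (T / t) ^ K" using growth_const_ge_1[of K] t by (intro mult_nonneg_nonneg) auto
      qed
      finally show ?thesis by (simp add: e_def)
    qed
    show "r (\<psi> (?q + \<zeta> *s v)) \<le> ?S v t" if "t \<le> t0" "norm \<zeta> \<le> t" for t \<zeta>
      using GS[OF v that] by (simp add: G_def F_def)
    show "?S v t \<le> norm ?a * (\<eta> / 8)" if t: "0 < t" "t \<le> t0" for t
    proof (rule S_fun_least)
      fix \<zeta> :: complex assume "norm \<zeta> \<le> t"
      then show "(r \<circ> \<psi>) (?q + \<zeta> *s v) \<le> norm ?a * (\<eta> / 8)"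
        unfolding Seq using Gb[OF v, of \<zeta>] t t0 by (simp add: g_def)
    qed (use t in simp)
  qed (use \<eta> \<eta>U nl16 R near t0 R1 in auto)
qed

section \<open>The chain of discs\<close>

text \<open>
  Let \<open>\<Delta> k \<xi>\<close> be the difference of \<open>f\<close> between the points over \<open>\<xi>\<close> and over \<open>0\<close> at depth \<open>u k\<close>. The
  holomorphic function \<open>\<Delta> k - \<Delta> (Suc k)\<close> vanishes at \<open>0\<close>; it is at most \<open>2 * \<Lambda> * u (Suc k) powr \<alpha>\<close> on the
  disc of radius \<open>2 ^ k * t\<close> since only the depth changes, and the Schwarz lemma divides this by
  \<open>2 ^ k\<close> on the circle of radius \<open>t\<close>.
\<close>
lemma dyadic_chain:
  fixes f :: "complex^'n \<Rightarrow> complex" and F :: "complex \<Rightarrow> complex^'n" and u :: "nat \<Rightarrow> real"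
  assumes f: "holomorphic_fun_on f \<Omega>"
    and lip: "\<And>x y. x \<in> \<Omega> \<Longrightarrow> y \<in> \<Omega> \<Longrightarrow> norm (f x - f y) \<le> \<Lambda> * norm (x - y) powr \<alpha>"
    and \<Lambda>: "0 \<le> \<Lambda>" and \<alpha>: "0 < \<alpha>" and \<nu>: "norm \<nu> = 1"
    and F: "\<And>i. (\<lambda>\<zeta>. F \<zeta> $ i) holomorphic_on ball 0 R" and t: "0 < t" "2 ^ n * t < R"
    and u: "0 \<le> u 0" "\<And>k. k < n \<Longrightarrow> u k \<le> u (Suc k)"
    and in\<Omega>: "\<And>k j \<zeta>. k \<le> n \<Longrightarrow> j \<in> {k, Suc k} \<Longrightarrow> j \<le> n \<Longrightarrow> norm \<zeta> \<le> 2 ^ k * t \<Longrightarrow> F \<zeta> - u j *\<^sub>R \<nu> \<in> \<Omega>"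
    and F1: "\<And>\<zeta>. norm \<zeta> \<le> 2 ^ n * t \<Longrightarrow> norm (F \<zeta> - F 0) \<le> 1"
    and \<zeta>: "norm \<zeta> = t" "F \<zeta> \<in> \<Omega>" "F 0 \<in> \<Omega>"
  shows "norm (f (F 0) - f (F \<zeta>)) \<le> 2 * \<Lambda> * u 0 powr \<alpha> + (\<Sum>k<n. 2 * \<Lambda> * u (Suc k) powr \<alpha> / 2 ^ k) + \<Lambda> / 2 ^ n"
proof -
  define \<Delta> where "\<Delta> = (\<lambda>k \<xi>. f (F \<xi> - u k *\<^sub>R \<nu>) - f (F 0 - u k *\<^sub>R \<nu>))"
  have pos: "0 \<le> u k" if "k \<le> n" for k
    using that by (induction k) (use u in \<open>auto intro: order_trans simp: Suc_le_eq\<close>)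
  have tk: "t \<le> 2 ^ k * t" for k using t(1) by simp
  have tkR: "2 ^ k * t < R" if "k \<le> n" for k
  proof -
    have "2 ^ k * t \<le> 2 ^ n * t" using that t(1) by (intro mult_right_mono power_increasing) auto
    then show ?thesis using t(2) by linarith
  qed
  have hol: "\<Delta> j holomorphic_on ball 0 (2 ^ k * t)" if "k \<le> n" "j \<in> {k, Suc k}" "j \<le> n" for k j
  proof -
    have "(\<lambda>\<xi>. f (F \<xi> - u j *\<^sub>R \<nu>)) holomorphic_on ball 0 (2 ^ k * t)"
    proof (rule holomorphic_fun_on_curve[OF f _ open_ball])
      show "(\<lambda>\<xi>. (F \<xi> - u j *\<^sub>R \<nu>) $ i) holomorphic_on ball 0 (2 ^ k * t)" for i
        using holomorphic_on_subset[OF F subset_ball[OF less_imp_le[OF tkR[OF that(1)]]], of i]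
        by (auto intro!: holomorphic_intros)
      show "F \<xi> - u j *\<^sub>R \<nu> \<in> \<Omega>" if "\<xi> \<in> ball 0 (2 ^ k * t)" for \<xi>
        using in\<Omega>[OF \<open>k \<le> n\<close> \<open>j \<in> {k, Suc k}\<close> \<open>j \<le> n\<close>] that by simp
    qed
    then show ?thesis unfolding \<Delta>_def by (intro holomorphic_on_diff holomorphic_on_const)
  qed
  have Schwarz: "norm (E \<zeta>) \<le> M / 2 ^ k"
    if E: "E holomorphic_on ball 0 (2 ^ k * t)" "E 0 = 0" and M: "\<And>\<xi>. norm \<xi> \<le> 2 ^ k * t \<Longrightarrow> norm (E \<xi>) \<le> M" for E M k
  proof (cases k)
    case 0
    then show ?thesis using M[of \<zeta>] \<zeta>(1) by simp
  next
    case (Suc m)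
    have "(1::real) < 2 ^ k" unfolding Suc by (simp add: power_less_power_Suc less_1_mult' one_less_power)
    then have "norm \<zeta> < 2 ^ k * t" using \<zeta>(1) t(1) by simp
    from Schwarz_scaled[OF E _ this, of M] M have "norm (E \<zeta>) \<le> M * (norm \<zeta> / (2 ^ k * t))" by simp
    then show ?thesis using \<zeta>(1) t(1) by simp
  qed
  have step: "norm (\<Delta> k \<zeta> - \<Delta> (Suc k) \<zeta>) \<le> 2 * \<Lambda> * u (Suc k) powr \<alpha> / 2 ^ k" if k: "k < n" for k
  proof (rule Schwarz[where E = "\<lambda>\<xi>. \<Delta> k \<xi> - \<Delta> (Suc k) \<xi>"])
    show "(\<lambda>\<xi>. \<Delta> k \<xi> - \<Delta> (Suc k) \<xi>) holomorphic_on ball 0 (2 ^ k * t)"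
      using hol k by (intro holomorphic_on_diff) auto
    show "\<Delta> k 0 - \<Delta> (Suc k) 0 = 0" by (simp add: \<Delta>_def)
    fix \<xi> :: complex assume x: "norm \<xi> \<le> 2 ^ k * t"
    have one: "norm (f (F \<xi>' - u k *\<^sub>R \<nu>) - f (F \<xi>' - u (Suc k) *\<^sub>R \<nu>)) \<le> \<Lambda> * u (Suc k) powr \<alpha>"
      if "norm \<xi>' \<le> 2 ^ k * t" for \<xi>'
    proof -
      have "norm (f (F \<xi>' - u k *\<^sub>R \<nu>) - f (F \<xi>' - u (Suc k) *\<^sub>R \<nu>))
          \<le> \<Lambda> * norm ((F \<xi>' - u k *\<^sub>R \<nu>) - (F \<xi>' - u (Suc k) *\<^sub>R \<nu>)) powr \<alpha>"
        by (rule lip) (use in\<Omega>[of k] k that in auto)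
      also have "(F \<xi>' - u k *\<^sub>R \<nu>) - (F \<xi>' - u (Suc k) *\<^sub>R \<nu>) = (u (Suc k) - u k) *\<^sub>R \<nu>"
        by (simp add: algebra_simps)
      also have "norm \<dots> = u (Suc k) - u k" using u(2)[OF k] \<nu> by simp
      also have "\<Lambda> * (u (Suc k) - u k) powr \<alpha> \<le> \<Lambda> * u (Suc k) powr \<alpha>"
        using u(2)[OF k] pos[of k] k \<alpha> \<Lambda> by (intro mult_left_mono powr_mono2) auto
      finally show ?thesis .
    qed
    have "\<Delta> k \<xi> - \<Delta> (Suc k) \<xi> = (f (F \<xi> - u k *\<^sub>R \<nu>) - f (F \<xi> - u (Suc k) *\<^sub>R \<nu>))
        - (f (F 0 - u k *\<^sub>R \<nu>) - f (F 0 - u (Suc k) *\<^sub>R \<nu>))" by (simp add: \<Delta>_def)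
    also have "norm \<dots> \<le> \<Lambda> * u (Suc k) powr \<alpha> + \<Lambda> * u (Suc k) powr \<alpha>"
      using t(1) by (intro order_trans[OF norm_triangle_ineq4] add_mono one x) simp
    finally show "norm (\<Delta> k \<xi> - \<Delta> (Suc k) \<xi>) \<le> 2 * \<Lambda> * u (Suc k) powr \<alpha>" by simp
  qed
  have last: "norm (\<Delta> n \<zeta>) \<le> \<Lambda> / 2 ^ n"
  proof (rule Schwarz[OF hol])
    show "\<Delta> n 0 = 0" by (simp add: \<Delta>_def)
    fix \<xi> :: complex assume x: "norm \<xi> \<le> 2 ^ n * t"
    have "norm (\<Delta> n \<xi>) \<le> \<Lambda> * norm ((F \<xi> - u n *\<^sub>R \<nu>) - (F 0 - u n *\<^sub>R \<nu>)) powr \<alpha>"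
      unfolding \<Delta>_def by (rule lip) (use in\<Omega>[of n n] x t(1) in auto)
    also have "\<dots> = \<Lambda> * norm (F \<xi> - F 0) powr \<alpha>" by simp
    also have "\<dots> \<le> \<Lambda> * 1 powr \<alpha>" using F1[OF x] \<Lambda> \<alpha> by (intro mult_left_mono powr_mono2) auto
    finally show "norm (\<Delta> n \<xi>) \<le> \<Lambda>" by simp
  qed auto
  have "\<Delta> 0 \<zeta> = (\<Sum>k<n. \<Delta> k \<zeta> - \<Delta> (Suc k) \<zeta>) + \<Delta> n \<zeta>"
    using sum_lessThan_telescope'[of "\<lambda>k. \<Delta> k \<zeta>" n] by simp
  then have "norm (\<Delta> 0 \<zeta>) \<le> (\<Sum>k<n. 2 * \<Lambda> * u (Suc k) powr \<alpha> / 2 ^ k) + \<Lambda> / 2 ^ n"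
    using step last by (auto intro!: order_trans[OF norm_triangle_ineq] add_mono sum_norm_le)
  moreover have down: "norm (f (F \<xi>) - f (F \<xi> - u 0 *\<^sub>R \<nu>)) \<le> \<Lambda> * u 0 powr \<alpha>" if "F \<xi> \<in> \<Omega>" "norm \<xi> \<le> t" for \<xi>
  proof -
    have "norm (f (F \<xi>) - f (F \<xi> - u 0 *\<^sub>R \<nu>)) \<le> \<Lambda> * norm (F \<xi> - (F \<xi> - u 0 *\<^sub>R \<nu>)) powr \<alpha>"
      by (rule lip) (use in\<Omega>[of 0 0] that in auto)
    then show ?thesis using \<nu> u(1) by simp
  qed
  have "f (F 0) - f (F \<zeta>) = (f (F 0) - f (F 0 - u 0 *\<^sub>R \<nu>)) - (f (F \<zeta>) - f (F \<zeta> - u 0 *\<^sub>R \<nu>)) - \<Delta> 0 \<zeta>"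
    by (simp add: \<Delta>_def)
  then have "norm (f (F 0) - f (F \<zeta>)) \<le> norm (f (F 0) - f (F 0 - u 0 *\<^sub>R \<nu>)) + norm (f (F \<zeta>) - f (F \<zeta> - u 0 *\<^sub>R \<nu>)) + norm (\<Delta> 0 \<zeta>)"
    by (metis (no_types, lifting) norm_triangle_ineq4 add_right_mono order_trans)
  ultimately show ?thesis using down[OF \<zeta>(3)] down[OF \<zeta>(2)] \<zeta>(1) t(1) by simp
qed

lemma geometric_powr_sum:
  fixes K n :: nat and \<alpha> c S0 :: real
  assumes \<alpha>: "0 < \<alpha>" "K * \<alpha> < 1" and c: "0 \<le> c" "0 \<le> S0"
    and u: "\<And>k. k \<le> n \<Longrightarrow> 0 \<le> u k \<and> u k \<le> c * (2 ^ k) ^ K * S0"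
  shows "(\<Sum>k<n. u (Suc k) powr \<alpha> / 2 ^ k) \<le> c powr \<alpha> * (2 powr (K * \<alpha>) / (1 - 2 powr (K * \<alpha> - 1))) * S0 powr \<alpha>"
proof -
  define q where "q = 2 powr (K * \<alpha> - 1 :: real)"
  have q: "0 \<le> q" "q < 1" using \<alpha> powr_less_mono[of "K * \<alpha> - 1" 0 2] by (auto simp: q_def)
  have "u (Suc k) powr \<alpha> / 2 ^ k \<le> c powr \<alpha> * S0 powr \<alpha> * 2 powr (K * \<alpha>) * q ^ k" if k: "k < n" for k
  proof -
    have "u (Suc k) powr \<alpha> \<le> (c * (2 ^ Suc k) ^ K * S0) powr \<alpha>" using u[of "Suc k"] k \<alpha> by (intro powr_mono2) auto
    also have "\<dots> = c powr \<alpha> * S0 powr \<alpha> * ((2 ^ Suc k) ^ K) powr \<alpha>" using c by (simp add: powr_mult mult_ac del: power_Suc)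
    also have "((2 ^ Suc k) ^ K) powr \<alpha> = 2 powr (real (Suc k) * (K * \<alpha>))"
      by (simp add: powr_powr mult_ac flip: powr_realpow power_mult del: power_Suc)
    also have "\<dots> = 2 powr (K * \<alpha>) * (q ^ k * 2 ^ k)"
      by (simp add: q_def powr_powr algebra_simps flip: powr_realpow powr_add)
    finally have "u (Suc k) powr \<alpha> \<le> c powr \<alpha> * S0 powr \<alpha> * 2 powr (K * \<alpha>) * q ^ k * 2 ^ k" by (simp add: mult_ac)
    then show ?thesis by (simp add: pos_divide_le_eq)
  qed
  then have "(\<Sum>k<n. u (Suc k) powr \<alpha> / 2 ^ k) \<le> (\<Sum>k<n. c powr \<alpha> * S0 powr \<alpha> * 2 powr (K * \<alpha>) * q ^ k)"
    by (intro sum_mono) auto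
  also have "\<dots> = c powr \<alpha> * S0 powr \<alpha> * 2 powr (K * \<alpha>) * (\<Sum>k<n. q ^ k)" by (simp add: sum_distrib_left)
  also have "\<dots> \<le> c powr \<alpha> * S0 powr \<alpha> * 2 powr (K * \<alpha>) * (1 / (1 - q))"
  proof (rule mult_left_mono)
    have "(\<Sum>k<n. q ^ k) \<le> (\<Sum>k. q ^ k)" by (rule sum_le_suminf) (use q in \<open>auto simp: summable_geometric\<close>)
    also have "\<dots> = 1 / (1 - q)" using q by (simp add: suminf_geometric)
    finally show "(\<Sum>k<n. q ^ k) \<le> 1 / (1 - q)" .
  qed simp
  finally show ?thesis by (simp add: q_def mult_ac)
qed

section \<open>The tangential estimate\<close>

text \<open>
  The fraction is the value of the geometric series over the chain of discs; the final \<open>1\<close> accounts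
  for the last term of the chain.
\<close>
definition estimate_const :: "nat \<Rightarrow> real \<Rightarrow> real \<Rightarrow> real" where
  "estimate_const K \<alpha> g = 2 * (2 / g * (growth_const K / positivity_const (lipschitz_const K))) powr \<alpha>
     * (1 + 2 powr (K * \<alpha>) / (1 - 2 powr (K * \<alpha> - 1))) + 1"

text \<open>
  Points of the tangential disc are close to its centre, since otherwise \<open>r \<circ> \<psi>\<close> would be at most
  \<open>Cd * \<delta>\<close> on a disc of fixed radius \<open>t3\<close> around the boundary point, against the lower bound for \<open>S\<close>.
  The chain of discs is then continued up to a fixed radius \<open>t0\<close>, where the increment of \<open>f\<close> is
  bounded trivially. The depths \<open>u k\<close> are measured along the normal at \<open>Q\<close> of the original
  coordinates: in this direction the Lipschitz norm of \<open>f\<close> is not distorted by the coordinates.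
\<close>
lemma tangential_estimate_const:
  fixes \<Omega> U :: "(complex^'n) set" and r :: "complex^'n \<Rightarrow> real" and \<alpha> g0 \<Lambda> :: real
  assumes \<Omega>: "open \<Omega>" "pseudoconvex \<Omega>" and Q: "Q \<in> frontier \<Omega>"
    and def: "defining_function_near \<Omega> Q r U"
    and K: "1 \<le> K" "K * \<alpha> < 1" and \<alpha>: "0 < \<alpha>"
    and type: "\<And>F. regular_curve_at Q F \<Longrightarrow> vanishing_order (r \<circ> F) \<le> enat K"
    and g0: "0 < g0" "g0 \<le> norm (gradient r Q)"
    and f: "holomorphic_fun_on f \<Omega>"
    and lip: "\<And>x y. x \<in> \<Omega> \<Longrightarrow> y \<in> \<Omega> \<Longrightarrow> norm (f x - f y) \<le> \<Lambda> * norm (x - y) powr \<alpha>"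
    and \<Lambda>: "0 \<le> \<Lambda>"
  shows "tangential_estimate \<Omega> U r \<alpha> f Q (\<Lambda> * estimate_const K \<alpha> g0)"
  unfolding tangential_estimate_def
proof (intro allI impI)
  fix \<phi> \<psi> W assume hc: "holomorphic_coordinates_near Q \<phi> \<psi> W"
  let ?q = "\<phi> Q" and ?a = "gradient r Q" and ?\<nu> = "outer_normal (r \<circ> \<psi>) (\<phi> Q)"
  let ?S = "S_fun (r \<circ> \<psi>) ?q"
  define e where "e = positivity_const (lipschitz_const K)"
  obtain \<eta> R c t0 Cd where
        \<eta>: "0 < \<eta>" "\<eta> \<le> 1" "ball Q \<eta> \<subseteq> U" "nearly_linear_on (ball Q \<eta>) r ?a (1/16)"
    and R: "0 < R" and near: "\<And>y. y \<in> ball ?q (3 * R) \<Longrightarrow> y \<in> \<phi> ` W \<and> \<psi> y \<in> ball Q (\<eta> / 16)"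
    and c: "0 < c" and t0: "0 < t0" "t0 < R" and Cd: "0 \<le> Cd" and \<nu>: "norm ?\<nu> = 1"
    and trans: "\<And>x \<delta>. x \<in> ball ?q (2 * R) \<Longrightarrow> 0 \<le> \<delta> \<Longrightarrow> \<delta> < R \<Longrightarrow>
      r (\<psi> (x - \<delta> *\<^sub>R ?\<nu>)) \<le> r (\<psi> x) \<and> r (\<psi> x) \<le> r (\<psi> (x - \<delta> *\<^sub>R ?\<nu>)) + Cd * \<delta>"
    and low: "\<And>v t. norm v = 1 \<Longrightarrow> 0 < t \<Longrightarrow> t \<le> t0 \<Longrightarrow> c * t ^ K \<le> ?S v t"
    and growth: "\<And>v t T. norm v = 1 \<Longrightarrow> 0 < t \<Longrightarrow> t \<le> T \<Longrightarrow> T \<le> t0 \<Longrightarrow>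
      ?S v T \<le> growth_const K / e * (T / t) ^ K * ?S v t"
    and upper: "\<And>v t \<zeta>. norm v = 1 \<Longrightarrow> t \<le> t0 \<Longrightarrow> norm \<zeta> \<le> t \<Longrightarrow> r (\<psi> (?q + \<zeta> *s v)) \<le> ?S v t"
    and Sle: "\<And>v t. norm v = 1 \<Longrightarrow> 0 < t \<Longrightarrow> t \<le> t0 \<Longrightarrow> ?S v t \<le> norm ?a * (\<eta> / 8)"
    using disc_family_bounds[OF \<Omega> Q def hc K(1) type] unfolding e_def by blast
  have W: "\<And>z. z \<in> W \<Longrightarrow> \<psi> (\<phi> z) = z" "\<And>i. holomorphic_fun_on (\<lambda>z. \<psi> z $ i) (\<phi> ` W)"
    using hc unfolding holomorphic_coordinates_near_def by auto
  define g where "g = norm ?a"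
  have g: "0 < g" "g0 \<le> g" using g0 by (auto simp: g_def)
  have a: "?a \<noteq> 0" using g by (auto simp: g_def)
  have L2: "1 \<le> (lipschitz_const K)\<^sup>2" using lipschitz_const_ge_1[of K] by simp
  have e: "0 < e" using L2 by (auto simp: e_def positivity_const_def divide_simps)
  \<comment> \<open>below \<open>t3\<close> the last term of the chain is dominated, because \<open>t\<close> is of smaller order than \<open>t powr (K * \<alpha>)\<close>\<close>
  obtain t3 where t3: "0 < t3" "t3 \<le> t0 / 4" "\<And>t. 0 < t \<Longrightarrow> t < t3 \<Longrightarrow> 2 * t / t0 \<le> (c * t ^ K) powr \<alpha>"
  proof -
    define \<gamma> where "\<gamma> = 1 - K * \<alpha>"
    have \<gamma>: "0 < \<gamma>" using K(2) by (simp add: \<gamma>_def)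
    have "((\<lambda>t. 2 / t0 * t powr \<gamma>) \<longlongrightarrow> 2 / t0 * 0) (at_right 0)"
    proof (intro tendsto_intros)
      show "((\<lambda>t. t powr \<gamma>) \<longlongrightarrow> 0) (at_right 0)" using \<gamma> by real_asymp
    qed
    then have "\<forall>\<^sub>F t in at_right 0. 2 / t0 * t powr \<gamma> < c powr \<alpha>" by (rule order_tendstoD) (use c in simp)
    then obtain b where b: "0 < b" "\<And>t. 0 < t \<Longrightarrow> t < b \<Longrightarrow> 2 / t0 * t powr \<gamma> < c powr \<alpha>"
      unfolding eventually_at_right_field by blast
    have "2 * t / t0 \<le> (c * t ^ K) powr \<alpha>" if t: "0 < t" "t < b" for t
    proof -
      have "t = t powr \<gamma> * t powr (K * \<alpha>)" using t by (simp add: \<gamma>_def flip: powr_add)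
      then have "2 * t / t0 = 2 / t0 * t powr \<gamma> * t powr (K * \<alpha>)" by simp
      also have "\<dots> \<le> c powr \<alpha> * t powr (K * \<alpha>)" using b(2)[OF t] by (intro mult_right_mono) auto
      also have "\<dots> = (c * t ^ K) powr \<alpha>" using t c by (simp add: powr_mult powr_powr flip: powr_realpow)
      finally show ?thesis .
    qed
    then show ?thesis using b(1) t0(1) by (intro that[of "min b (t0/4)"]) auto
  qed
  define \<delta>0 where "\<delta>0 = min R (c * t3 ^ K / (Cd + 1))"
  have \<delta>0: "0 < \<delta>0" "\<delta>0 \<le> R" using R c t3(1) Cd by (auto simp: \<delta>0_def)
  have \<delta>0c: "Cd * \<delta> < c * t3 ^ K" if "0 < \<delta>" "\<delta> < \<delta>0" for \<delta>
  proof -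
    have "\<delta> < c * t3 ^ K / (Cd + 1)" using that by (simp add: \<delta>0_def)
    then have "\<delta> * (Cd + 1) < c * t3 ^ K" using Cd by (simp add: pos_less_divide_eq)
    then show ?thesis using that by (simp add: algebra_simps)
  qed
  show "\<exists>\<delta>\<^sub>0>0. \<forall>v\<in>unit_complex_tangents (r \<circ> \<psi>) ?q. \<forall>\<delta>. 0 < \<delta> \<and> \<delta> < \<delta>\<^sub>0 \<longrightarrow>
    (\<forall>w\<in>tangential_disc (\<phi> ` (\<Omega> \<inter> U \<inter> W)) (r \<circ> \<psi>) ?q v \<delta>.
      cmod ((f \<circ> \<psi>) (inner_point (r \<circ> \<psi>) ?q \<delta>) - (f \<circ> \<psi>) w)
        \<le> \<Lambda> * estimate_const K \<alpha> g0 * ?S v (norm (inner_point (r \<circ> \<psi>) ?q \<delta> - w)) powr \<alpha>)"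
  proof (intro exI[of _ \<delta>0] conjI ballI allI impI \<delta>0(1))
    fix v \<delta> w
    assume "v \<in> unit_complex_tangents (r \<circ> \<psi>) ?q" and "0 < \<delta> \<and> \<delta> < \<delta>0"
      and w: "w \<in> tangential_disc (\<phi> ` (\<Omega> \<inter> U \<inter> W)) (r \<circ> \<psi>) ?q v \<delta>"
    then have v: "norm v = 1" and \<delta>: "0 < \<delta>" "\<delta> < \<delta>0" by (auto simp: unit_complex_tangents_def)
    define p where "p = ?q - \<delta> *\<^sub>R ?\<nu>"
    have pd: "inner_point (r \<circ> \<psi>) ?q \<delta> = p" by (simp add: p_def inner_point_def)
    obtain \<zeta> where \<zeta>: "w = p + \<zeta> *s v" "ereal (cmod \<zeta>) < disc_radius (\<phi> ` (\<Omega> \<inter> U \<inter> W)) (r \<circ> \<psi>) ?q v \<delta>"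
      using w unfolding tangential_disc_def pd by blast
    then obtain \<rho> where \<rho>: "cmod \<zeta> < \<rho>" "\<And>\<xi>. cmod \<xi> \<le> \<rho> \<Longrightarrow> p + \<xi> *s v \<in> \<phi> ` (\<Omega> \<inter> U \<inter> W)"
      unfolding disc_radius_def less_Sup_iff pd by auto
    have in\<Omega>: "\<psi> (p + \<xi> *s v) \<in> \<Omega>" "r (\<psi> (p + \<xi> *s v)) < 0" if x: "cmod \<xi> \<le> \<rho>" for \<xi>
    proof -
      obtain y where y: "y \<in> \<Omega> \<inter> U \<inter> W" "p + \<xi> *s v = \<phi> y" using \<rho>(2)[OF x] by blast
      then show "\<psi> (p + \<xi> *s v) \<in> \<Omega>" using W(1) by simp
      have "y \<in> \<Omega> \<inter> U" using y(1) by blast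
      then have "r y < 0" using def unfolding defining_function_near_def by blast
      then show "r (\<psi> (p + \<xi> *s v)) < 0" using y W(1) by simp
    qed
    define t where "t = cmod \<zeta>"
    have shift: "p + \<xi> *s v = (?q + \<xi> *s v) - \<delta> *\<^sub>R ?\<nu>" for \<xi> by (simp add: p_def)
    have qball: "?q + \<xi> *s v \<in> ball ?q (2 * R)" if "cmod \<xi> < 2 * R" for \<xi>
      using that v by (simp add: dist_norm norm_smult)
    have \<delta>R: "\<delta> < R" using \<delta> \<delta>0 by simp
    have tsmall: "t < t3"
    proof (rule ccontr)
      assume "\<not> t < t3"
      have "?S v t3 \<le> Cd * \<delta>"
      proof (rule S_fun_least)
        fix \<xi> :: complex assume x: "cmod \<xi> \<le> t3"
        then have "cmod \<xi> \<le> \<rho>" using \<open>\<not> t < t3\<close> \<rho>(1) by (simp add: t_def)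
        then have "r (\<psi> (p + \<xi> *s v)) < 0" by (rule in\<Omega>)
        moreover have "r (\<psi> (?q + \<xi> *s v)) \<le> r (\<psi> (p + \<xi> *s v)) + Cd * \<delta>"
          unfolding shift using trans[OF qball, of \<xi> \<delta>] x t3 t0 \<delta>(1) \<delta>R by simp
        ultimately show "(r \<circ> \<psi>) (?q + \<xi> *s v) \<le> Cd * \<delta>" by simp
      qed (use t3 in simp)
      moreover have "c * t3 ^ K \<le> ?S v t3" by (rule low[OF v t3(1)]) (use t3 t0 in simp)
      ultimately show False using \<delta>0c[OF \<delta>] by linarith
    qed
    have nw: "norm (p - w) = t" using v by (simp add: \<zeta>(1) t_def norm_smult)
    have p0: "p + 0 *s v = p" by simp
    show "cmod ((f \<circ> \<psi>) (inner_point (r \<circ> \<psi>) ?q \<delta>) - (f \<circ> \<psi>) w)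
        \<le> \<Lambda> * estimate_const K \<alpha> g0 * ?S v (norm (inner_point (r \<circ> \<psi>) ?q \<delta> - w)) powr \<alpha>"
    proof (cases "t = 0")
      case True
      then have "w = p" using \<zeta>(1) by (simp add: t_def)
      moreover have "0 \<le> estimate_const K \<alpha> g0"
      proof -
        have "2 powr (K * \<alpha> - 1) < 1" using K(2) powr_less_mono[of "K * \<alpha> - 1" 0 2] by simp
        then show ?thesis unfolding estimate_const_def by (intro add_nonneg_nonneg mult_nonneg_nonneg divide_nonneg_nonneg) auto
      qed
      ultimately show ?thesis using \<Lambda> unfolding pd by (simp add: mult_nonneg_nonneg)
    next
      case False
      then have t: "0 < t" by (simp add: t_def)
      \<comment> \<open>the last disc of the chain has radius comparable with \<open>t0\<close>\<close>
      obtain n where n: "2 ^ n * t \<le> t0" "t0 < 2 ^ Suc n * t"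
      proof -
        have "\<exists>m. t0 < 2 ^ m * t"
          using reals_power_lt_ex[of "t / t0" 2]
          by (metis t t0(1) real_arch_pow one_less_numeral_iff semiring_norm(76) pos_divide_less_eq)
        then obtain m where m: "t0 < 2 ^ m * t" "\<And>k. k < m \<Longrightarrow> \<not> t0 < 2 ^ k * t"
          using exists_least_iff[of "\<lambda>m. t0 < 2 ^ m * t"] by blast
        have "m \<noteq> 0" using m(1) tsmall t3(2) t0(1) by (intro notI) simp
        then obtain n where "m = Suc n" using not0_implies_Suc by blast
        then show ?thesis using m(1) m(2)[of n] that[of n] by auto
      qed
      have kt: "2 ^ k * t \<le> t0" "t \<le> 2 ^ k * t" if "k \<le> n" for k
      proof -
        have "2 ^ k * t \<le> 2 ^ n * t" using that t by (intro mult_right_mono power_increasing) auto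
        then show "2 ^ k * t \<le> t0" using n(1) by simp
        show "t \<le> 2 ^ k * t" using t by simp
      qed
      define u where "u = (\<lambda>k. 2 / g * ?S v (2 ^ k * t))"
      have Spos: "0 < ?S v s" if "0 < s" "s \<le> t0" for s
      proof -
        have "0 < c * s ^ K" using c that by simp
        then show ?thesis using low[OF v that] by linarith
      qed
      have Smono: "?S v s \<le> ?S v s'" if "0 < s" "s \<le> s'" "s' \<le> t0" for s s'
        by (rule S_fun_least) (use that upper[OF v that(3)] in auto)
      have u_pos: "0 < u k" if "k \<le> n" for k
        unfolding u_def using Spos[OF _ kt(1)[OF that]] t g by simp
      have u_le: "u k \<le> \<eta> / 4" if "k \<le> n" for k
      proof -
        have "?S v (2 ^ k * t) \<le> g * (\<eta> / 8)" using Sle[OF v _ kt(1)[OF that]] t by (simp add: g_def)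
        then have "u k \<le> 2 / g * (g * (\<eta> / 8))" unfolding u_def using g by (intro mult_left_mono) auto
        then show ?thesis using g by simp
      qed
      define F where "F = (\<lambda>\<xi>. \<psi> (p + \<xi> *s v))"
      have pball: "p + \<xi> *s v \<in> ball ?q (3 * R)" if "cmod \<xi> < 2 * R" for \<xi>
      proof -
        have "dist ?q (p + \<xi> *s v) \<le> dist ?q (?q + \<xi> *s v) + dist (?q + \<xi> *s v) (p + \<xi> *s v)" by (rule dist_triangle)
        also have "dist (?q + \<xi> *s v) (p + \<xi> *s v) = \<delta>" using \<nu> \<delta>(1) by (simp add: shift dist_norm)
        finally show ?thesis using qball[OF that] \<delta>R by simp
      qed
      have FB: "F \<xi> \<in> ball Q (\<eta> / 16)" if "cmod \<xi> < 2 * R" for \<xi>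
        unfolding F_def using near[OF pball[OF that]] by blast
      have chain: "norm (f (F 0) - f (F \<zeta>)) \<le> 2 * \<Lambda> * u 0 powr \<alpha> + (\<Sum>k<n. 2 * \<Lambda> * u (Suc k) powr \<alpha> / 2 ^ k) + \<Lambda> / 2 ^ n"
      proof (rule dyadic_chain[OF f lip \<Lambda> \<alpha>, where \<nu> = "sgn ?a" and R = "2 * R" and t = t])
        show "norm (sgn ?a) = 1" using a by (simp add: norm_sgn)
        show "(\<lambda>\<xi>. F \<xi> $ i) holomorphic_on ball 0 (2 * R)" for i
          unfolding F_def by (rule holomorphic_on_line[OF W(2) open_ball]) (use near[OF pball] in auto)
        show "0 < t" by fact
        show "2 ^ n * t < 2 * R" using n(1) t0 R by simp
        show "0 \<le> u 0" using u_pos[of 0] by simp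
        show "u k \<le> u (Suc k)" if "k < n" for k
          unfolding u_def using Smono[of "2 ^ k * t" "2 ^ Suc k * t"] kt(1)[of "Suc k"] that t g
          by (intro mult_left_mono) auto
        show "F \<xi> - u j *\<^sub>R sgn ?a \<in> \<Omega>" if k: "k \<le> n" "j \<in> {k, Suc k}" "j \<le> n" "norm \<xi> \<le> 2 ^ k * t" for k j \<xi>
        proof -
          have x: "cmod \<xi> < 2 * R" using k(4) kt(1)[OF k(1)] t0 R by simp
          have "k \<le> j" using k(2) by auto
          then have "2 ^ k * t \<le> 2 ^ j * t" using t by (intro mult_right_mono power_increasing) auto
          then have xj: "cmod \<xi> \<le> 2 ^ j * t" using k(4) by linarith
          have "r (F \<xi>) \<le> r (\<psi> (?q + \<xi> *s v))"
            unfolding F_def shift using trans[OF qball[OF x], of \<delta>] \<delta>(1) \<delta>R by simp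
          also have "\<dots> \<le> ?S v (2 ^ j * t)" by (rule upper[OF v kt(1)[OF k(3)] xj])
          also have "\<dots> = u j * g / 2" using g by (simp add: u_def)
          finally have 1: "r (F \<xi>) \<le> u j * g / 2" .
          have F1: "F \<xi> \<in> ball Q \<eta>" using FB[OF x] \<eta>(1) by simp
          have "dist Q (F \<xi> - u j *\<^sub>R sgn ?a) \<le> dist Q (F \<xi>) + dist (F \<xi>) (F \<xi> - u j *\<^sub>R sgn ?a)" by (rule dist_triangle)
          also have "dist (F \<xi>) (F \<xi> - u j *\<^sub>R sgn ?a) = u j" using u_pos[OF k(3)] a by (simp add: dist_norm norm_sgn)
          finally have F2: "F \<xi> - u j *\<^sub>R sgn ?a \<in> ball Q \<eta>" using FB[OF x] u_le[OF k(3)] \<eta>(1) by simp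
          have "r (F \<xi> - u j *\<^sub>R sgn ?a) \<le> r (F \<xi>) - u j * norm ?a * (1 - 1/16)"
            by (rule nearly_linear_on_shift(1)[OF \<eta>(4) F1 F2 _ a]) (use u_pos[OF k(3)] in simp)
          moreover have "0 < u j * g" using u_pos[OF k(3)] g by simp
          moreover have "u j * norm ?a * (1 - 1/16) = 15/16 * (u j * g)" by (simp add: g_def)
          moreover have "u j * g / 2 = 1/2 * (u j * g)" by simp
          ultimately have "r (F \<xi> - u j *\<^sub>R sgn ?a) < 0" using 1 by linarith
          moreover have "F \<xi> - u j *\<^sub>R sgn ?a \<in> U" using F2 \<eta>(3) by blast
          ultimately show ?thesis using def unfolding defining_function_near_def by blast
        qed
        show "norm (F \<xi> - F 0) \<le> 1" if "norm \<xi> \<le> 2 ^ n * t" for \<xi>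
        proof -
          have "F \<xi> \<in> ball Q (\<eta> / 16)" "F 0 \<in> ball Q (\<eta> / 16)"
            by (rule FB, use that n(1) t0 R in simp)+
          then have "dist (F \<xi>) (F 0) < \<eta> / 16 + \<eta> / 16"
            using dist_triangle[of "F \<xi>" "F 0" Q] by (simp add: dist_commute)
          then show ?thesis using \<eta>(2) by (simp add: dist_norm)
        qed
        show "norm \<zeta> = t" by (simp add: t_def)
        show "F \<zeta> \<in> \<Omega>" unfolding F_def by (rule in\<Omega>) (use \<rho>(1) in simp)
        show "F 0 \<in> \<Omega>" unfolding F_def by (rule in\<Omega>) (use \<rho>(1) norm_ge_zero[of \<zeta>] in \<open>simp del: norm_ge_zero\<close>)
      qed
      define s where "s = ?S v t"
      have s: "0 < s" unfolding s_def using Spos[OF t] kt(1)[of 0] by simp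
      define cc where "cc = 2 / g0 * (growth_const K / e)"
      have cc: "0 \<le> cc" using g0 growth_const_ge_1[of K] e by (simp add: cc_def)
      have u_bd: "0 \<le> u k \<and> u k \<le> cc * (2 ^ k) ^ K * s" if k: "k \<le> n" for k
      proof
        show "0 \<le> u k" using u_pos[OF k] by simp
        have "?S v (2 ^ k * t) \<le> growth_const K / e * (2 ^ k * t / t) ^ K * ?S v t"
          by (rule growth[OF v t]) (use kt[OF k] in auto)
        then have "?S v (2 ^ k * t) \<le> growth_const K / e * (2 ^ k) ^ K * s" using t by (simp add: s_def)
        then have "u k \<le> 2 / g * (growth_const K / e * (2 ^ k) ^ K * s)" unfolding u_def using g by (intro mult_left_mono) auto
        also have "\<dots> \<le> 2 / g0 * (growth_const K / e * (2 ^ k) ^ K * s)"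
          using g g0 growth_const_ge_1[of K] e s by (intro mult_right_mono divide_left_mono mult_nonneg_nonneg) auto
        finally show "u k \<le> cc * (2 ^ k) ^ K * s" by (simp add: cc_def mult_ac)
      qed
      define geo where "geo = 2 powr (K * \<alpha>) / (1 - 2 powr (K * \<alpha> - 1))"
      have 1: "u 0 powr \<alpha> \<le> cc powr \<alpha> * s powr \<alpha>"
      proof -
        have "u 0 powr \<alpha> \<le> (cc * s) powr \<alpha>" using u_bd[of 0] \<alpha> by (intro powr_mono2) auto
        then show ?thesis using cc s by (simp add: powr_mult)
      qed
      have 2: "(\<Sum>k<n. u (Suc k) powr \<alpha> / 2 ^ k) \<le> cc powr \<alpha> * geo * s powr \<alpha>"
        unfolding geo_def by (rule geometric_powr_sum[OF \<alpha> K(2) cc _ u_bd]) (use s in auto)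
      have 3: "1 / 2 ^ n \<le> s powr \<alpha>"
      proof -
        have "1 / 2 ^ n \<le> 2 * t / t0" using n(2) t0(1) by (simp add: field_simps)
        also have "\<dots> \<le> (c * t ^ K) powr \<alpha>" by (rule t3(3)[OF t tsmall])
        also have "\<dots> \<le> s powr \<alpha>"
          unfolding s_def using low[OF v t] kt(1)[of 0] c t \<alpha> by (intro powr_mono2) auto
        finally show ?thesis .
      qed
      have "norm (f (F 0) - f (F \<zeta>)) \<le> \<Lambda> * (2 * u 0 powr \<alpha> + 2 * (\<Sum>k<n. u (Suc k) powr \<alpha> / 2 ^ k) + 1 / 2 ^ n)"
        using chain by (simp add: algebra_simps sum_distrib_left)
      also have "\<dots> \<le> \<Lambda> * (2 * (cc powr \<alpha> * s powr \<alpha>) + 2 * (cc powr \<alpha> * geo * s powr \<alpha>) + s powr \<alpha>)"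
        using 1 2 3 \<Lambda> by (intro mult_left_mono add_mono) auto
      also have "\<dots> = \<Lambda> * estimate_const K \<alpha> g0 * s powr \<alpha>"
        unfolding estimate_const_def cc_def[unfolded e_def, symmetric] geo_def[symmetric] by (simp add: algebra_simps)
      finally show ?thesis unfolding pd nw s_def by (simp add: F_def \<zeta>(1))
    qed
  qed
qed

lemma lip_norm_bound:
  assumes \<Omega>: "bounded \<Omega>" and f: "f \<in> Lip \<alpha> \<Omega>" and \<alpha>: "0 < \<alpha>" and x: "x \<in> \<Omega>" "y \<in> \<Omega>"
  shows "cmod (f x - f y) \<le> lip_norm \<alpha> \<Omega> f * norm (x - y) powr \<alpha>"
proof -
  obtain C where C: "0 < C" "\<And>x y. x \<in> \<Omega> \<Longrightarrow> y \<in> \<Omega> \<Longrightarrow> cmod (f x - f y) \<le> C * norm (x - y) powr \<alpha>"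
    using f unfolding Lip_def by blast
  obtain d where d: "\<And>z. z \<in> \<Omega> \<Longrightarrow> norm z \<le> d" using \<Omega> unfolding bounded_iff by blast
  have "cmod (f z) \<le> cmod (f x) + C * (2 * d) powr \<alpha>" if z: "z \<in> \<Omega>" for z
  proof -
    have "norm (z - x) \<le> 2 * d" using norm_triangle_ineq4[of z x] d[OF z] d[OF x(1)] by simp
    then have "norm (z - x) powr \<alpha> \<le> (2 * d) powr \<alpha>" using \<alpha> by (intro powr_mono2) auto
    then have "C * norm (z - x) powr \<alpha> \<le> C * (2 * d) powr \<alpha>" using C(1) by simp
    then have "cmod (f z - f x) \<le> C * (2 * d) powr \<alpha>" using C(2)[OF z x(1)] by linarith
    then show ?thesis using norm_triangle_sub[of "f z" "f x"] by linarith
  qed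
  then have "bdd_above ((\<lambda>z. cmod (f z)) ` \<Omega>)" by (intro bdd_aboveI2) auto
  then have "cmod (f x) \<le> (SUP z\<in>\<Omega>. cmod (f z))" by (intro cSUP_upper x)
  then have 1: "0 \<le> (SUP z\<in>\<Omega>. cmod (f z))" by (rule order_trans[OF norm_ge_zero])
  show ?thesis
  proof (cases "x = y")
    case False
    let ?A = "{(x, y). x \<in> \<Omega> \<and> y \<in> \<Omega> \<and> x \<noteq> y}"
    let ?h = "\<lambda>(x, y). cmod (f x - f y) / norm (x - y) powr \<alpha>"
    have "?h p \<le> C" if "p \<in> ?A" for p
      using that C(2) by (auto simp: divide_le_eq)
    then have "bdd_above (?h ` ?A)" by (intro bdd_aboveI2) auto
    then have "?h (x, y) \<le> (SUP p\<in>?A. ?h p)" by (rule cSUP_upper[rotated]) (use x False in auto)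
    then have "cmod (f x - f y) / norm (x - y) powr \<alpha> \<le> lip_norm \<alpha> \<Omega> f"
      unfolding lip_norm_def using 1 by simp
    then show ?thesis using False by (simp add: divide_le_eq)
  qed simp
qed

text \<open>
  The order of contact is an integer, so the bound \<open>1 / \<alpha>\<close> can be replaced by the largest integer
  below it, which does not depend on the point \<open>Q\<close>.
\<close>
lemma vanishing_order_le_exponent:
  fixes r :: "complex^'n \<Rightarrow> real"
  assumes \<alpha>: "0 < \<alpha>" "ereal \<alpha> < 1 / regular_type r Q" and F: "regular_curve_at Q F"
  shows "vanishing_order (r \<circ> F) \<le> enat (nat \<lceil>1 / \<alpha>\<rceil> - 1)"
proof -
  let ?T = "regular_type r Q"
  have ge: "ereal_of_enat (vanishing_order (r \<circ> F)) \<le> ?T" by (rule regular_type_ge[OF F])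
  have "1 \<le> vanishing_order (r \<circ> F)"
    unfolding vanishing_order_def one_enat_def by (rule Sup_upper) auto
  then have "ereal_of_enat 1 \<le> ereal_of_enat (vanishing_order (r \<circ> F))" by (simp only: ereal_of_enat_le_iff)
  then have T1: "1 \<le> ?T" using ge by (simp add: one_enat_def one_ereal_def[symmetric])
  have "?T \<noteq> \<infinity>" using \<alpha> by auto
  then obtain T where T: "?T = ereal T" using T1 by (cases ?T) auto
  have Tpos: "1 \<le> T" using T1 T by simp
  have "\<alpha> < 1 / T" using \<alpha>(2) Tpos unfolding T by (simp add: one_ereal_def)
  then have T\<alpha>: "T < 1 / \<alpha>" using \<alpha>(1) Tpos by (simp add: field_simps)
  obtain m where m: "vanishing_order (r \<circ> F) = enat m"
    using ge T by (cases "vanishing_order (r \<circ> F)") auto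
  have "real m \<le> T" using ge unfolding T m by simp
  then have "real m < 1 / \<alpha>" using T\<alpha> by linarith
  then have "m < nat \<lceil>1 / \<alpha>\<rceil>" by linarith
  then show ?thesis unfolding m by simp
qed

text \<open>Complex lines are regular curves, and their order of contact is at least \<open>1\<close>.\<close>
lemma type_exponent_ge_1:
  fixes r :: "complex^'n \<Rightarrow> real"
  assumes \<alpha>: "0 < \<alpha>" "ereal \<alpha> < 1 / regular_type r Q"
  shows "1 \<le> nat \<lceil>1 / \<alpha>\<rceil> - 1"
proof -
  let ?F = "\<lambda>\<zeta>. Q + \<zeta> *s (\<chi> i. (1::complex))"
  have "regular_curve_at Q ?F"
    unfolding regular_curve_at_def
  proof (intro conjI)
    show "\<exists>e>0. \<forall>i. (\<lambda>\<zeta>. ?F \<zeta> $ i) holomorphic_on ball 0 e"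
      by (intro exI[of _ 1] conjI allI holomorphic_affine_component) simp
    have "deriv (\<lambda>\<zeta>. ?F \<zeta> $ i) 0 = 1" for i
      by (rule DERIV_imp_deriv) (auto intro!: derivative_eq_intros)
    then show "\<exists>i. deriv (\<lambda>\<zeta>. ?F \<zeta> $ i) 0 \<noteq> 0" by simp
  qed simp
  from vanishing_order_le_exponent[OF \<alpha> this] have "vanishing_order (r \<circ> ?F) \<le> enat (nat \<lceil>1 / \<alpha>\<rceil> - 1)" .
  moreover have "enat 1 \<le> vanishing_order (r \<circ> ?F)"
    unfolding vanishing_order_def by (rule Sup_upper) auto
  ultimately have "enat 1 \<le> enat (nat \<lceil>1 / \<alpha>\<rceil> - 1)" by (rule order_trans[rotated])
  then show ?thesis by simp
qed

theorem mainTheorem1: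
  fixes \<Omega> U :: "(complex^'n) set" and P :: "complex^'n"
    and r :: "complex^'n \<Rightarrow> real" and \<alpha> :: real
  assumes "CARD('n) > 1"
    and "smoothly_bounded_domain \<Omega>" and "pseudoconvex \<Omega>"
    and "P \<in> frontier \<Omega>"
    and "defining_function_near \<Omega> P r U"
    and "regular_type r P < \<infinity>"
    and "0 < \<alpha>" and "ereal \<alpha> < 1 / regular_type r P"
  shows "(\<exists>C :: real \<Rightarrow> real. (\<forall>s. C s > 0) \<and>
            (\<forall>f. holomorphic_fun_on f \<Omega> \<and> f \<in> Lip \<alpha> \<Omega> \<longrightarrow>
               tangential_estimate \<Omega> U r \<alpha> f P (C (lip_norm \<alpha> \<Omega> f))))
       \<and> ((\<exists>V M. open V \<and> P \<in> V \<and> V \<subseteq> U \<and>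
             (\<forall>Q \<in> frontier \<Omega> \<inter> V. regular_type r Q \<le> ereal M)) \<longrightarrow>
          (\<exists>V. open V \<and> P \<in> V \<and> V \<subseteq> U \<and>
            (\<exists>C :: real \<Rightarrow> real. (\<forall>s. C s > 0) \<and>
              (\<forall>Q \<in> frontier \<Omega> \<inter> V. ereal \<alpha> < 1 / regular_type r Q \<longrightarrow>
                (\<forall>f. holomorphic_fun_on f \<Omega> \<and> f \<in> Lip \<alpha> \<Omega> \<longrightarrow>
                   tangential_estimate \<Omega> U r \<alpha> f Q (C (lip_norm \<alpha> \<Omega> f)))))))"
proof -
  have \<Omega>: "open \<Omega>" "bounded \<Omega>" using assms(2) by (auto simp: smoothly_bounded_domain_def)
  have U: "open U" "P \<in> U" "smooth_on U r" and a: "gradient r P \<noteq> 0"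
    using assms(4,5) by (auto simp: defining_function_near_def)
  define K where "K = nat \<lceil>1 / \<alpha>\<rceil> - 1"
  have K1: "1 \<le> K" unfolding K_def by (rule type_exponent_ge_1[OF assms(7,8)])
  have "real K < 1 / \<alpha>" unfolding K_def using K1[unfolded K_def] by linarith
  then have K2: "K * \<alpha> < 1" using assms(7) by (simp add: field_simps)
  define g0 where "g0 = norm (gradient r P) / 2"
  have g0: "0 < g0" using a by (simp add: g0_def)
  obtain V where V: "open V" "P \<in> V" "V \<subseteq> U" "\<And>Q. Q \<in> V \<Longrightarrow> g0 \<le> norm (gradient r Q)"
  proof (rule that[of "U \<inter> gradient r -` {y. g0 < norm y}"])
    have "open {y :: complex^'n. g0 < norm y}" by (intro open_Collect_less continuous_intros)
    then show "open (U \<inter> gradient r -` {y. g0 < norm y})"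
      by (rule continuous_open_preimage[OF continuous_on_gradient[OF U(3)] U(1)])
  qed (use U a in \<open>auto simp: g0_def\<close>)
  define C where "C = (\<lambda>s. (\<bar>s\<bar> + 1) * estimate_const K \<alpha> g0)"
  have C: "C s > 0" for s
  proof -
    have "2 powr (K * \<alpha> - 1) < 1" using K2 powr_less_mono[of "K * \<alpha> - 1" 0 2] by simp
    then have "0 < estimate_const K \<alpha> g0"
      unfolding estimate_const_def by (intro add_nonneg_pos mult_nonneg_nonneg add_nonneg_nonneg divide_nonneg_nonneg) auto
    then show ?thesis by (simp add: C_def)
  qed
  have main: "tangential_estimate \<Omega> U r \<alpha> f Q (C (lip_norm \<alpha> \<Omega> f))"
    if Q: "Q \<in> frontier \<Omega> \<inter> V" and type: "ereal \<alpha> < 1 / regular_type r Q"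
      and f: "holomorphic_fun_on f \<Omega>" "f \<in> Lip \<alpha> \<Omega>" for Q f
    unfolding C_def
  proof (rule tangential_estimate_const[OF \<Omega>(1) assms(3)])
    show "Q \<in> frontier \<Omega>" "g0 \<le> norm (gradient r Q)" using Q V(4) by auto
    show "defining_function_near \<Omega> Q r U"
      using assms(5) Q V(3) unfolding defining_function_near_def by blast
    show "vanishing_order (r \<circ> F) \<le> enat K" if "regular_curve_at Q F" for F
      unfolding K_def by (rule vanishing_order_le_exponent[OF assms(7) type that])
    show "cmod (f x - f y) \<le> (\<bar>lip_norm \<alpha> \<Omega> f\<bar> + 1) * norm (x - y) powr \<alpha>" if "x \<in> \<Omega>" "y \<in> \<Omega>" for x y
      by (rule order_trans[OF lip_norm_bound[OF \<Omega>(2) f(2) assms(7) that] mult_right_mono]) auto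
  qed (use K1 K2 assms(7) g0 f in auto)
  have "P \<in> frontier \<Omega> \<inter> V" using assms(4) V(2) by blast
  then show ?thesis using main assms(8) C V(1-3) by blast
qed

end
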